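(* Let $M$ be a closed orientable surface of positive genus, or a manifold of dimension at least $3$ whose fundamental group modulo its centre admits infinitely many linearly independent homogeneous quasimorphisms. Then $$\dim H^2_{(1)}(\mathrm{Homeo}_0(M),\mathbb{R})=\infty .$$
   Context: $M$ is a smooth compact oriented connected manifold. $\mathrm{Homeo}_0(M)$ is the group of homeomorphisms of $M$ which are the identity on a neighbourhood of $\partial M$ and are isotopic to the identity, regarded as a discrete group. For a group $G$ and $p\le k$, a (not necessarily homogeneous) $k$-cochain $c\colon G^k\to\mathbb{R}$ in the standard inhomogeneous complex with trivial coefficients is called $p$-bounded if for any fixed $g_1,\dots,g_{k-p}\in G$ the function $(g_{k-p+1},\dots,g_k)\mapsto c(g_1,\dots,g_k)$ is bounded. The $p$-bounded cochains form a subcomplex, and its cohomology is denoted $H^*_{(p)}(G,\mathbb{R})$. A quasimorphism on a group $G$ is a function $\varphi\colon G\to\mathbb{R}$ with $\sup_{g,h}|\varphi(h)-\varphi(gh)+\varphi(g)|<\infty$; it is homogeneous if $\varphi(g^k)=k\varphi(g)$ for all $g\in G$, $k\in\mathbb{Z}$. *)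

theory Defs
  imports
    "HOL-Analysis.Analysis"
    "HOL-Algebra.Algebra"
    "HOL-Library.Extended_Nat"
    "Jordan_Normal_Form.Missing_VectorSpace"
begin

section \<open>Compact oriented smooth manifolds with boundary\<close>

text \<open>Meant for open \<open>S\<close>: all iterated directional derivatives up to order \<open>r\<close> exist,
  those of order below \<open>r\<close> are differentiable, and those of order \<open>r\<close> are continuous.\<close>

primrec times_continuously_differentiable_on ::
    "nat \<Rightarrow> ('a::real_normed_vector \<Rightarrow> 'b::real_normed_vector) \<Rightarrow> 'a set \<Rightarrow> bool" where
  "times_continuously_differentiable_on 0 f S \<longleftrightarrow> continuous_on S f"
| "times_continuously_differentiable_on (Suc r) f S \<longleftrightarrow>
     (\<forall>x\<in>S. f differentiable (at x)) \<and>
     (\<forall>v. times_continuously_differentiable_on r (\<lambda>x. frechet_derivative f (at x) v) S)"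

text \<open>On an arbitrary set (here: a relatively open subset of a half-space) a smooth map is one
  that extends, near each point, to a smooth map on an open set.\<close>

definition smooth_map_on ::
    "'a::real_normed_vector set \<Rightarrow> ('a \<Rightarrow> 'b::real_normed_vector) \<Rightarrow> bool" where
  "smooth_map_on S f \<longleftrightarrow>
     (\<forall>x\<in>S. \<exists>W F. open W \<and> x \<in> W \<and> (\<forall>r. times_continuously_differentiable_on r F W) \<and>
        (\<forall>y\<in>S \<inter> W. F y = f y))"

text \<open>The model space is the half-space on which the \<open>k\<close>-th coordinate is nonnegative.  The index
  \<open>k\<close> is arbitrary but the same for all charts.\<close>

definition half_space :: "'n \<Rightarrow> (real ^ 'n) set" where
  "half_space k = {x. 0 \<le> x $ k}"

definition manifold_chart ::
    "'n \<Rightarrow> 'm::topological_space set \<Rightarrow> 'm set \<times> ('m \<Rightarrow> real ^ 'n) \<Rightarrow> bool" where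
  "manifold_chart k M = (\<lambda>(U, \<phi>).
     openin (top_of_set M) U \<and>
     openin (top_of_set (half_space k)) (\<phi> ` U) \<and>
     (\<exists>\<psi>. homeomorphism U (\<phi> ` U) \<phi> \<psi>))"

text \<open>The derivative within the (relatively open) domain in the half-space is unique, also at
  boundary points.\<close>

definition oriented_compatible ::
    "'m set \<times> ('m \<Rightarrow> real ^ 'n) \<Rightarrow> 'm set \<times> ('m \<Rightarrow> real ^ 'n) \<Rightarrow> bool" where
  "oriented_compatible = (\<lambda>(U, \<phi>) (V, \<psi>).
     let S = \<phi> ` (U \<inter> V); \<tau> = \<psi> \<circ> inv_into U \<phi> in
       smooth_map_on S \<tau> \<and>
       (\<forall>x\<in>S. \<exists>D. (\<tau> has_derivative D) (at x within S) \<and> 0 < det (matrix D)))"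

definition oriented_smooth_atlas ::
    "'n \<Rightarrow> 'm::topological_space set \<Rightarrow> ('m set \<times> ('m \<Rightarrow> real ^ 'n)) set \<Rightarrow> bool" where
  "oriented_smooth_atlas k M \<A> \<longleftrightarrow>
     (\<forall>c\<in>\<A>. manifold_chart k M c) \<and>
     (\<Union>c\<in>\<A>. fst c) = M \<and>
     (\<forall>c\<in>\<A>. \<forall>d\<in>\<A>. oriented_compatible c d)"

text \<open>The Hausdorff property comes from the type class; second countability is automatic for a
  compact space covered by charts.\<close>

definition compact_connected_oriented_manifold ::
    "'n \<Rightarrow> 'm::t2_space set \<Rightarrow> ('m set \<times> ('m \<Rightarrow> real ^ 'n)) set \<Rightarrow> bool" where
  "compact_connected_oriented_manifold k M \<A> \<longleftrightarrow>
     oriented_smooth_atlas k M \<A> \<and> compact M \<and> connected M \<and> M \<noteq> {}"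

definition manifold_boundary ::
    "'n \<Rightarrow> ('m set \<times> ('m \<Rightarrow> real ^ 'n)) set \<Rightarrow> 'm set" where
  "manifold_boundary k \<A> = {x. \<exists>(U, \<phi>)\<in>\<A>. x \<in> U \<and> \<phi> x $ k = 0}"

text \<open>The genus of a surface: the largest number of pairwise disjoint simple closed curves that
  together do not separate it.\<close>

definition genus :: "'m::topological_space set \<Rightarrow> enat" where
  "genus M = Sup {enat (card \<C>) | \<C>. finite \<C> \<and> pairwise disjnt \<C> \<and>
     (\<forall>c\<in>\<C>. \<exists>p. simple_path p \<and> pathfinish p = pathstart p \<and> path_image p = c \<and> c \<subseteq> M) \<and>
     connected (M - \<Union>\<C>)}"

section \<open>The group of homeomorphisms isotopic to the identity\<close>

text \<open>A self-map of \<open>M\<close> is represented by the function on the whole type that is the identity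
  outside \<open>M\<close>.\<close>

definition homeos_rel_boundary ::
    "'n \<Rightarrow> 'm::topological_space set \<Rightarrow> ('m set \<times> ('m \<Rightarrow> real ^ 'n)) set \<Rightarrow> ('m \<Rightarrow> 'm) set" where
  "homeos_rel_boundary k M \<A> = {f.
     (\<exists>g. homeomorphism M M f g) \<and>
     (\<forall>x. x \<notin> M \<longrightarrow> f x = x) \<and>
     (\<exists>W. openin (top_of_set M) W \<and> manifold_boundary k \<A> \<subseteq> W \<and> (\<forall>x\<in>W. f x = x))}"

definition Homeo0 ::
    "'n \<Rightarrow> 'm::topological_space set \<Rightarrow> ('m set \<times> ('m \<Rightarrow> real ^ 'n)) set \<Rightarrow> ('m \<Rightarrow> 'm) monoid" where
  "Homeo0 k M \<A> =
     \<lparr>carrier = {f \<in> homeos_rel_boundary k M \<A>.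
        \<exists>H::real \<Rightarrow> 'm \<Rightarrow> 'm. continuous_on ({0..1} \<times> M) (\<lambda>(t, x). H t x) \<and>
          (\<forall>t\<in>{0..1}. H t \<in> homeos_rel_boundary k M \<A>) \<and> H 0 = id \<and> H 1 = f},
      mult = (\<circ>), one = id\<rparr>"

section \<open>The fundamental group and homogeneous quasimorphisms\<close>

definition fundamental_group ::
    "'m::topological_space set \<Rightarrow> 'm \<Rightarrow> (real \<Rightarrow> 'm) set monoid" where
  "fundamental_group M x =
     \<lparr>carrier = {p. path p \<and> path_image p \<subseteq> M \<and> pathstart p = x \<and> pathfinish p = x}
                  // {(p, q). homotopic_paths M p q},
      mult = (\<lambda>P Q. {r. \<exists>p\<in>P. \<exists>q\<in>Q. homotopic_paths M (p +++ q) r}),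
      one = {p. homotopic_paths M (\<lambda>_. x) p}\<rparr>"

definition group_centre :: "('g, 'b) monoid_scheme \<Rightarrow> 'g set" where
  "group_centre G = {z \<in> carrier G. \<forall>g\<in>carrier G. z \<otimes>\<^bsub>G\<^esub> g = g \<otimes>\<^bsub>G\<^esub> z}"

definition quasimorphism :: "('g, 'b) monoid_scheme \<Rightarrow> ('g \<Rightarrow> real) \<Rightarrow> bool" where
  "quasimorphism G \<phi> \<longleftrightarrow>
     (\<exists>B. \<forall>g\<in>carrier G. \<forall>h\<in>carrier G. \<bar>\<phi> h - \<phi> (g \<otimes>\<^bsub>G\<^esub> h) + \<phi> g\<bar> \<le> B)"

definition homogeneous_quasimorphism :: "('g, 'b) monoid_scheme \<Rightarrow> ('g \<Rightarrow> real) \<Rightarrow> bool" where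
  "homogeneous_quasimorphism G \<phi> \<longleftrightarrow>
     quasimorphism G \<phi> \<and>
     (\<forall>g\<in>carrier G. \<forall>k::int. \<phi> (g [^]\<^bsub>G\<^esub> k) = of_int k * \<phi> g)"

definition real_ring :: "real ring" where
  "real_ring = \<lparr>carrier = UNIV, mult = (*), one = 1, ring.zero = 0, add = (+)\<rparr>"

text \<open>The real vector space of all functions \<open>S \<rightarrow> \<real>\<close>, represented as in the library by functions
  that are \<open>undefined\<close> outside \<open>S\<close>.\<close>

abbreviation real_functions :: "'s set \<Rightarrow> (real, 's \<Rightarrow> real) module" where
  "real_functions S \<equiv> ring.func_space real_ring S"

definition infinitely_many_independent_homogeneous_quasimorphisms ::
    "('g, 'b) monoid_scheme \<Rightarrow> bool" where
  "infinitely_many_independent_homogeneous_quasimorphisms G \<longleftrightarrow>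
     (\<exists>\<Phi> \<subseteq> carrier (real_functions (carrier G)).
        infinite \<Phi> \<and> (\<forall>\<phi>\<in>\<Phi>. homogeneous_quasimorphism G \<phi>) \<and>
        \<not> LinearCombinations.module.lin_dep real_ring (real_functions (carrier G)) \<Phi>)"

section \<open>Cohomology of \<open>p\<close>-bounded cochains\<close>

definition tuples :: "('g, 'b) monoid_scheme \<Rightarrow> nat \<Rightarrow> 'g list set" where
  "tuples G k = {gs. length gs = k \<and> set gs \<subseteq> carrier G}"

text \<open>The inhomogeneous coboundary from degree \<open>k\<close> to degree \<open>k + 1\<close>,
  \<open>c(g_2,\<dots>,g_{k+1}) + \<Sum>_{i=1}^k (-1)^i c(g_1,\<dots>,g_i g_{i+1},\<dots>,g_{k+1}) + (-1)^{k+1} c(g_1,\<dots>,g_k)\<close>,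
  with the summation index shifted by one because list positions start at 0.\<close>

definition coboundary ::
    "('g, 'b) monoid_scheme \<Rightarrow> nat \<Rightarrow> ('g list \<Rightarrow> real) \<Rightarrow> 'g list \<Rightarrow> real" where
  "coboundary G k c = (\<lambda>gs\<in>tuples G (Suc k).
     c (tl gs)
     + (\<Sum>i<k. (- 1) ^ Suc i * c (take i gs @ [gs ! i \<otimes>\<^bsub>G\<^esub> gs ! Suc i] @ drop (i + 2) gs))
     + (- 1) ^ Suc k * c (take k gs))"

text \<open>Meant for \<open>p \<le> k\<close>.\<close>

definition bounded_cochains ::
    "('g, 'b) monoid_scheme \<Rightarrow> nat \<Rightarrow> nat \<Rightarrow> ('g list \<Rightarrow> real) set" where
  "bounded_cochains G p k = {c \<in> carrier (real_functions (tuples G k)).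
     \<forall>gs\<in>tuples G (k - p). \<exists>B. \<forall>hs\<in>tuples G p. \<bar>c (gs @ hs)\<bar> \<le> B}"

definition bounded_cocycles ::
    "('g, 'b) monoid_scheme \<Rightarrow> nat \<Rightarrow> nat \<Rightarrow> ('g list \<Rightarrow> real) set" where
  "bounded_cocycles G p k = {c \<in> bounded_cochains G p k. \<forall>gs\<in>tuples G (Suc k). coboundary G k c gs = 0}"

text \<open>The complex of \<open>p\<close>-bounded cochains starts in degree \<open>p\<close>.\<close>

definition bounded_coboundaries ::
    "('g, 'b) monoid_scheme \<Rightarrow> nat \<Rightarrow> nat \<Rightarrow> ('g list \<Rightarrow> real) set" where
  "bounded_coboundaries G p k =
     (if p < k then coboundary G (k - 1) ` bounded_cochains G p (k - 1)
      else {\<zero>\<^bsub>real_functions (tuples G k)\<^esub>})"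

text \<open>The quotient of a module by a submodule; the ring multiplication and unit of the record play
  no role.\<close>

definition quotient_module :: "('r, 'v, 'b) module_scheme \<Rightarrow> 'v set \<Rightarrow> ('r, 'v set) module" where
  "quotient_module V N =
     \<lparr>carrier = a_rcosets\<^bsub>V\<^esub> N, mult = (\<lambda>_ _. N), one = N,
      ring.zero = N, add = (\<lambda>C D. C <+>\<^bsub>V\<^esub> D),
      smult = (\<lambda>r C. \<Union>x\<in>C. N +>\<^bsub>V\<^esub> (r \<odot>\<^bsub>V\<^esub> x))\<rparr>"

definition bounded_cohomology ::
    "('g, 'b) monoid_scheme \<Rightarrow> nat \<Rightarrow> nat \<Rightarrow> (real, ('g list \<Rightarrow> real) set) module" where
  "bounded_cohomology G p k =
     quotient_module (real_functions (tuples G k)\<lparr>carrier := bounded_cocycles G p k\<rparr>)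
       (bounded_coboundaries G p k)"

end

theory Submission
  imports Defs
begin

text \<open>If \<open>f\<close> is a real function on a group such that \<open>h \<mapsto> f (g h) - f h\<close> is bounded for every \<open>g\<close>,
  then the coboundary of \<open>(1 + \<bar>f\<bar>) powr s\<close> with \<open>0 < s \<le> 1\<close> is a 1-bounded 2-cocycle.  If moreover
  \<open>f (p ^ n) = n w\<close> with \<open>w \<noteq> 0\<close>, then a linear combination of these functions with exponents
  \<open>1/2, 1/3, \<dots>\<close> can differ from a homomorphism by a bounded function only if it is trivial: evaluate it on
  the powers of \<open>p\<close>.  So one such \<open>f\<close> suffices.

  If the fundamental group modulo its centre has a nonzero homogeneous quasimorphism \<open>\<phi>\<close>, let \<open>f g\<close> be the
  value of \<open>\<phi>\<close> on the trajectory of an interior point under an isotopy from the identity to \<open>g\<close>, closed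
  up by paths from a locally finite system.  Changing the isotopy changes the loop by a central element.
  For \<open>p\<close> take the end of an isotopy that pushes the point around a loop on which \<open>\<phi>\<close> does not vanish.

  A closed surface of positive genus carries a map \<open>u\<close> to the punctured plane without a continuous
  logarithm, because a simple closed curve that does not separate has an intersection number with loops.
  Every \<open>g\<close> in the group satisfies \<open>u \<circ> g = u exp F\<close> for some \<open>F\<close>, unique up to a constant, and
  \<open>f g\<close> is the imaginary part of \<open>F x - F y\<close> for two fixed points.\<close>

subsection \<open>Quotient modules\<close>

text \<open>The class of the coboundary of \<open>q\<close> vanishes exactly when \<open>q\<close>
  is a bounded function plus a homomorphism. Post-composing \<open>f\<close> with a Lipschitz
  function keeps \<open>f (g h) - f h\<close> bounded in \<open>h\<close>, so one unbounded
  \<open>f\<close> feeds infinitely many cocycles. The exponents stay below 1 because a homomorphism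
  grows linearly along the powers of \<open>p\<close>: the exponent 1 is reserved for it, and growth
  rates then separate all terms.

  Two constructions of \<open>f\<close> are needed since a torus has abelian fundamental group, so
  nothing survives modulo the centre. On a surface the indeterminacy is an additive constant, which
  comparing two points cancels.

  In both constructions the bound on \<open>f (g h) - f h\<close> must be uniform over all positions
  to which \<open>h\<close> may carry the chosen points, and it comes from compactness of
  \<open>M\<close>. A logarithm is continuous, hence bounded. The class of a closed-up trajectory is
  not continuous in the starting point, because the closing paths jump; having only finitely many
  possible jumps near each point is the substitute.\<close>

lemma field_real_ring: "field real_ring"
proof -
  have "abelian_group real_ring"
  proof (rule abelian_groupI)
    fix x assume "x \<in> carrier real_ring"
    show "\<exists>y\<in>carrier real_ring. y \<oplus>\<^bsub>real_ring\<^esub> x = \<zero>\<^bsub>real_ring\<^esub>"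
      by (rule bexI[of _ "- x"]) (auto simp: real_ring_def)
  qed (auto simp: real_ring_def)
  then interpret cring real_ring
    by (intro cringI comm_monoidI) (auto simp: real_ring_def distrib_right)
  show ?thesis
  proof (rule cring_fieldI)
    show "Units real_ring = carrier real_ring - {\<zero>\<^bsub>real_ring\<^esub>}"
    proof -
      have "(\<exists>y. y * x = 1 \<and> x * y = 1) \<longleftrightarrow> x \<noteq> 0" for x :: real
        by (metis left_inverse right_inverse mult_zero_left zero_neq_one)
      then show ?thesis by (auto simp: Units_def real_ring_def)
    qed
  qed
qed

lemma carrier_real_ring [simp]: "carrier real_ring = UNIV"
  by (simp add: real_ring_def)

lemma real_ring_simps [simp]:
  "\<zero>\<^bsub>real_ring\<^esub> = 0" "\<one>\<^bsub>real_ring\<^esub> = 1" "x \<otimes>\<^bsub>real_ring\<^esub> y = x * y" "x \<oplus>\<^bsub>real_ring\<^esub> y = x + y"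
  by (simp_all add: real_ring_def)

lemma uminus_real_ring [simp]: "\<ominus>\<^bsub>real_ring\<^esub> x = - x"
proof -
  interpret field real_ring by (rule field_real_ring)
  show ?thesis by (rule minus_equality) auto
qed

context module
begin

lemma submodule_abelian_subgroup:
  assumes "submodule R N M"
  shows "abelian_subgroup N M"
proof (rule abelian_subgroupI3)
  interpret N: submodule R N M by fact
  show "abelian_group M" by unfold_locales
  show "additive_subgroup N M"
  proof (rule additive_subgroup.intro, rule add.subgroupI)
    show "N \<subseteq> carrier M" by (rule N.subset)
    show "N \<noteq> {}" using N.zero_closed by blast
    fix a assume a: "a \<in> N"
    then have "(\<ominus>\<^bsub>R\<^esub> \<one>\<^bsub>R\<^esub>) \<odot>\<^bsub>M\<^esub> a \<in> N" by (intro N.smult_closed) auto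
    then show "\<ominus>\<^bsub>M\<^esub> a \<in> N"
      using a N.subset smult_l_minus[of "\<one>\<^bsub>R\<^esub>" a] by (simp add: subsetD)
    fix b assume "b \<in> N"
    with a show "a \<oplus>\<^bsub>M\<^esub> b \<in> N" by simp
  qed
qed

text \<open>The scalar action of \<open>quotient_module\<close> is a union over all representatives.
  Since \<open>N\<close> is closed under scalars, each representative contributes the same coset and
  the union collapses.\<close>

lemma smult_coset:
  assumes N: "submodule R N M" and x: "x \<in> carrier M" and r: "r \<in> carrier R"
  shows "(\<Union>y\<in>N +>\<^bsub>M\<^esub> x. N +>\<^bsub>M\<^esub> (r \<odot>\<^bsub>M\<^esub> y)) = N +>\<^bsub>M\<^esub> (r \<odot>\<^bsub>M\<^esub> x)"
proof -
  interpret N: submodule R N M by fact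
  interpret S: abelian_subgroup N M by (rule submodule_abelian_subgroup[OF N])
  have "N +>\<^bsub>M\<^esub> (r \<odot>\<^bsub>M\<^esub> y) = N +>\<^bsub>M\<^esub> (r \<odot>\<^bsub>M\<^esub> x)" if y: "y \<in> N +>\<^bsub>M\<^esub> x" for y
  proof -
    obtain n where n: "n \<in> N" "y = n \<oplus>\<^bsub>M\<^esub> x" using y by (auto simp: a_r_coset_def')
    then have nc: "n \<in> carrier M" using N.subset by auto
    have "r \<odot>\<^bsub>M\<^esub> y = r \<odot>\<^bsub>M\<^esub> n \<oplus>\<^bsub>M\<^esub> r \<odot>\<^bsub>M\<^esub> x" using n nc x r by (simp add: smult_r_distr)
    moreover have "r \<odot>\<^bsub>M\<^esub> n \<in> N" using n r by simp
    ultimately have "r \<odot>\<^bsub>M\<^esub> y \<in> N +>\<^bsub>M\<^esub> (r \<odot>\<^bsub>M\<^esub> x)"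
      by (auto simp: a_r_coset_def')
    moreover have "subgroup N (add_monoid M)" by (rule S.a_subgroup)
    ultimately show ?thesis using a_repr_independence r x by (metis smult_closed)
  qed
  moreover have "x \<in> N +>\<^bsub>M\<^esub> x" using S.a_rcos_self x by simp
  ultimately show ?thesis by blast
qed

lemma quotient_module_simps:
  assumes N: "submodule R N M"
  shows "carrier (quotient_module M N) = (\<lambda>x. N +>\<^bsub>M\<^esub> x) ` carrier M"
    and "\<zero>\<^bsub>quotient_module M N\<^esub> = N +>\<^bsub>M\<^esub> \<zero>\<^bsub>M\<^esub>"
    and "\<And>x y. \<lbrakk>x \<in> carrier M; y \<in> carrier M\<rbrakk> \<Longrightarrow>
      (N +>\<^bsub>M\<^esub> x) \<oplus>\<^bsub>quotient_module M N\<^esub> (N +>\<^bsub>M\<^esub> y) = N +>\<^bsub>M\<^esub> (x \<oplus>\<^bsub>M\<^esub> y)"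
    and "\<And>r x. \<lbrakk>r \<in> carrier R; x \<in> carrier M\<rbrakk> \<Longrightarrow>
      r \<odot>\<^bsub>quotient_module M N\<^esub> (N +>\<^bsub>M\<^esub> x) = N +>\<^bsub>M\<^esub> (r \<odot>\<^bsub>M\<^esub> x)"
proof -
  interpret N: submodule R N M by fact
  interpret S: abelian_subgroup N M by (rule submodule_abelian_subgroup[OF N])
  show "carrier (quotient_module M N) = (\<lambda>x. N +>\<^bsub>M\<^esub> x) ` carrier M"
    by (auto simp: quotient_module_def A_RCOSETS_def')
  show "\<zero>\<^bsub>quotient_module M N\<^esub> = N +>\<^bsub>M\<^esub> \<zero>\<^bsub>M\<^esub>"
    using N.subset by (simp add: quotient_module_def a_coset_add_zero)
  fix x assume x: "x \<in> carrier M"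
  { fix y assume "y \<in> carrier M"
    with x show "(N +>\<^bsub>M\<^esub> x) \<oplus>\<^bsub>quotient_module M N\<^esub> (N +>\<^bsub>M\<^esub> y) = N +>\<^bsub>M\<^esub> (x \<oplus>\<^bsub>M\<^esub> y)"
      by (simp add: quotient_module_def S.a_rcos_sum) }
  { fix r assume "r \<in> carrier R"
    with x show "r \<odot>\<^bsub>quotient_module M N\<^esub> (N +>\<^bsub>M\<^esub> x) = N +>\<^bsub>M\<^esub> (r \<odot>\<^bsub>M\<^esub> x)"
      using smult_coset[OF N x] by (simp add: quotient_module_def) }
qed

lemma quotient_module_is_module:
  assumes N: "submodule R N M"
  shows "module R (quotient_module M N)"
proof (rule module_criteria)
  note [simp] = quotient_module_simps[OF N]
  show "cring R" by unfold_locales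
  show "\<forall>v\<in>carrier (quotient_module M N). \<exists>w\<in>carrier (quotient_module M N).
      v \<oplus>\<^bsub>quotient_module M N\<^esub> w = \<zero>\<^bsub>quotient_module M N\<^esub>"
  proof
    fix v assume "v \<in> carrier (quotient_module M N)"
    then obtain x where x: "x \<in> carrier M" "v = N +>\<^bsub>M\<^esub> x" by auto
    then show "\<exists>w\<in>carrier (quotient_module M N).
        v \<oplus>\<^bsub>quotient_module M N\<^esub> w = \<zero>\<^bsub>quotient_module M N\<^esub>"
      by (intro bexI[of _ "N +>\<^bsub>M\<^esub> (\<ominus>\<^bsub>M\<^esub> x)"]) (auto simp: r_neg)
  qed
qed (auto simp: quotient_module_simps[OF N] a_ac smult_assoc1 smult_l_distr smult_r_distr)

lemma finsum_quotient:
  assumes N: "submodule R N M" and "finite I" "z \<in> I \<rightarrow> carrier M"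
  shows "(\<Oplus>\<^bsub>quotient_module M N\<^esub>i\<in>I. N +>\<^bsub>M\<^esub> z i) = N +>\<^bsub>M\<^esub> (\<Oplus>\<^bsub>M\<^esub>i\<in>I. z i)"
  using assms(2,3)
proof (induction I rule: finite_induct)
  case empty
  interpret Q: module R "quotient_module M N" by (rule quotient_module_is_module[OF N])
  show ?case by (simp add: quotient_module_simps[OF N])
next
  case (insert i I)
  interpret Q: module R "quotient_module M N" by (rule quotient_module_is_module[OF N])
  from insert show ?case
    by (subst Q.finsum_insert) (auto simp: quotient_module_simps[OF N] Pi_def)
qed

end

text \<open>A relation between the cosets of the \<open>z i\<close> is a combination of the
  \<open>z i\<close> that lies in \<open>N\<close>, so \<open>indep\<close> yields an infinite
  independent set, which a finite-dimensional space cannot contain.\<close>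

lemma infinite_dim_quotient:
  fixes z :: "nat \<Rightarrow> 'v"
  assumes V: "module real_ring V" and N: "submodule real_ring N V"
    and z: "\<And>i. z i \<in> carrier V"
    and indep: "\<And>I d. \<lbrakk>finite I; (\<Oplus>\<^bsub>V\<^esub>i\<in>I. d i \<odot>\<^bsub>V\<^esub> z i) \<in> N\<rbrakk> \<Longrightarrow> \<forall>i\<in>I. d i = 0"
  shows "\<not> vectorspace.fin_dim real_ring (quotient_module V N)"
proof
  let ?Q = "quotient_module V N"
  let ?c = "\<lambda>i. N +>\<^bsub>V\<^esub> z i"
  interpret V: module real_ring V by fact
  interpret N: submodule real_ring N V by fact
  interpret S: abelian_subgroup N V by (rule V.submodule_abelian_subgroup[OF N])
  interpret Q: module real_ring ?Q by (rule V.quotient_module_is_module[OF N])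
  interpret QV: vectorspace real_ring ?Q
    by (intro vectorspace.intro Q.module_axioms field_real_ring)
  note qs = V.quotient_module_simps[OF N]
  assume fd: "vectorspace.fin_dim real_ring ?Q"
  have key: "\<forall>i\<in>I. d i = 0"
    if I: "finite I" and 0: "(\<Oplus>\<^bsub>?Q\<^esub>i\<in>I. d i \<odot>\<^bsub>?Q\<^esub> ?c i) = \<zero>\<^bsub>?Q\<^esub>" for I d
  proof (rule indep[OF I])
    have "(\<Oplus>\<^bsub>?Q\<^esub>i\<in>I. d i \<odot>\<^bsub>?Q\<^esub> ?c i) = (\<Oplus>\<^bsub>?Q\<^esub>i\<in>I. N +>\<^bsub>V\<^esub> (d i \<odot>\<^bsub>V\<^esub> z i))"
      using z by (intro Q.finsum_cong') (auto simp: qs)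
    also have "\<dots> = N +>\<^bsub>V\<^esub> (\<Oplus>\<^bsub>V\<^esub>i\<in>I. d i \<odot>\<^bsub>V\<^esub> z i)"
      using z by (intro V.finsum_quotient[OF N I]) auto
    finally have "N +>\<^bsub>V\<^esub> (\<Oplus>\<^bsub>V\<^esub>i\<in>I. d i \<odot>\<^bsub>V\<^esub> z i) = N"
      using 0 N.subset by (simp add: qs V.a_coset_add_zero)
    moreover have "(\<Oplus>\<^bsub>V\<^esub>i\<in>I. d i \<odot>\<^bsub>V\<^esub> z i) \<in> carrier V"
      using z by (intro V.finsum_closed) auto
    ultimately show "(\<Oplus>\<^bsub>V\<^esub>i\<in>I. d i \<odot>\<^bsub>V\<^esub> z i) \<in> N"
      using S.a_rcos_self by fastforce
  qed
  have cc: "?c i \<in> carrier ?Q" for i using z by (auto simp: qs)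
  \<comment> \<open>Independence is a property of sets and would not notice repeated cosets. Two
    equal cosets give a relation with coefficients 1 and -1.\<close>
  have inj: "inj ?c"
  proof (rule injI)
    fix i j assume eq: "?c i = ?c j"
    show "i = j"
    proof (rule ccontr)
      assume ij: "i \<noteq> j"
      define d where "d = (\<lambda>l. if l = i then 1 else - 1 :: real)"
      have "(\<Oplus>\<^bsub>?Q\<^esub>l\<in>{i,j}. d l \<odot>\<^bsub>?Q\<^esub> ?c l) = 1 \<odot>\<^bsub>?Q\<^esub> ?c j \<oplus>\<^bsub>?Q\<^esub> (- 1) \<odot>\<^bsub>?Q\<^esub> ?c j"
        using ij cc eq by (subst Q.finsum_insert) (auto simp: d_def Q.finsum_insert)
      also have "\<dots> = (1 \<oplus>\<^bsub>real_ring\<^esub> (- 1)) \<odot>\<^bsub>?Q\<^esub> ?c j"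
        using cc by (subst Q.smult_l_distr) auto
      also have "\<dots> = \<zero>\<^bsub>?Q\<^esub>" using Q.smult_l_null[OF cc[of j]] by simp
      finally have "\<forall>l\<in>{i,j}. d l = 0" by (intro key) auto
      then show False by (auto simp: d_def)
    qed
  qed
  have "Q.lin_indpt (range ?c)"
  proof
    assume "Q.lin_dep (range ?c)"
    then obtain A a v where A: "finite A" "A \<subseteq> range ?c" "Q.lincomb a A = \<zero>\<^bsub>?Q\<^esub>" "v \<in> A" "a v \<noteq> 0"
      by (auto simp: Q.lin_dep_def)
    obtain I where I: "A = ?c ` I" "finite I"
      using A(1,2) by (meson finite_subset_image)
    have "Q.lincomb a A = (\<Oplus>\<^bsub>?Q\<^esub>i\<in>I. a (?c i) \<odot>\<^bsub>?Q\<^esub> ?c i)"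
      unfolding Q.lincomb_def I(1) using cc inj
      by (subst Q.finsum_reindex) (auto intro: inj_on_subset)
    with A(3) have "\<forall>i\<in>I. a (?c i) = 0" by (intro key I) simp
    with A(4,5) I show False by auto
  qed
  then have "finite (range ?c)"
    using QV.fin_dim_li_fin[OF fd] cc by blast
  with inj show False using finite_imageD by blast
qed

subsection \<open>Growth\<close>

text \<open>Divide by the fastest growing power that has a nonzero coefficient: the sum tends to
  this coefficient, while the divided bound tends to 0.\<close>

lemma powr_sum_bounded_imp_zero:
  fixes e d :: "'i \<Rightarrow> real" and x :: "nat \<Rightarrow> real"
  assumes I: "finite I" and e: "inj_on e I" "\<And>i. i \<in> I \<Longrightarrow> 0 < e i"
    and x: "filterlim x at_top sequentially"
    and B: "\<And>n. \<bar>\<Sum>i\<in>I. d i * x n powr e i\<bar> \<le> B"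
  shows "\<forall>i\<in>I. d i = 0"
proof (rule ccontr)
  define J where "J = {i \<in> I. d i \<noteq> 0}"
  assume "\<not> ?thesis"
  then have "finite J" "J \<noteq> {}" using I by (auto simp: J_def)
  then obtain m where m: "m \<in> J" "e m = Max (e ` J)"
    using Max_in[of "e ` J"] by fastforce
  have lt: "e i < e m" if "i \<in> J - {m}" for i
  proof -
    have "e i \<le> e m" unfolding m(2) using \<open>finite J\<close> that by auto
    moreover have "e i \<noteq> e m" using e(1) that m(1) by (auto simp: inj_on_def J_def)
    ultimately show ?thesis by simp
  qed
  have pos: "\<forall>\<^sub>F n in sequentially. 0 < x n"
    using x by (rule filterlim_at_top_dense[THEN iffD1, rule_format])
  have lim: "(\<lambda>n. x n powr (- s)) \<longlonglongrightarrow> 0" if "0 < s" for s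
    using x that by (intro tendsto_neg_powr) auto
  have "(\<lambda>n. d m + (\<Sum>i\<in>J-{m}. d i * x n powr (- (e m - e i)))) \<longlonglongrightarrow> d m + (\<Sum>i\<in>J-{m}. d i * 0)"
    by (intro tendsto_intros lim) (use lt in auto)
  then have 1: "(\<lambda>n. d m + (\<Sum>i\<in>J-{m}. d i * x n powr (- (e m - e i)))) \<longlonglongrightarrow> d m" by simp
  have m0: "0 < e m" using e(2) m(1) by (auto simp: J_def)
  have "\<forall>\<^sub>F n in sequentially.
      norm (d m + (\<Sum>i\<in>J-{m}. d i * x n powr (- (e m - e i)))) \<le> B * x n powr (- e m)"
    using pos
  proof eventually_elim
    case (elim n)
    have "(\<Sum>i\<in>I. d i * x n powr e i) = (\<Sum>i\<in>J. d i * x n powr e i)"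
      by (rule sum.mono_neutral_right) (use I in \<open>auto simp: J_def\<close>)
    then have "x n powr (- e m) * (\<Sum>i\<in>I. d i * x n powr e i)
        = (\<Sum>i\<in>J. d i * x n powr (- (e m - e i)))"
      by (simp add: sum_distrib_left mult.left_commute flip: powr_add)
    also have "\<dots> = d m + (\<Sum>i\<in>J-{m}. d i * x n powr (- (e m - e i)))"
      using elim by (subst sum.remove[OF \<open>finite J\<close> m(1)]) simp
    finally have "norm (d m + (\<Sum>i\<in>J-{m}. d i * x n powr (- (e m - e i))))
        = norm (x n powr (- e m) * (\<Sum>i\<in>I. d i * x n powr e i))" by (rule arg_cong[OF sym])
    also have "\<dots> = x n powr (- e m) * \<bar>\<Sum>i\<in>I. d i * x n powr e i\<bar>"
      by (simp add: abs_mult)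
    also have "\<dots> \<le> x n powr (- e m) * B" by (intro mult_left_mono B) auto
    finally show ?case by (simp add: mult.commute)
  qed
  moreover have "(\<lambda>n. B * x n powr (- e m)) \<longlonglongrightarrow> 0"
    using tendsto_mult_left[OF lim[OF m0], of B] by simp
  ultimately have "(\<lambda>n. d m + (\<Sum>i\<in>J-{m}. d i * x n powr (- (e m - e i)))) \<longlonglongrightarrow> 0"
    by (rule Lim_null_comparison)
  with 1 have "d m = 0" by (rule LIMSEQ_unique)
  with m(1) show False by (simp add: J_def)
qed

text \<open>On arguments at least 1 the derivative of a power with exponent at most 1 is at most 1,
  and the summand 1 keeps the arguments there. The factorization with \<open>v / u\<close> replaces
  the derivative by monotonicity of powers in the exponent.\<close>

lemma powr_lipschitz:
  fixes s t a :: real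
  assumes a: "0 < a" "a \<le> 1"
  shows "\<bar>(1 + \<bar>s\<bar>) powr a - (1 + \<bar>t\<bar>) powr a\<bar> \<le> \<bar>s - t\<bar>"
proof -
  have *: "v powr a - u powr a \<le> v - u" if "1 \<le> u" "u \<le> v" for u v :: real
  proof -
    have 1: "(v / u) powr a \<le> (v / u) powr 1" using that a by (intro powr_mono) auto
    have 2: "u powr a \<le> u powr 1" using that a by (intro powr_mono) auto
    have "v powr a - u powr a = u powr a * ((v / u) powr a - 1)"
      using that by (simp add: powr_divide field_simps)
    also have "\<dots> \<le> u powr a * (v / u - 1)"
      using 1 that by (intro mult_left_mono) auto
    also have "\<dots> \<le> u * (v / u - 1)"
      using 2 that by (intro mult_right_mono) auto
    also have "\<dots> = v - u" using that by (simp add: field_simps)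
    finally show ?thesis .
  qed
  have **: "v powr a \<ge> u powr a" if "1 \<le> u" "u \<le> v" for u v :: real
    using that a by (intro powr_mono2) auto
  show ?thesis
  proof (cases "\<bar>s\<bar> \<le> \<bar>t\<bar>")
    case True
    then show ?thesis using *[of "1 + \<bar>s\<bar>" "1 + \<bar>t\<bar>"] **[of "1 + \<bar>s\<bar>" "1 + \<bar>t\<bar>"] by linarith
  next
    case False
    then show ?thesis using *[of "1 + \<bar>t\<bar>" "1 + \<bar>s\<bar>"] **[of "1 + \<bar>t\<bar>" "1 + \<bar>s\<bar>"] by linarith
  qed
qed

subsection \<open>Classes in the second cohomology\<close>

lemma tuples_simps:
  "[g] \<in> tuples G (Suc 0) \<longleftrightarrow> g \<in> carrier G"
  "[g, h] \<in> tuples G 2 \<longleftrightarrow> g \<in> carrier G \<and> h \<in> carrier G"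
  "[g, h, l] \<in> tuples G 3 \<longleftrightarrow> g \<in> carrier G \<and> h \<in> carrier G \<and> l \<in> carrier G"
  "tuples G 0 = {[]}"
  by (auto simp: tuples_def)

lemma tuples_1: "tuples G (Suc 0) = (\<lambda>g. [g]) ` carrier G"
  by (auto simp: tuples_def length_Suc_conv)

lemma in_tuples_2: "t \<in> tuples G 2 \<longleftrightarrow> (\<exists>g\<in>carrier G. \<exists>h\<in>carrier G. t = [g, h])"
  by (auto simp: tuples_def length_Suc_conv numeral_2_eq_2)

lemma in_tuples_3:
  "t \<in> tuples G 3 \<longleftrightarrow> (\<exists>g\<in>carrier G. \<exists>h\<in>carrier G. \<exists>l\<in>carrier G. t = [g, h, l])"
  by (auto simp: tuples_def length_Suc_conv numeral_3_eq_3)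

lemma coboundary_1:
  assumes "g \<in> carrier G" "h \<in> carrier G"
  shows "coboundary G (Suc 0) c [g, h] = c [h] - c [g \<otimes>\<^bsub>G\<^esub> h] + c [g]"
proof -
  have "[g, h] \<in> tuples G (Suc (Suc 0))" using assms by (auto simp: tuples_def)
  then show ?thesis by (simp add: coboundary_def)
qed

lemma coboundary_2:
  assumes "g \<in> carrier G" "h \<in> carrier G" "l \<in> carrier G"
  shows "coboundary G 2 c [g, h, l]
    = c [h, l] - c [g \<otimes>\<^bsub>G\<^esub> h, l] + c [g, h \<otimes>\<^bsub>G\<^esub> l] - c [g, h]"
proof -
  have "[g, h, l] \<in> tuples G (Suc 2)" using assms by (auto simp: tuples_def)
  then show ?thesis by (simp add: coboundary_def lessThan_Suc numeral_2_eq_2)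
qed

lemma real_functions_simps:
  "carrier (real_functions S) = extensional S"
  "\<zero>\<^bsub>real_functions S\<^esub> = (\<lambda>s\<in>S. 0)"
  "c \<oplus>\<^bsub>real_functions S\<^esub> c' = (\<lambda>s\<in>S. c s + c' s)"
  "r \<odot>\<^bsub>real_functions S\<^esub> c = (\<lambda>s\<in>S. r * c s)"
proof -
  interpret field real_ring by (rule field_real_ring)
  show "carrier (real_functions S) = extensional S"
    "\<zero>\<^bsub>real_functions S\<^esub> = (\<lambda>s\<in>S. 0)"
    "c \<oplus>\<^bsub>real_functions S\<^esub> c' = (\<lambda>s\<in>S. c s + c' s)"
    "r \<odot>\<^bsub>real_functions S\<^esub> c = (\<lambda>s\<in>S. r * c s)"
    by (auto simp: func_space_def PiE_def)
qed

lemma module_real_functions: "module real_ring (real_functions S)"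
proof -
  interpret field real_ring by (rule field_real_ring)
  show ?thesis by (rule func_space_is_module)
qed

lemma bounded_cochains_1:
  "bounded_cochains G (Suc 0) (Suc 0)
    = {b \<in> extensional (tuples G (Suc 0)). \<exists>B. \<forall>g\<in>carrier G. \<bar>b [g]\<bar> \<le> B}"
  by (auto simp: bounded_cochains_def real_functions_simps tuples_simps(4) tuples_1)

lemma bounded_cochains_2:
  "bounded_cochains G (Suc 0) 2
    = {c \<in> extensional (tuples G 2). \<forall>g\<in>carrier G. \<exists>B. \<forall>h\<in>carrier G. \<bar>c [g, h]\<bar> \<le> B}"
  by (auto simp: bounded_cochains_def real_functions_simps tuples_1)

lemma bounded_cocycles_2:
  "bounded_cocycles G (Suc 0) 2
    = {c \<in> extensional (tuples G 2). (\<forall>g\<in>carrier G. \<exists>B. \<forall>h\<in>carrier G. \<bar>c [g, h]\<bar> \<le> B) \<and>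
       (\<forall>g\<in>carrier G. \<forall>h\<in>carrier G. \<forall>l\<in>carrier G.
          c [h, l] - c [g \<otimes>\<^bsub>G\<^esub> h, l] + c [g, h \<otimes>\<^bsub>G\<^esub> l] - c [g, h] = 0)}"
proof -
  have 3: "Suc 2 = 3" by simp
  have "(\<forall>gs\<in>tuples G 3. coboundary G 2 c gs = 0) \<longleftrightarrow>
      (\<forall>g\<in>carrier G. \<forall>h\<in>carrier G. \<forall>l\<in>carrier G. coboundary G 2 c [g, h, l] = 0)" for c
    unfolding in_tuples_3 Ball_def by blast
  then show ?thesis
    unfolding bounded_cocycles_def bounded_cochains_2 3 by (auto simp: coboundary_2)
qed

lemma submodule_criterion_real_functions:
  assumes "N \<subseteq> extensional S" "(\<lambda>s\<in>S. 0) \<in> N"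
    "\<And>c c'. \<lbrakk>c \<in> N; c' \<in> N\<rbrakk> \<Longrightarrow> (\<lambda>s\<in>S. c s + c' s) \<in> N"
    "\<And>r c. c \<in> N \<Longrightarrow> (\<lambda>s\<in>S. r * c s) \<in> N"
  shows "submodule real_ring N (real_functions S)"
  using assms module_real_functions
  by (intro submodule.intro) (auto simp: real_functions_simps)

lemma finsum_real_functions:
  assumes "submodule real_ring Z (real_functions S)" "finite I" "\<And>i. i \<in> I \<Longrightarrow> z i \<in> Z"
  shows "(\<Oplus>\<^bsub>real_functions S\<lparr>carrier := Z\<rparr>\<^esub>i\<in>I. z i) = (\<lambda>s\<in>S. \<Sum>i\<in>I. z i s)"
  using assms(2,3)
proof (induction I rule: finite_induct)
  interpret F: module real_ring "real_functions S" by (rule module_real_functions)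
  interpret W: module real_ring "real_functions S\<lparr>carrier := Z\<rparr>"
    by (rule F.submodule_is_module[OF assms(1)])
  {
    case empty
    show ?case by (simp add: real_functions_simps)
  next
    case (insert i I)
    then show ?case
      by (subst W.finsum_insert) (auto simp: real_functions_simps restrict_def)
  }
qed

text \<open>The common end of both constructions. Only products in the carrier enter, so the
  hypotheses are those of a semigroup and the powers of \<open>p\<close> are given by their
  recursion.\<close>

lemma infinite_dim_H2:
  fixes f :: "'g \<Rightarrow> real" and P :: "nat \<Rightarrow> 'g"
  assumes closed: "\<And>g h. \<lbrakk>g \<in> carrier G; h \<in> carrier G\<rbrakk> \<Longrightarrow> g \<otimes>\<^bsub>G\<^esub> h \<in> carrier G"
    and assoc: "\<And>g h l. \<lbrakk>g \<in> carrier G; h \<in> carrier G; l \<in> carrier G\<rbrakk> \<Longrightarrow>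
      (g \<otimes>\<^bsub>G\<^esub> h) \<otimes>\<^bsub>G\<^esub> l = g \<otimes>\<^bsub>G\<^esub> (h \<otimes>\<^bsub>G\<^esub> l)"
    and f: "\<And>g. g \<in> carrier G \<Longrightarrow> \<exists>C. \<forall>h\<in>carrier G. \<bar>f (g \<otimes>\<^bsub>G\<^esub> h) - f h\<bar> \<le> C"
    and p: "p \<in> carrier G" and P: "\<And>n. P n \<in> carrier G" "\<And>n. P (Suc n) = p \<otimes>\<^bsub>G\<^esub> P n"
    and fP: "\<And>n. f (P n) = real n * w" and w: "w \<noteq> 0"
  shows "\<not> vectorspace.fin_dim real_ring (bounded_cohomology G 1 2)"
proof -
  let ?S = "tuples G 2" and ?Z = "bounded_cocycles G (Suc 0) 2"
  let ?N = "coboundary G (Suc 0) ` bounded_cochains G (Suc 0) (Suc 0)"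
  let ?V = "real_functions ?S\<lparr>carrier := ?Z\<rparr>"
  \<comment> \<open>Index 0 carries the exponent 1 and is kept for the homomorphism;
    \<open>\<psi> i\<close> uses index \<open>Suc i\<close>, that is, exponent
    \<open>1 / (i + 2)\<close>.\<close>
  define a where "a i = 1 / (real i + 1)" for i
  have a: "0 < a i" "a i \<le> 1" for i by (auto simp: a_def field_simps)
  define \<psi> where "\<psi> i t = (1 + \<bar>t\<bar>) powr a (Suc i)" for i t
  have \<psi>: "\<bar>\<psi> i s - \<psi> i t\<bar> \<le> \<bar>s - t\<bar>" for i s t
    unfolding \<psi>_def by (rule powr_lipschitz) (use a in auto)
  define q where "q i = (\<lambda>gs. \<psi> i (f (hd gs)))" for i
  define z where "z i = coboundary G (Suc 0) (q i)" for i
  have zval: "z i [g, h] = \<psi> i (f h) - \<psi> i (f (g \<otimes>\<^bsub>G\<^esub> h)) + \<psi> i (f g)"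
    if "g \<in> carrier G" "h \<in> carrier G" for i g h
    using that by (simp add: z_def q_def coboundary_1)
  have ext: "coboundary G (Suc 0) c \<in> extensional ?S" for c
    by (auto simp: coboundary_def numeral_2_eq_2)
  have Zsub: "submodule real_ring ?Z (real_functions ?S)"
  proof (rule submodule_criterion_real_functions)
    fix c c' assume "c \<in> ?Z" "c' \<in> ?Z"
    then have c: "\<And>g. g\<in>carrier G \<Longrightarrow> \<exists>B. \<forall>h\<in>carrier G. \<bar>c [g, h]\<bar> \<le> B"
      "\<And>g h l. \<lbrakk>g \<in> carrier G; h \<in> carrier G; l \<in> carrier G\<rbrakk> \<Longrightarrow>
        c [h, l] - c [g \<otimes>\<^bsub>G\<^esub> h, l] + c [g, h \<otimes>\<^bsub>G\<^esub> l] - c [g, h] = 0"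
      "\<And>g. g\<in>carrier G \<Longrightarrow> \<exists>B. \<forall>h\<in>carrier G. \<bar>c' [g, h]\<bar> \<le> B"
      "\<And>g h l. \<lbrakk>g \<in> carrier G; h \<in> carrier G; l \<in> carrier G\<rbrakk> \<Longrightarrow>
        c' [h, l] - c' [g \<otimes>\<^bsub>G\<^esub> h, l] + c' [g, h \<otimes>\<^bsub>G\<^esub> l] - c' [g, h] = 0"
      by (auto simp: bounded_cocycles_2)
    have "\<exists>B. \<forall>h\<in>carrier G. \<bar>c [g, h] + c' [g, h]\<bar> \<le> B" if "g \<in> carrier G" for g
    proof -
      obtain B B' where "\<forall>h\<in>carrier G. \<bar>c [g, h]\<bar> \<le> B" "\<forall>h\<in>carrier G. \<bar>c' [g, h]\<bar> \<le> B'"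
        using c(1,3) \<open>g \<in> carrier G\<close> by blast
      then show ?thesis by (intro exI[of _ "B + B'"]) (meson abs_triangle_ineq add_mono order_trans)
    qed
    moreover have "c [h, l] + c' [h, l] - (c [g \<otimes>\<^bsub>G\<^esub> h, l] + c' [g \<otimes>\<^bsub>G\<^esub> h, l])
        + (c [g, h \<otimes>\<^bsub>G\<^esub> l] + c' [g, h \<otimes>\<^bsub>G\<^esub> l]) - (c [g, h] + c' [g, h]) = 0"
      if "g \<in> carrier G" "h \<in> carrier G" "l \<in> carrier G" for g h l
      using c(2,4)[OF that] by linarith
    ultimately show "(\<lambda>s\<in>?S. c s + c' s) \<in> ?Z"
      using closed by (auto simp: bounded_cocycles_2 tuples_simps)
  next
    fix r c assume "c \<in> ?Z"
    then have c: "\<And>g. g\<in>carrier G \<Longrightarrow> \<exists>B. \<forall>h\<in>carrier G. \<bar>c [g, h]\<bar> \<le> B"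
      "\<And>g h l. \<lbrakk>g \<in> carrier G; h \<in> carrier G; l \<in> carrier G\<rbrakk> \<Longrightarrow>
        c [h, l] - c [g \<otimes>\<^bsub>G\<^esub> h, l] + c [g, h \<otimes>\<^bsub>G\<^esub> l] - c [g, h] = 0"
      by (auto simp: bounded_cocycles_2)
    have "\<exists>B. \<forall>h\<in>carrier G. \<bar>r * c [g, h]\<bar> \<le> B" if "g \<in> carrier G" for g
    proof -
      obtain B where "\<forall>h\<in>carrier G. \<bar>c [g, h]\<bar> \<le> B"
        using c(1) \<open>g \<in> carrier G\<close> by blast
      then show ?thesis
        by (intro exI[of _ "\<bar>r\<bar> * B"]) (auto simp: abs_mult intro!: mult_left_mono)
    qed
    moreover have "r * c [h, l] - r * c [g \<otimes>\<^bsub>G\<^esub> h, l] + r * c [g, h \<otimes>\<^bsub>G\<^esub> l] - r * c [g, h] = 0"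
      if "g \<in> carrier G" "h \<in> carrier G" "l \<in> carrier G" for g h l
    proof -
      have "r * c [h, l] - r * c [g \<otimes>\<^bsub>G\<^esub> h, l] + r * c [g, h \<otimes>\<^bsub>G\<^esub> l] - r * c [g, h]
        = r * (c [h, l] - c [g \<otimes>\<^bsub>G\<^esub> h, l] + c [g, h \<otimes>\<^bsub>G\<^esub> l] - c [g, h])"
        by (simp add: algebra_simps)
      then show ?thesis using c(2)[OF that] by simp
    qed
    ultimately show "(\<lambda>s\<in>?S. r * c s) \<in> ?Z"
      using closed by (auto simp: bounded_cocycles_2 tuples_simps)
  qed (use closed in \<open>auto simp: bounded_cocycles_2 tuples_simps\<close>)
  interpret F: module real_ring "real_functions ?S" by (rule module_real_functions)
  have V: "module real_ring ?V" by (rule F.submodule_is_module[OF Zsub])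
  \<comment> \<open>In a 1-bounded 2-cochain the first argument is fixed, so the term
    \<open>c [g]\<close> is a constant and only \<open>c [h] - c [g h]\<close> has to be bounded.
    The cocycle identity is associativity.\<close>
  have cobZ: "coboundary G (Suc 0) c \<in> ?Z"
    if bd: "\<And>g. g \<in> carrier G \<Longrightarrow> \<exists>B. \<forall>h\<in>carrier G. \<bar>c [h] - c [g \<otimes>\<^bsub>G\<^esub> h]\<bar> \<le> B" for c
  proof -
    have "\<exists>B. \<forall>h\<in>carrier G. \<bar>c [h] - c [g \<otimes>\<^bsub>G\<^esub> h] + c [g]\<bar> \<le> B" if g: "g \<in> carrier G" for g
    proof -
      obtain B where B: "\<forall>h\<in>carrier G. \<bar>c [h] - c [g \<otimes>\<^bsub>G\<^esub> h]\<bar> \<le> B"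
        using bd[OF g] by blast
      show ?thesis
      proof (intro exI[of _ "B + \<bar>c [g]\<bar>"] ballI)
        fix h assume "h \<in> carrier G"
        with B have "\<bar>c [h] - c [g \<otimes>\<^bsub>G\<^esub> h]\<bar> \<le> B" by blast
        then show "\<bar>c [h] - c [g \<otimes>\<^bsub>G\<^esub> h] + c [g]\<bar> \<le> B + \<bar>c [g]\<bar>" by linarith
      qed
    qed
    then show ?thesis
      using ext closed assoc by (auto simp: bounded_cocycles_2 coboundary_1)
  qed
  have z: "z i \<in> carrier ?V" for i
  proof -
    have "\<exists>B. \<forall>h\<in>carrier G. \<bar>\<psi> i (f h) - \<psi> i (f (g \<otimes>\<^bsub>G\<^esub> h))\<bar> \<le> B" if "g \<in> carrier G" for g
    proof -
      obtain C where "\<forall>h\<in>carrier G. \<bar>f (g \<otimes>\<^bsub>G\<^esub> h) - f h\<bar> \<le> C" using f \<open>g \<in> carrier G\<close> by blast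
      then have "\<bar>\<psi> i (f h) - \<psi> i (f (g \<otimes>\<^bsub>G\<^esub> h))\<bar> \<le> C" if "h \<in> carrier G" for h
        using that \<psi>[of i "f h" "f (g \<otimes>\<^bsub>G\<^esub> h)"] by (auto simp: abs_minus_commute intro: order_trans)
      then show ?thesis by blast
    qed
    then show ?thesis
      unfolding z_def by (simp, intro cobZ) (simp add: q_def)
  qed
  have N: "submodule real_ring ?N ?V"
  proof (rule submodule.intro[OF V])
    show "?N \<subseteq> carrier ?V"
    proof (clarsimp)
      fix b assume "b \<in> bounded_cochains G (Suc 0) (Suc 0)"
      then obtain B where B: "\<forall>g\<in>carrier G. \<bar>b [g]\<bar> \<le> B" by (auto simp: bounded_cochains_1)
      have "\<bar>b [h] - b [g \<otimes>\<^bsub>G\<^esub> h]\<bar> \<le> B + B" if "g \<in> carrier G" "h \<in> carrier G" for g h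
      proof -
        have "\<bar>b [h]\<bar> \<le> B" "\<bar>b [g \<otimes>\<^bsub>G\<^esub> h]\<bar> \<le> B" using B that closed by auto
        then show ?thesis by linarith
      qed
      then show "coboundary G (Suc 0) b \<in> ?Z" by (intro cobZ) blast
    qed
    have eqI: "c = coboundary G (Suc 0) b"
      if "c \<in> extensional ?S"
        "\<And>g h. \<lbrakk>g \<in> carrier G; h \<in> carrier G\<rbrakk> \<Longrightarrow> c [g, h] = b [h] - b [g \<otimes>\<^bsub>G\<^esub> h] + b [g]" for c b
      using that ext by (intro extensionalityI[of _ ?S]) (auto simp: in_tuples_2 coboundary_1)
    have "(\<lambda>s\<in>?S. 0) = coboundary G (Suc 0) (\<lambda>s\<in>tuples G (Suc 0). 0)"
      by (rule eqI) (auto simp: tuples_simps closed)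
    moreover have "(\<lambda>s\<in>tuples G (Suc 0). 0) \<in> bounded_cochains G (Suc 0) (Suc 0)"
      by (auto simp: bounded_cochains_1 tuples_simps)
    ultimately show "\<zero>\<^bsub>?V\<^esub> \<in> ?N" by (auto simp: real_functions_simps)
    fix c assume "c \<in> ?N"
    then obtain b B where b: "c = coboundary G (Suc 0) b" "b \<in> extensional (tuples G (Suc 0))"
      "\<forall>g\<in>carrier G. \<bar>b [g]\<bar> \<le> B" by (auto simp: bounded_cochains_1)
    { fix r
      let ?b = "\<lambda>s\<in>tuples G (Suc 0). r * b s"
      have "(\<lambda>s\<in>?S. r * c s) = coboundary G (Suc 0) ?b"
        by (rule eqI) (auto simp: tuples_simps closed b(1) coboundary_1 algebra_simps)
      moreover have "\<forall>g\<in>carrier G. \<bar>?b [g]\<bar> \<le> \<bar>r\<bar> * B"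
        using b(3) by (auto simp: tuples_simps abs_mult intro!: mult_left_mono)
      then have "?b \<in> bounded_cochains G (Suc 0) (Suc 0)"
        unfolding bounded_cochains_1 by blast
      ultimately show "r \<odot>\<^bsub>?V\<^esub> c \<in> ?N" by (auto simp: real_functions_simps) }
    { fix c' assume "c' \<in> ?N"
      then obtain b' B' where b': "c' = coboundary G (Suc 0) b'" "b' \<in> extensional (tuples G (Suc 0))"
        "\<forall>g\<in>carrier G. \<bar>b' [g]\<bar> \<le> B'" by (auto simp: bounded_cochains_1)
      let ?b = "\<lambda>s\<in>tuples G (Suc 0). b s + b' s"
      have "(\<lambda>s\<in>?S. c s + c' s) = coboundary G (Suc 0) ?b"
        by (rule eqI) (auto simp: tuples_simps closed b(1) b'(1) coboundary_1 algebra_simps)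
      moreover have "\<forall>g\<in>carrier G. \<bar>?b [g]\<bar> \<le> B + B'"
        using b(3) b'(3) by (auto simp: tuples_simps) (meson abs_triangle_ineq add_mono order_trans)
      then have "?b \<in> bounded_cochains G (Suc 0) (Suc 0)"
        unfolding bounded_cochains_1 by blast
      ultimately show "c \<oplus>\<^bsub>?V\<^esub> c' \<in> ?N" by (auto simp: real_functions_simps) }
  qed
  have "\<not> vectorspace.fin_dim real_ring (quotient_module ?V ?N)"
  proof (rule infinite_dim_quotient[OF V N z])
    fix I :: "nat set" and d
    assume I: "finite I" and "(\<Oplus>\<^bsub>?V\<^esub>i\<in>I. d i \<odot>\<^bsub>?V\<^esub> z i) \<in> ?N"
    moreover have "d i \<odot>\<^bsub>?V\<^esub> z i \<in> ?Z" for i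
      using module.smult_closed[OF V _ z, of "d i" i] by simp
    ultimately obtain b B where b: "\<forall>g\<in>carrier G. \<bar>b [g]\<bar> \<le> B"
      and eq: "(\<lambda>s\<in>?S. \<Sum>i\<in>I. (d i \<odot>\<^bsub>?V\<^esub> z i) s) = coboundary G (Suc 0) b"
      by (subst (asm) finsum_real_functions[OF Zsub I]) (auto simp: bounded_cochains_1)
    \<comment> \<open>The assumed relation says that this difference has zero coboundary, hence is
      additive and affine in \<open>n\<close> along \<open>P n\<close>.\<close>
    define \<tau> where "\<tau> g = (\<Sum>i\<in>I. d i * \<psi> i (f g)) - b [g]" for g
    have hom: "\<tau> (g \<otimes>\<^bsub>G\<^esub> h) = \<tau> g + \<tau> h" if "g \<in> carrier G" "h \<in> carrier G" for g h
    proof -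
      have "(\<Sum>i\<in>I. d i * z i [g, h]) = b [h] - b [g \<otimes>\<^bsub>G\<^esub> h] + b [g]"
        using fun_cong[OF eq, of "[g, h]"] that
        by (simp add: tuples_simps real_functions_simps coboundary_1)
      then show ?thesis
        using that by (simp add: zval \<tau>_def algebra_simps sum.distrib sum_subtractf)
    qed
    have \<tau>P: "\<tau> (P n) = \<tau> (P 0) + real n * \<tau> p" for n
      by (induction n) (auto simp: P hom p algebra_simps)
    \<comment> \<open>Since \<open>1 + \<bar>f (P n)\<bar>\<close> is \<open>x n\<close>, the linear
      part of \<open>\<tau> (P n)\<close> is \<open>\<tau> p / \<bar>w\<bar>\<close> times
      \<open>x n\<close>, up to a constant. Moving it to the other side makes it the coefficient of
      the exponent \<open>a 0 = 1\<close>; what remains is bounded.\<close>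
    define d' where "d' j = (case j of 0 \<Rightarrow> - \<tau> p / \<bar>w\<bar> | Suc i \<Rightarrow> d i)" for j
    define x where "x n = 1 + real n * \<bar>w\<bar>" for n
    have "\<forall>j\<in>insert 0 (Suc ` I). d' j = 0"
    proof (rule powr_sum_bounded_imp_zero)
      show "finite (insert 0 (Suc ` I))" using I by simp
      show "inj_on a (insert 0 (Suc ` I))" by (auto simp: inj_on_def a_def)
      show "0 < a i" for i by (rule a)
      show "filterlim x at_top sequentially"
        unfolding x_def using w
        by (intro filterlim_tendsto_add_at_top[OF tendsto_const]
            filterlim_at_top_mult_tendsto_pos[OF tendsto_const _ filterlim_real_sequentially]) auto
      fix n
      have x0: "0 < x n" by (auto simp: x_def intro: add_pos_nonneg)
      have "(\<Sum>j\<in>insert 0 (Suc ` I). d' j * x n powr a j)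
          = - \<tau> p / \<bar>w\<bar> * x n + (\<Sum>i\<in>I. d i * \<psi> i (f (P n)))"
        using I x0 by (simp add: sum.reindex d'_def a_def x_def \<psi>_def fP abs_mult)
      also have "\<dots> = - \<tau> p / \<bar>w\<bar> * x n + \<tau> (P 0) + real n * \<tau> p + b [P n]"
        using \<tau>P[of n] by (simp add: \<tau>_def)
      also have "\<dots> = - \<tau> p / \<bar>w\<bar> + \<tau> (P 0) + b [P n]"
        using w by (simp add: x_def field_simps)
      finally show "\<bar>\<Sum>j\<in>insert 0 (Suc ` I). d' j * x n powr a j\<bar>
          \<le> \<bar>- \<tau> p / \<bar>w\<bar> + \<tau> (P 0)\<bar> + B"
        using b P(1)[of n] abs_triangle_ineq[of "- \<tau> p / \<bar>w\<bar> + \<tau> (P 0)" "b [P n]"]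
        by fastforce
    qed
    then show "\<forall>i\<in>I. d i = 0" by (auto simp: d'_def)
  qed
  then show ?thesis by (simp add: bounded_cohomology_def bounded_coboundaries_def)
qed

subsection \<open>Pushing points inside open sets of Euclidean space\<close>

lemma continuous_on_open_cover2:
  assumes "openin (top_of_set S) A" "openin (top_of_set S) B" "S \<subseteq> A \<union> B"
    "continuous_on A f" "continuous_on B f"
  shows "continuous_on S f"
proof -
  have "A \<union> B = S" using assms openin_imp_subset by blast
  then show ?thesis using continuous_on_Un_local_open[of A B f] assms by simp
qed

text \<open>The displacement has Lipschitz constant at most \<open>norm d / r < 1\<close>, so
  solving for a preimage of \<open>y\<close> is the fixed point problem of a contraction.\<close>

lemma bij_translation_with_bump:
  fixes d :: "'a::euclidean_space"
  assumes r: "0 < r" "norm d < r" and t: "0 \<le> t" "t \<le> 1"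
  shows "bij (\<lambda>z. z + (t * max 0 (1 - dist z a / r)) *\<^sub>R d)"
proof -
  define c where "c z = (t * max 0 (1 - dist z a / r)) *\<^sub>R d" for z
  have lip: "dist (c z) (c w) \<le> (norm d / r) * dist z w" for z w
  proof -
    have "\<bar>max 0 (1 - dist z a / r) - max 0 (1 - dist w a / r)\<bar> \<le> \<bar>dist z a / r - dist w a / r\<bar>"
      by (auto simp: max_def)
    also have "\<dots> = \<bar>dist z a - dist w a\<bar> / r"
      using r by (simp add: diff_divide_distrib[symmetric])
    also have "\<dots> \<le> dist z w / r"
      using r by (intro divide_right_mono) (use abs_dist_diff_le[of z a w] in \<open>auto simp: dist_commute\<close>)
    finally have 1: "\<bar>max 0 (1 - dist z a / r) - max 0 (1 - dist w a / r)\<bar> \<le> dist z w / r" .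
    have "c z - c w = (t * (max 0 (1 - dist z a / r) - max 0 (1 - dist w a / r))) *\<^sub>R d"
      by (simp add: c_def algebra_simps)
    then have "dist (c z) (c w) = t * \<bar>max 0 (1 - dist z a / r) - max 0 (1 - dist w a / r)\<bar> * norm d"
      using t by (simp add: dist_norm abs_mult)
    also have "\<dots> \<le> 1 * (dist z w / r) * norm d"
      using t r 1 by (intro mult_right_mono mult_mono) auto
    finally show ?thesis by (simp add: mult.commute)
  qed
  have "\<exists>!z. z + c z = y" for y
  proof -
    have "\<exists>!z. y - c z = z"
      by (rule banach_fix_type[of "norm d / r"])
        (use r lip in \<open>auto simp: dist_norm norm_minus_commute\<close>)
    then show ?thesis by (metis diff_eq_eq)
  qed
  then show ?thesis unfolding c_def bij_iff by blast
qed

text \<open>An ambient isotopy with compact support in \<open>S\<close>. The compact support is what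
  allows extension by the identity from a chart to the whole manifold.\<close>

definition pushable :: "'a::euclidean_space set \<Rightarrow> 'a \<Rightarrow> 'a \<Rightarrow> bool" where
  "pushable S a b \<longleftrightarrow> (\<exists>H K. compact K \<and> K \<subseteq> S \<and>
     continuous_on ({0..1} \<times> UNIV) (\<lambda>(t::real, z). H t z) \<and>
     (\<forall>t\<in>{0..1}. bij (H t) \<and> (\<forall>z. z \<notin> K \<longrightarrow> H t z = z)) \<and> H 0 = id \<and> H 1 a = b)"

lemma pushable_near:
  assumes "ball a r \<subseteq> S" "dist a b < r / 4"
  shows "pushable S a b"
proof -
  have r: "0 < r" using assms(2) zero_le_dist[of a b] by linarith
  \<comment> \<open>The bump is 1 at \<open>a\<close>, so \<open>a\<close> travels straight to
    \<open>b\<close>. Its radius \<open>r/2\<close> keeps the closed support inside \<open>S\<close>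
    and exceeds \<open>dist a b\<close>, as the contraction argument requires.\<close>
  define H where "H t z = z + (t * max 0 (1 - dist z a / (r/2))) *\<^sub>R (b - a)" for t z
  show ?thesis unfolding pushable_def
  proof (intro exI[of _ H] exI[of _ "cball a (r/2)"] conjI ballI allI impI)
    show "cball a (r/2) \<subseteq> S" using assms(1) r by (force simp: subset_eq)
    show "continuous_on ({0..1} \<times> UNIV) (\<lambda>(t, z). H t z)"
      unfolding H_def split_beta using r by (intro continuous_intros) auto
    show "H 0 = id" "H 1 a = b" by (auto simp: H_def)
    fix t :: real assume t: "t \<in> {0..1}"
    show "bij (H t)"
      unfolding H_def using t r assms(2)
      by (intro bij_translation_with_bump) (auto simp: dist_norm norm_minus_commute)
    fix z assume "z \<notin> cball a (r/2)"
    then have "max 0 (1 - dist z a / (r/2)) = 0"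
      using r by (auto simp: max_def field_simps dist_commute)
    then show "H t z = z" by (simp add: H_def)
  qed auto
qed

text \<open>The isotopies are composed at each time instead of being run one after the other, which
  avoids gluing in time.\<close>

lemma pushable_trans:
  assumes "pushable S a b" "pushable S b c"
  shows "pushable S a c"
proof -
  obtain H K where H: "compact K" "K \<subseteq> S" "continuous_on ({0..1} \<times> UNIV) (\<lambda>(t::real, z). H t z)"
    "\<And>t. t\<in>{0..1} \<Longrightarrow> bij (H t)" "\<And>t z. \<lbrakk>t\<in>{0..1}; z \<notin> K\<rbrakk> \<Longrightarrow> H t z = z" "H 0 = id" "H 1 a = b"
    using assms(1) unfolding pushable_def by metis
  obtain H' K' where H': "compact K'" "K' \<subseteq> S" "continuous_on ({0..1} \<times> UNIV) (\<lambda>(t::real, z). H' t z)"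
    "\<And>t. t\<in>{0..1} \<Longrightarrow> bij (H' t)" "\<And>t z. \<lbrakk>t\<in>{0..1}; z \<notin> K'\<rbrakk> \<Longrightarrow> H' t z = z" "H' 0 = id" "H' 1 b = c"
    using assms(2) unfolding pushable_def by metis
  show ?thesis unfolding pushable_def
  proof (intro exI[of _ "\<lambda>t. H' t \<circ> H t"] exI[of _ "K \<union> K'"] conjI ballI allI impI)
    have "continuous_on ({0..1} \<times> UNIV) (\<lambda>x. (\<lambda>(t, z). H' t z) (fst x, (\<lambda>(t, z). H t z) x))"
      by (rule continuous_on_compose2[OF H'(3)]) (intro continuous_intros H(3), auto)
    then show "continuous_on ({0..1} \<times> UNIV) (\<lambda>(t, z). (H' t \<circ> H t) z)"
      by (simp add: split_beta)
  qed (use H H' in \<open>auto intro: bij_comp\<close>)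
qed

text \<open>Pushability in both directions is an equivalence relation with open classes, and a
  connected set has only one.\<close>

lemma pushable_connected_open:
  assumes "open S" "connected S" "a \<in> S" "b \<in> S"
  shows "pushable S a b"
proof -
  have "pushable S a b \<and> pushable S b a"
  proof (rule connected_equivalence_relation[OF assms(2-4), where R = "\<lambda>a b. pushable S a b \<and> pushable S b a"])
    fix a assume "a \<in> S"
    then obtain r where r: "0 < r" "ball a r \<subseteq> S" using assms(1) openE by blast
    \<comment> \<open>For the way back, the ball of radius \<open>r/2\<close> around
      \<open>c\<close> still lies in \<open>ball a r\<close>, and \<open>r/8\<close> is a quarter of
      \<open>r/2\<close>, the distance that \<open>pushable_near\<close> allows.\<close>
    have "pushable S a c \<and> pushable S c a" if "c \<in> ball a (r/8)" for c
    proof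
      show "pushable S a c" using that r by (intro pushable_near[of a r]) auto
      have "ball c (r/2) \<subseteq> ball a r"
      proof
        fix z assume "z \<in> ball c (r/2)"
        then show "z \<in> ball a r" using that r dist_triangle[of a z c] by auto
      qed
      then show "pushable S c a"
        using that r by (intro pushable_near[of c "r/2"]) (auto simp: dist_commute)
    qed
    moreover have "ball a (r/8) \<subseteq> ball a r" by (rule subset_ball) (use r in auto)
    then have "openin (top_of_set S) (ball a (r/8))" using r assms(1) by (auto simp: openin_open_eq)
    ultimately show "\<exists>T. openin (top_of_set S) T \<and> a \<in> T \<and> (\<forall>x\<in>T. pushable S a x \<and> pushable S x a)"
      using r by (intro exI[of _ "ball a (r/8)"]) auto
  qed (auto intro: pushable_trans)
  then show ?thesis ..
qed

subsection \<open>Charts, cells and isotopies\<close>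

locale compact_manifold =
  fixes k :: "'n::finite" and M :: "'m::t2_space set"
    and \<A> :: "('m set \<times> ('m \<Rightarrow> real ^ 'n)) set"
  assumes manifold: "compact_connected_oriented_manifold k M \<A>"
begin

abbreviation boundary :: "'m set" where
  "boundary \<equiv> manifold_boundary k \<A>"

definition isotopy :: "(real \<Rightarrow> 'm \<Rightarrow> 'm) \<Rightarrow> bool" where
  "isotopy H \<longleftrightarrow> continuous_on ({0..1} \<times> M) (\<lambda>(t, x). H t x) \<and>
     (\<forall>t\<in>{0..1}. H t \<in> homeos_rel_boundary k M \<A>) \<and> H 0 = id"

lemma compact_M: "compact M" and connected_M: "connected M" and M_nonempty: "M \<noteq> {}"
  using manifold by (auto simp: compact_connected_oriented_manifold_def)

lemma chart_inverse:
  assumes "(U, \<phi>) \<in> \<A>"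
  obtains \<psi> where "openin (top_of_set M) U" "openin (top_of_set (half_space k)) (\<phi> ` U)"
    "homeomorphism U (\<phi> ` U) \<phi> \<psi>"
  using assms manifold
  by (fastforce simp: compact_connected_oriented_manifold_def oriented_smooth_atlas_def manifold_chart_def)

lemma chart_subset: "(U, \<phi>) \<in> \<A> \<Longrightarrow> U \<subseteq> M"
  by (metis chart_inverse openin_imp_subset)

lemma chart_at:
  assumes "x \<in> M"
  obtains U \<phi> where "(U, \<phi>) \<in> \<A>" "x \<in> U"
proof -
  have "x \<in> (\<Union>c\<in>\<A>. fst c)"
    using assms manifold by (simp add: compact_connected_oriented_manifold_def oriented_smooth_atlas_def)
  then show ?thesis using that by auto
qed

lemma chart_coordinate_nonneg: "\<lbrakk>(U, \<phi>) \<in> \<A>; x \<in> U\<rbrakk> \<Longrightarrow> 0 \<le> \<phi> x $ k"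
  by (metis (mono_tags, lifting) chart_inverse openin_imp_subset imageI subsetD half_space_def mem_Collect_eq)

lemma boundary_subset: "boundary \<subseteq> M"
  by (auto simp: manifold_boundary_def dest: chart_subset)

lemma homeo_maps_M:
  assumes "f \<in> homeos_rel_boundary k M \<A>"
  shows "continuous_on M f" "f ` M = M" "inj_on f M"
  using assms unfolding homeos_rel_boundary_def homeomorphism_def
  by (auto simp: inj_on_def) metis+

lemma homeosI:
  assumes "continuous_on M f" "f ` M = M" "inj_on f M" "\<And>x. x \<notin> M \<Longrightarrow> f x = x"
    "openin (top_of_set M) W" "boundary \<subseteq> W" "\<And>x. x \<in> W \<Longrightarrow> f x = x"
  shows "f \<in> homeos_rel_boundary k M \<A>"
  using assms homeomorphism_compact[OF compact_M assms(1,2,3)]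
  unfolding homeos_rel_boundary_def by blast

lemma homeos_id: "id \<in> homeos_rel_boundary k M \<A>"
  by (rule homeosI[of _ M]) (auto simp: boundary_subset)

lemma homeos_comp:
  assumes "f \<in> homeos_rel_boundary k M \<A>" "g \<in> homeos_rel_boundary k M \<A>"
  shows "f \<circ> g \<in> homeos_rel_boundary k M \<A>"
proof -
  note f = homeo_maps_M[OF assms(1)] and g = homeo_maps_M[OF assms(2)]
  obtain V W where V: "openin (top_of_set M) V" "boundary \<subseteq> V" "\<And>x. x \<in> V \<Longrightarrow> f x = x"
    and W: "openin (top_of_set M) W" "boundary \<subseteq> W" "\<And>x. x \<in> W \<Longrightarrow> g x = x"
    using assms by (fastforce simp: homeos_rel_boundary_def)
  show ?thesis
  proof (rule homeosI[of _ "V \<inter> W"])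
    show "continuous_on M (f \<circ> g)" using continuous_on_compose[OF g(1)] f g by metis
    show "(f \<circ> g) ` M = M" using f g by (metis image_comp)
    show "inj_on (f \<circ> g) M" using f g by (simp add: comp_inj_on)
    show "(f \<circ> g) x = x" if "x \<notin> M" for x
      using that assms by (simp add: homeos_rel_boundary_def)
  qed (use V W in \<open>auto simp: openin_Int\<close>)
qed

lemma isotopyD:
  assumes "isotopy H"
  shows "continuous_on ({0..1} \<times> M) (\<lambda>(t, x). H t x)" "H 0 = id"
    "\<And>t. t \<in> {0..1} \<Longrightarrow> H t \<in> homeos_rel_boundary k M \<A>"
    "\<And>t x. \<lbrakk>t \<in> {0..1}; x \<in> M\<rbrakk> \<Longrightarrow> H t x \<in> M"
proof -
  show 1: "continuous_on ({0..1} \<times> M) (\<lambda>(t, x). H t x)" "H 0 = id"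
    "\<And>t. t \<in> {0..1} \<Longrightarrow> H t \<in> homeos_rel_boundary k M \<A>"
    using assms by (auto simp: isotopy_def)
  show "\<And>t x. \<lbrakk>t \<in> {0..1}; x \<in> M\<rbrakk> \<Longrightarrow> H t x \<in> M"
    using homeo_maps_M(2)[OF 1(3)] by blast
qed

lemma isotopy_id: "isotopy (\<lambda>_. id)"
  by (auto simp: isotopy_def homeos_id split_beta intro!: continuous_intros)

lemma isotopy_comp:
  assumes "isotopy H" "isotopy H'"
  shows "isotopy (\<lambda>t. H t \<circ> H' t)"
proof -
  note H = isotopyD[OF assms(1)] and H' = isotopyD[OF assms(2)]
  have "continuous_on ({0..1} \<times> M) (\<lambda>x. (\<lambda>(t, z). H t z) (fst x, (\<lambda>(t, z). H' t z) x))"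
    by (rule continuous_on_compose2[OF H(1)]) (intro continuous_intros H'(1), use H' in auto)
  then show ?thesis
    using H H' by (auto simp: isotopy_def split_beta intro!: homeos_comp)
qed

lemma carrier_Homeo0: "carrier (Homeo0 k M \<A>) = {H 1 | H. isotopy H}"
  by (fastforce simp: Homeo0_def isotopy_def)

lemma mult_Homeo0 [simp]: "f \<otimes>\<^bsub>Homeo0 k M \<A>\<^esub> g = f \<circ> g"
  by (simp add: Homeo0_def)

lemma Homeo0_comp:
  "\<lbrakk>f \<in> carrier (Homeo0 k M \<A>); g \<in> carrier (Homeo0 k M \<A>)\<rbrakk> \<Longrightarrow> f \<circ> g \<in> carrier (Homeo0 k M \<A>)"
proof -
  assume "f \<in> carrier (Homeo0 k M \<A>)" "g \<in> carrier (Homeo0 k M \<A>)"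
  then obtain H H' where H: "isotopy H" "f = H 1" and H': "isotopy H'" "g = H' 1"
    by (auto simp: carrier_Homeo0)
  have "f \<circ> g = (\<lambda>t. H t \<circ> H' t) 1" using H H' by simp
  then show ?thesis unfolding carrier_Homeo0
    using isotopy_comp[OF H(1) H'(1)] by (intro CollectI exI[of _ "\<lambda>t. H t \<circ> H' t"]) simp
qed

lemma Homeo0_id: "id \<in> carrier (Homeo0 k M \<A>)"
  by (auto simp: carrier_Homeo0 intro!: exI[of _ "\<lambda>_. id"] isotopy_id)

lemma Homeo0_maps:
  assumes "f \<in> carrier (Homeo0 k M \<A>)"
  shows "x \<in> M \<Longrightarrow> f x \<in> M" "continuous_on M f"
proof -
  have "f \<in> homeos_rel_boundary k M \<A>" using assms by (auto simp: carrier_Homeo0 intro: isotopyD(3))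
  then show "x \<in> M \<Longrightarrow> f x \<in> M" "continuous_on M f" using homeo_maps_M by blast+
qed

text \<open>By invariance of domain the coordinate change sends a Euclidean neighbourhood of
  \<open>\<phi> x\<close> to an open set. That set lies in the closed half-space, so
  \<open>\<theta> x\<close> cannot be on the bounding hyperplane: a small step outwards would leave
  the half-space.\<close>

lemma positive_coordinate_invariant:
  assumes U: "(U, \<phi>) \<in> \<A>" and V: "(V, \<theta>) \<in> \<A>" and x: "x \<in> U" "x \<in> V" and pos: "0 < \<phi> x $ k"
  shows "0 < \<theta> x $ k"
proof -
  obtain \<psi> where \<psi>: "openin (top_of_set M) U" "openin (top_of_set (half_space k)) (\<phi> ` U)"
    "homeomorphism U (\<phi> ` U) \<phi> \<psi>" by (rule chart_inverse[OF U])
  obtain \<theta>' where \<theta>: "openin (top_of_set M) V" "openin (top_of_set (half_space k)) (\<theta> ` V)"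
    "homeomorphism V (\<theta> ` V) \<theta> \<theta>'" by (rule chart_inverse[OF V])
  have "openin (top_of_set U) (U \<inter> V)"
    using \<psi>(1) \<theta>(1) by (meson openin_Int openin_subset_trans inf_le1 openin_imp_subset)
  then have "openin (top_of_set (\<phi> ` U)) (\<phi> ` (U \<inter> V))"
    using homeomorphism_imp_open_map[OF \<psi>(3)] by blast
  then have "openin (top_of_set (half_space k)) (\<phi> ` (U \<inter> V))"
    using \<psi>(2) openin_trans by blast
  then obtain T where T: "open T" "\<phi> ` (U \<inter> V) = half_space k \<inter> T"
    by (auto simp: openin_open)
  define B where "B = T \<inter> {y. 0 < y $ k}"
  have "open {y::real^'n. 0 < y $ k}" by (rule open_halfspace_component_gt_cart)
  then have B: "open B" "\<phi> x \<in> B" "B \<subseteq> \<phi> ` (U \<inter> V)"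
    using T x pos by (auto simp: B_def half_space_def)
  have B\<psi>: "\<psi> ` B \<subseteq> U \<inter> V" using B(3) \<psi>(3) by (auto simp: homeomorphism_def)
  have "open ((\<theta> \<circ> \<psi>) ` B)"
  proof (rule invariance_of_domain_gen)
    have "continuous_on B \<psi>"
      using \<psi>(3) B(3) by (meson continuous_on_subset homeomorphism_cont2 image_mono inf_le1)
    moreover have "continuous_on (\<psi> ` B) \<theta>"
      using \<theta>(3) B\<psi> by (meson continuous_on_subset homeomorphism_cont1 le_inf_iff)
    ultimately show "continuous_on B (\<theta> \<circ> \<psi>)" by (rule continuous_on_compose)
    have "inj_on \<psi> B" using \<psi>(3) B(3) by (metis homeomorphism_def inj_on_inverseI inj_on_subset image_mono inf_le1)
    moreover have "inj_on \<theta> (\<psi> ` B)" using \<theta>(3) B\<psi> by (metis homeomorphism_def inj_on_inverseI inj_on_subset le_inf_iff)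
    ultimately show "inj_on (\<theta> \<circ> \<psi>) B" by (rule comp_inj_on)
  qed (use B in auto)
  moreover have "(\<theta> \<circ> \<psi>) (\<phi> x) = \<theta> x" using \<psi>(3) x by (simp add: homeomorphism_def)
  then have "\<theta> x \<in> (\<theta> \<circ> \<psi>) ` B" using B(2) by (metis imageI)
  ultimately obtain e where e: "0 < e" "cball (\<theta> x) e \<subseteq> (\<theta> \<circ> \<psi>) ` B"
    using open_contains_cball by blast
  have "(\<theta> \<circ> \<psi>) ` B \<subseteq> {y. 0 \<le> y $ k}"
    using B\<psi> chart_coordinate_nonneg[OF V] by auto
  moreover have "\<theta> x - e *\<^sub>R axis k 1 \<in> cball (\<theta> x) e"
    using e by (simp add: dist_norm)
  ultimately have "0 \<le> (\<theta> x - e *\<^sub>R axis k 1) $ k" using e(2) by blast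
  then show ?thesis using e(1) by simp
qed

lemma not_boundary_iff:
  assumes "(U, \<phi>) \<in> \<A>" "x \<in> U"
  shows "x \<notin> boundary \<longleftrightarrow> 0 < \<phi> x $ k"
proof
  assume "x \<notin> boundary"
  then show "0 < \<phi> x $ k"
    using chart_coordinate_nonneg[OF assms] assms by (force simp: manifold_boundary_def)
next
  assume "0 < \<phi> x $ k"
  then show "x \<notin> boundary"
    using positive_coordinate_invariant[OF assms(1) _ assms(2)] by (force simp: manifold_boundary_def)
qed

text \<open>A compactly supported Euclidean isotopy is transported by the chart and extended by the
  identity. As \<open>K\<close> is compact in a Hausdorff space, \<open>V\<close> and
  \<open>M - K\<close> form an open cover on which continuity is checked. Positivity of the
  \<open>k\<close>-th coordinate on \<open>T\<close> keeps \<open>K\<close> away from the boundary,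
  so \<open>M - K\<close> is the neighbourhood on which nothing moves.\<close>

lemma isotopy_push_chart:
  assumes U: "(U, \<phi>) \<in> \<A>" and T: "open T" "connected T" "T \<subseteq> \<phi> ` U" "T \<subseteq> {y. 0 < y $ k}"
    and p: "p \<in> U" "\<phi> p \<in> T" and q: "q \<in> U" "\<phi> q \<in> T"
  obtains H K where "isotopy H" "compact K" "K \<subseteq> {z\<in>U. \<phi> z \<in> T}"
    "\<And>t z. \<lbrakk>t \<in> {0..1}; z \<notin> K\<rbrakk> \<Longrightarrow> H t z = z" "H 1 p = q"
proof -
  obtain \<psi> where \<psi>: "openin (top_of_set M) U" "homeomorphism U (\<phi> ` U) \<phi> \<psi>"
    by (rule chart_inverse[OF U])
  obtain G L where G: "compact L" "L \<subseteq> T" "continuous_on ({0..1} \<times> UNIV) (\<lambda>(t::real, z). G t z)"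
    "\<And>t. t\<in>{0..1} \<Longrightarrow> bij (G t)" "\<And>t z. \<lbrakk>t\<in>{0..1}; z \<notin> L\<rbrakk> \<Longrightarrow> G t z = z" "G 0 = id" "G 1 (\<phi> p) = \<phi> q"
    using pushable_connected_open[OF T(1,2) p(2) q(2)] unfolding pushable_def by metis
  define V where "V = {z\<in>U. \<phi> z \<in> T}"
  define K where "K = \<psi> ` L"
  define H where "H t z = (if z \<in> V then \<psi> (G t (\<phi> z)) else z)" for t z
  have \<psi>\<phi>: "\<psi> (\<phi> z) = z" if "z \<in> U" for z using \<psi>(2) that by (simp add: homeomorphism_def)
  have \<phi>\<psi>: "\<phi> (\<psi> y) = y" "\<psi> y \<in> U" if "y \<in> T" for y using \<psi>(2) T(3) that by (auto simp: homeomorphism_def)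
  have V\<psi>: "V = \<psi> ` T" using \<phi>\<psi> \<psi>\<phi> by (force simp: V_def)
  have cont\<psi>: "continuous_on T \<psi>" and cont\<phi>: "continuous_on V \<phi>"
    using \<psi>(2) T(3) by (auto simp: homeomorphism_def V_def intro: continuous_on_subset)
  have VM: "V \<subseteq> M" using chart_subset[OF U] by (auto simp: V_def)
  have "openin (top_of_set U) (U \<inter> \<phi> -` T)"
    using \<psi>(2) T(1) by (meson continuous_openin_preimage_gen homeomorphism_cont1)
  then have Vop: "openin (top_of_set M) V"
    using \<psi>(1) openin_trans by (simp add: V_def Collect_conj_eq vimage_def)
  have KV: "K \<subseteq> V" using G(2) V\<psi> by (auto simp: K_def)
  have compK: "compact K" unfolding K_def using G(1,2) cont\<psi> compact_continuous_image continuous_on_subset by blast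
  have MKop: "openin (top_of_set M) (M - K)"
    using compact_imp_closed[OF compK] by (metis Diff_eq open_Compl openin_open_Int)
  \<comment> \<open>A bijection that fixes every point outside \<open>T\<close> preserves
    \<open>T\<close>: a point leaving \<open>T\<close> would share its image with a fixed
    point.\<close>
  have GT: "G t y \<in> T \<longleftrightarrow> y \<in> T" if "t \<in> {0..1}" for t y
  proof
    assume "y \<in> T"
    show "G t y \<in> T"
    proof (rule ccontr)
      assume "G t y \<notin> T"
      then have "G t (G t y) = G t y" using G(2,5) that by blast
      then have "G t y = y" using G(4)[OF that] by (simp add: bij_def inj_eq)
      then show False using \<open>y \<in> T\<close> \<open>G t y \<notin> T\<close> by simp
    qed
  next
    assume "G t y \<in> T" then show "y \<in> T" using G(2,5) that by (metis subsetD)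
  qed
  have Hout: "H t z = z" if "t \<in> {0..1}" "z \<notin> K" for t z
  proof (cases "z \<in> V")
    case True
    then have "\<phi> z \<notin> L" using that \<psi>\<phi> by (force simp: K_def V_def)
    then show ?thesis using True \<psi>\<phi> G(5) that by (simp add: H_def V_def)
  qed (simp add: H_def)
  have HV: "H t z \<in> V \<longleftrightarrow> z \<in> V" if "t \<in> {0..1}" for t z
    using GT[OF that] \<phi>\<psi> by (auto simp: H_def V_def)
  have cont: "continuous_on ({0..1} \<times> M) (\<lambda>(t, z). H t z)"
  proof (rule continuous_on_open_cover2)
    show "openin (top_of_set ({0..1::real} \<times> M)) ({0..1} \<times> V)"
      "openin (top_of_set ({0..1::real} \<times> M)) ({0..1} \<times> (M - K))"
      using Vop MKop by (auto intro: openin_Times)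
    show "{0..1::real} \<times> M \<subseteq> {0..1} \<times> V \<union> {0..1} \<times> (M - K)" using KV by auto
    have "continuous_on ({0..1} \<times> V) (\<lambda>x. (\<lambda>(t, z). G t z) (fst x, \<phi> (snd x)))"
      by (rule continuous_on_compose2[OF G(3)])
        (auto intro!: continuous_intros continuous_on_compose2[OF cont\<phi>])
    then have "continuous_on ({0..1} \<times> V) (\<lambda>x. \<psi> ((\<lambda>(t, z). G t z) (fst x, \<phi> (snd x))))"
      by (rule continuous_on_compose2[OF cont\<psi>]) (use GT in \<open>auto simp: V_def\<close>)
    then show "continuous_on ({0..1} \<times> V) (\<lambda>(t, z). H t z)"
      by (rule continuous_on_eq) (auto simp: H_def)
    have "continuous_on ({0..1::real} \<times> (M - K)) snd" by (intro continuous_intros)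
    then show "continuous_on ({0..1} \<times> (M - K)) (\<lambda>(t, z). H t z)"
      by (rule continuous_on_eq) (auto simp: Hout)
  qed
  have homeo: "H t \<in> homeos_rel_boundary k M \<A>" if t: "t \<in> {0..1}" for t
  proof (rule homeosI[of _ "M - K"])
    have "continuous_on M (\<lambda>z. (\<lambda>(t, z). H t z) (t, z))"
      by (rule continuous_on_compose2[OF cont]) (use t in \<open>auto intro!: continuous_intros\<close>)
    then show "continuous_on M (H t)" by simp
    show "inj_on (H t) M"
    proof (rule inj_onI)
      fix y z assume yz: "H t y = H t z"
      show "y = z"
      proof (cases "y \<in> V")
        case True
        then have "z \<in> V" using HV[OF t] yz by metis
        then have "\<psi> (G t (\<phi> y)) = \<psi> (G t (\<phi> z))" using True yz by (simp add: H_def)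
        then have "G t (\<phi> y) = G t (\<phi> z)" using \<phi>\<psi>(1) GT[OF t] True \<open>z \<in> V\<close>
          by (metis (mono_tags, lifting) V_def mem_Collect_eq)
        then have "\<phi> y = \<phi> z" using G(4)[OF t] by (simp add: bij_def inj_eq)
        then show ?thesis using \<psi>\<phi> True \<open>z \<in> V\<close> by (metis (mono_tags, lifting) V_def mem_Collect_eq)
      next
        case False
        then have "z \<notin> V" using HV[OF t] yz by metis
        then show ?thesis using False yz by (simp add: H_def)
      qed
    qed
    show "H t ` M = M"
    proof
      show "H t ` M \<subseteq> M" using HV[OF t] VM by (metis H_def image_subsetI subsetD)
      show "M \<subseteq> H t ` M"
      proof
        fix y assume y: "y \<in> M"
        show "y \<in> H t ` M"
        proof (cases "y \<in> V")
          case True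
          obtain v where v: "G t v = \<phi> y" using G(4)[OF t] by (metis bij_pointE)
          then have "v \<in> T" using GT[OF t] True by (metis (mono_tags, lifting) V_def mem_Collect_eq)
          then have "\<psi> v \<in> V" "H t (\<psi> v) = y"
            using \<phi>\<psi> v \<psi>\<phi> True by (auto simp: V_def H_def)
          then show ?thesis using VM by blast
        next
          case False
          then have "H t y = y" by (simp add: H_def)
          then show ?thesis using y by (metis imageI)
        qed
      qed
    qed
    show "boundary \<subseteq> M - K"
      using boundary_subset KV not_boundary_iff[OF U] T(4) by (auto simp: V_def)
    show "H t x = x" if "x \<notin> M" for x using that VM by (auto simp: H_def)
    show "H t x = x" if "x \<in> M - K" for x using that t Hout by auto
  qed (rule MKop)
  show ?thesis
  proof
    have "H 0 = id" using G(6) \<psi>\<phi> by (auto simp: H_def V_def fun_eq_iff)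
    then show "isotopy H" using cont homeo by (auto simp: isotopy_def)
    show "H 1 p = q" using p q G(7) \<psi>\<phi> by (simp add: H_def V_def)
    show "compact K" by (rule compK)
    show "K \<subseteq> {z \<in> U. \<phi> z \<in> T}" using KV by (simp add: V_def)
  qed (use Hout in auto)
qed

text \<open>A coordinate ball, or a ball cut off by the bounding hyperplane near the boundary. In
  both cases the coordinate image is convex, so boundary points need no separate treatment.\<close>

definition cell :: "'m set \<Rightarrow> bool" where
  "cell V \<longleftrightarrow> (\<exists>U \<phi> a r. (U, \<phi>) \<in> \<A> \<and> 0 < r \<and> ball a r \<inter> half_space k \<subseteq> \<phi> ` U \<and>
     V = {z\<in>U. \<phi> z \<in> ball a r})"

text \<open>Simple connectedness, phrased for paths with common ends because it is applied to
  replace one path by another.\<close>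

definition path_simple :: "'m set \<Rightarrow> bool" where
  "path_simple V \<longleftrightarrow> path_connected V \<and>
    (\<forall>p q. path p \<and> path q \<and> path_image p \<subseteq> V \<and> path_image q \<subseteq> V \<and>
       pathstart p = pathstart q \<and> pathfinish p = pathfinish q \<longrightarrow> homotopic_paths V p q)"

lemma openin_chart_preimage:
  assumes "(U, \<phi>) \<in> \<A>" "open T"
  shows "openin (top_of_set M) {z\<in>U. \<phi> z \<in> T}"
proof -
  obtain \<psi> where \<psi>: "openin (top_of_set M) U" "homeomorphism U (\<phi> ` U) \<phi> \<psi>"
    by (rule chart_inverse[OF assms(1)])
  have "openin (top_of_set U) (U \<inter> \<phi> -` T)"
    using \<psi>(2) assms(2) by (meson continuous_openin_preimage_gen homeomorphism_cont1)
  then show ?thesis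
    using \<psi>(1) openin_trans by (simp add: Collect_conj_eq vimage_def)
qed

lemma cell_open: "cell V \<Longrightarrow> openin (top_of_set M) V"
  unfolding cell_def using openin_chart_preimage[OF _ open_ball] by blast

lemma convex_half_space: "convex (half_space k :: (real^'n) set)"
  by (auto simp: convex_def half_space_def)

text \<open>Straight-line homotopies in the convex coordinate image are carried back by the inverse
  chart.\<close>

lemma cell_path_simple:
  assumes "cell V"
  shows "path_simple V"
proof -
  obtain U \<phi> a r where U: "(U, \<phi>) \<in> \<A>" and r: "ball a r \<inter> half_space k \<subseteq> \<phi> ` U"
    and V: "V = {z\<in>U. \<phi> z \<in> ball a r}"
    using assms by (auto simp: cell_def)
  obtain \<psi> where \<psi>: "openin (top_of_set (half_space k)) (\<phi> ` U)" "homeomorphism U (\<phi> ` U) \<phi> \<psi>"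
    by (rule chart_inverse[OF U])
  define C where "C = ball a r \<inter> half_space k"
  have C: "convex C" unfolding C_def by (intro convex_Int convex_ball convex_half_space)
  have C\<psi>: "continuous_on C \<psi>" and V\<phi>: "continuous_on V \<phi>"
    using \<psi>(2) r by (auto simp: homeomorphism_def V C_def intro: continuous_on_subset)
  have \<psi>\<phi>: "\<psi> (\<phi> z) = z" if "z \<in> V" for z using \<psi>(2) that by (auto simp: homeomorphism_def V)
  have \<phi>V: "\<phi> z \<in> C" if "z \<in> V" for z
    using that openin_imp_subset[OF \<psi>(1)] by (auto simp: V C_def)
  have \<psi>C: "\<psi> y \<in> V" if "y \<in> C" for y
    using that r \<psi>(2) by (auto simp: V C_def homeomorphism_def)
  have "V = \<psi> ` C" using \<phi>V \<psi>C \<psi>\<phi> by force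
  then have "path_connected V"
    using C\<psi> C by (metis convex_imp_path_connected path_connected_continuous_image)
  moreover have "homotopic_paths V p q"
    if p: "path p" "path_image p \<subseteq> V" and q: "path q" "path_image q \<subseteq> V"
      and e: "pathstart p = pathstart q" "pathfinish p = pathfinish q" for p q
  proof -
    have *: "homotopic_paths V (\<psi> \<circ> (\<phi> \<circ> p)) p" if "path p" "path_image p \<subseteq> V" for p
    proof (rule homotopic_paths_sym, rule homotopic_paths_eq)
      show "p t = (\<psi> \<circ> (\<phi> \<circ> p)) t" if "t \<in> {0..1}" for t
      proof -
        have "p t \<in> V" using that \<open>path_image p \<subseteq> V\<close> by (auto simp: path_image_def image_subset_iff)
        then show ?thesis using \<psi>\<phi> by simp
      qed
    qed (use that in auto)
    have "homotopic_paths C (\<phi> \<circ> p) (\<phi> \<circ> q)"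
    proof (rule homotopic_paths_linear)
      show "path (\<phi> \<circ> p)" "path (\<phi> \<circ> q)"
        using p q V\<phi> by (auto intro!: path_continuous_image intro: continuous_on_subset)
      show "pathstart (\<phi> \<circ> q) = pathstart (\<phi> \<circ> p)" "pathfinish (\<phi> \<circ> q) = pathfinish (\<phi> \<circ> p)"
        using e by (simp_all add: pathstart_compose pathfinish_compose)
      show "closed_segment ((\<phi> \<circ> p) t) ((\<phi> \<circ> q) t) \<subseteq> C" if "t \<in> {0..1}" for t
        using that p(2) q(2) \<phi>V
        by (intro closed_segment_subset[OF _ _ C]) (auto simp: path_image_def image_subset_iff)
    qed
    then have "homotopic_paths V (\<psi> \<circ> (\<phi> \<circ> p)) (\<psi> \<circ> (\<phi> \<circ> q))"
      by (rule homotopic_paths_continuous_image) (use C\<psi> \<psi>C in auto)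
    then show ?thesis
      using *[OF p] *[OF q] by (meson homotopic_paths_sym homotopic_paths_trans)
  qed
  ultimately show ?thesis by (auto simp: path_simple_def)
qed

text \<open>Concentric coordinate balls of radius \<open>r\<close> and \<open>r/2\<close> give the
  cell and its core. The compact core is there so that a finite cover consists of closed sets, each
  inside a simply connected open one.\<close>

lemma cell_neighbourhood:
  assumes W: "openin (top_of_set M) W" and x: "x \<in> W"
  obtains V C N where "cell V" "V \<subseteq> W" "compact C" "C \<subseteq> V" "openin (top_of_set M) N" "x \<in> N" "N \<subseteq> C"
proof -
  have xM: "x \<in> M" using W x openin_imp_subset by blast
  obtain U \<phi> where U: "(U, \<phi>) \<in> \<A>" "x \<in> U" by (rule chart_at[OF xM])
  obtain \<psi> where \<psi>: "openin (top_of_set M) U" "openin (top_of_set (half_space k)) (\<phi> ` U)"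
    "homeomorphism U (\<phi> ` U) \<phi> \<psi>" by (rule chart_inverse[OF U(1)])
  have "openin (top_of_set U) (U \<inter> W)"
    using \<psi>(1) W by (meson openin_Int openin_subset_trans inf_le1 openin_imp_subset)
  then have "openin (top_of_set (\<phi> ` U)) (\<phi> ` (U \<inter> W))"
    using homeomorphism_imp_open_map[OF \<psi>(3)] by blast
  then have "openin (top_of_set (half_space k)) (\<phi> ` (U \<inter> W))"
    using \<psi>(2) openin_trans by blast
  then obtain T where T: "open T" "\<phi> ` (U \<inter> W) = half_space k \<inter> T"
    by (auto simp: openin_open)
  then have "\<phi> x \<in> T" using U(2) x by blast
  then obtain r where r: "0 < r" "ball (\<phi> x) r \<subseteq> T" using T(1) openE by blast
  define V where "V = {z\<in>U. \<phi> z \<in> ball (\<phi> x) r}"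
  define D where "D = cball (\<phi> x) (r/2) \<inter> half_space k"
  have DU: "D \<subseteq> \<phi> ` (U \<inter> W)" using T(2) r by (force simp: D_def)
  have \<psi>\<phi>: "\<psi> (\<phi> z) = z" if "z \<in> U" for z using \<psi>(3) that by (simp add: homeomorphism_def)
  have hs: "closed (half_space k :: (real^'n) set)"
  proof -
    have "half_space k = {x::real^'n. x $ k \<ge> 0}" by (simp add: half_space_def)
    then show ?thesis by (simp add: closed_halfspace_component_ge_cart)
  qed
  show ?thesis
  proof
    show "cell V" unfolding cell_def V_def using U r T(2) by blast
    show "V \<subseteq> W"
    proof
      fix z assume z: "z \<in> V"
      then have "\<phi> z \<in> half_space k \<inter> T"
        using r openin_imp_subset[OF \<psi>(2)] by (auto simp: V_def)
      then obtain w where w: "w \<in> U \<inter> W" "\<phi> w = \<phi> z" using T(2) by (metis imageE)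
      then have "w = z" using \<psi>\<phi> z by (metis (no_types, lifting) IntE V_def mem_Collect_eq)
      then show "z \<in> W" using w by simp
    qed
    have "compact D" unfolding D_def using hs by (simp add: compact_Int_closed)
    moreover have "continuous_on D \<psi>"
      using \<psi>(3) DU by (meson continuous_on_subset homeomorphism_cont2 image_mono inf_le1)
    ultimately show "compact (\<psi> ` D)" by (simp add: compact_continuous_image)
    show "\<psi> ` D \<subseteq> V" using DU \<psi>\<phi> r by (fastforce simp: V_def D_def)
    show "openin (top_of_set M) {z\<in>U. \<phi> z \<in> ball (\<phi> x) (r/2)}"
      using openin_chart_preimage[OF U(1)] by blast
    show "x \<in> {z\<in>U. \<phi> z \<in> ball (\<phi> x) (r/2)}" using U r by simp
    show "{z\<in>U. \<phi> z \<in> ball (\<phi> x) (r/2)} \<subseteq> \<psi> ` D"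
      using \<psi>\<phi> openin_imp_subset[OF \<psi>(2)] by (force simp: D_def)
  qed
qed

lemma cell_interior_point:
  assumes "cell V" "x \<in> V"
  obtains z where "z \<in> V" "z \<notin> boundary"
proof -
  obtain U \<phi> a r where U: "(U, \<phi>) \<in> \<A>" and r: "ball a r \<inter> half_space k \<subseteq> \<phi> ` U"
    and V: "V = {z\<in>U. \<phi> z \<in> ball a r}"
    using assms(1) by (auto simp: cell_def)
  have xb: "\<phi> x \<in> ball a r" "x \<in> U" using assms V by auto
  obtain e where e: "0 < e" "cball (\<phi> x) e \<subseteq> ball a r"
    using xb(1) open_ball[of a r] unfolding open_contains_cball by blast
  \<comment> \<open>A step from \<open>\<phi> x\<close> into the half-space, short enough to stay in
    the ball.\<close>
  let ?y = "\<phi> x + e *\<^sub>R axis k 1"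
  have "?y \<in> ball a r" using e by (intro subsetD[OF e(2)]) (simp add: dist_norm)
  moreover have pos: "0 < ?y $ k" using chart_coordinate_nonneg[OF U xb(2)] e by simp
  ultimately obtain z where z: "z \<in> U" "\<phi> z = ?y"
    using r by (fastforce simp: half_space_def)
  show ?thesis
  proof
    show "z \<in> V" using z \<open>?y \<in> ball a r\<close> V by simp
    show "z \<notin> boundary" using not_boundary_iff[OF U z(1)] z(2) pos by simp
  qed
qed

lemma cell_push:
  assumes "cell V" "p \<in> V" "q \<in> V" "p \<notin> boundary" "q \<notin> boundary"
  obtains H K where "isotopy H" "compact K" "K \<subseteq> V"
    "\<And>t z. \<lbrakk>t \<in> {0..1}; z \<notin> K\<rbrakk> \<Longrightarrow> H t z = z" "H 1 p = q"
proof -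
  obtain U \<phi> a r where U: "(U, \<phi>) \<in> \<A>" and r: "ball a r \<inter> half_space k \<subseteq> \<phi> ` U"
    and V: "V = {z\<in>U. \<phi> z \<in> ball a r}"
    using assms(1) by (auto simp: cell_def)
  define T where "T = ball a r \<inter> {y. 0 < y $ k}"
  have "convex {y::real^'n. 0 < y $ k}"
    using convex_halfspace_gt[of 0 "axis k (1::real)"] by (simp add: cart_eq_inner_axis inner_commute)
  then have "convex T" unfolding T_def by (intro convex_Int convex_ball)
  moreover have "open T" unfolding T_def
    by (intro open_Int open_ball open_halfspace_component_gt_cart)
  moreover have "T \<subseteq> \<phi> ` U" using r by (auto simp: T_def half_space_def)
  moreover have "0 < \<phi> p $ k" "0 < \<phi> q $ k"
    using assms V not_boundary_iff[OF U] by auto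
  ultimately obtain H K where "isotopy H" "compact K" "K \<subseteq> {z\<in>U. \<phi> z \<in> T}"
    "\<And>t z. \<lbrakk>t \<in> {0..1}; z \<notin> K\<rbrakk> \<Longrightarrow> H t z = z" "H 1 p = q"
    using isotopy_push_chart[OF U, of T p q] assms V
    by (auto simp: T_def convex_connected)
  then show ?thesis using that[of H K] by (auto simp: V T_def)
qed

lemma path_connected_M: "path_connected M"
proof -
  have "\<exists>p. path p \<and> path_image p \<subseteq> M \<and> pathstart p = x \<and> pathfinish p = y" if "x \<in> M" "y \<in> M" for x y
  proof (rule connected_equivalence_relation[OF connected_M that])
    fix x assume "x \<in> M"
    then obtain V where V: "cell V" "V \<subseteq> M" "x \<in> V"
      using cell_neighbourhood[of M x] by (metis openin_subtopology_self subsetD topspace_euclidean)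
    then have "path_connected V" using cell_path_simple by (auto simp: path_simple_def)
    then have "\<exists>p. path p \<and> path_image p \<subseteq> M \<and> pathstart p = x \<and> pathfinish p = y" if "y \<in> V" for y
      using V that unfolding path_connected_def by (meson order_trans)
    then show "\<exists>T. openin (top_of_set M) T \<and> x \<in> T \<and>
        (\<forall>y\<in>T. \<exists>p. path p \<and> path_image p \<subseteq> M \<and> pathstart p = x \<and> pathfinish p = y)"
      by (intro exI[of _ V] conjI cell_open V ballI)
  next
    fix x y assume "\<exists>p. path p \<and> path_image p \<subseteq> M \<and> pathstart p = x \<and> pathfinish p = y"
    then show "\<exists>p. path p \<and> path_image p \<subseteq> M \<and> pathstart p = y \<and> pathfinish p = x"
      by (metis path_image_reversepath path_reversepath pathfinish_reversepath pathstart_reversepath)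
  next
    fix x y z assume "\<exists>p. path p \<and> path_image p \<subseteq> M \<and> pathstart p = x \<and> pathfinish p = y"
      "\<exists>p. path p \<and> path_image p \<subseteq> M \<and> pathstart p = y \<and> pathfinish p = z"
    then obtain p q where "path p" "path_image p \<subseteq> M" "pathstart p = x" "pathfinish p = y"
      "path q" "path_image q \<subseteq> M" "pathstart q = y" "pathfinish q = z" by auto
    then show "\<exists>p. path p \<and> path_image p \<subseteq> M \<and> pathstart p = x \<and> pathfinish p = z"
      by (intro exI[of _ "p +++ q"]) (auto simp: path_image_join)
  qed
  then show ?thesis by (auto simp: path_connected_def)
qed

end

subsection \<open>Homotopies of paths in topological spaces\<close>

text \<open>The library has the groupoid laws for path homotopy only in real normed vector spaces, because
  it states them with straight-line paths.\<close>

lemma homotopic_paths_reparam: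
  fixes f g :: "real \<Rightarrow> 'a::real_normed_vector" and p :: "'a \<Rightarrow> 'b::topological_space"
  assumes "convex C" "continuous_on C p" "p ` C \<subseteq> S" "path f" "path_image f \<subseteq> C"
    "path g" "path_image g \<subseteq> C" "pathstart f = pathstart g" "pathfinish f = pathfinish g"
  shows "homotopic_paths S (p \<circ> f) (p \<circ> g)"
proof (rule homotopic_paths_continuous_image)
  show "homotopic_paths C f g"
  proof (rule homotopic_paths_linear)
    show "closed_segment (f t) (g t) \<subseteq> C" if "t \<in> {0..1}" for t
      using that assms by (intro closed_segment_subset) (auto simp: path_image_def image_subset_iff)
  qed (use assms in auto)
qed (use assms in auto)

lemma path_const: "path (\<lambda>_. a)"
  by (simp add: path_def)

text \<open>Both sides are \<open>p\<close> precomposed with paths in the unit interval that have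
  the same ends, and such paths are homotopic by convexity. The next two laws follow in the same
  way.\<close>

lemma homotopic_paths_const_right:
  assumes p: "path p" "path_image p \<subseteq> S" "pathfinish p = a"
  shows "homotopic_paths S (p +++ (\<lambda>_. a)) p"
proof -
  have "homotopic_paths S (p \<circ> (linepath 0 1 +++ linepath 1 1)) (p \<circ> linepath 0 (1::real))"
    by (rule homotopic_paths_reparam[of "{0..1}"])
      (use p in \<open>auto simp: path_def[of p] path_image_def[of p] path_image_join closed_segment_eq_real_ivl\<close>)
  moreover have "p \<circ> (linepath 0 1 +++ linepath 1 1) = p +++ (\<lambda>_. a)" "p \<circ> linepath 0 1 = p"
    using p(3) by (auto simp: joinpaths_def linepath_def pathfinish_def fun_eq_iff)
  ultimately show ?thesis by simp
qed

lemma homotopic_paths_const_left: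
  assumes p: "path p" "path_image p \<subseteq> S" "pathstart p = a"
  shows "homotopic_paths S ((\<lambda>_. a) +++ p) p"
proof -
  have "homotopic_paths S (p \<circ> (linepath 0 0 +++ linepath 0 1)) (p \<circ> linepath 0 (1::real))"
    by (rule homotopic_paths_reparam[of "{0..1}"])
      (use p in \<open>auto simp: path_def[of p] path_image_def[of p] path_image_join closed_segment_eq_real_ivl\<close>)
  moreover have "p \<circ> (linepath 0 0 +++ linepath 0 1) = (\<lambda>_. a) +++ p" "p \<circ> linepath 0 1 = p"
    using p(3) by (auto simp: joinpaths_def linepath_def pathstart_def fun_eq_iff)
  ultimately show ?thesis by simp
qed

lemma homotopic_paths_reverse_right:
  assumes p: "path p" "path_image p \<subseteq> S" "pathstart p = a"
  shows "homotopic_paths S (p +++ reversepath p) (\<lambda>_. a)"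
proof -
  have "homotopic_paths S (p \<circ> (linepath 0 1 +++ linepath 1 0)) (p \<circ> linepath 0 (0::real))"
    by (rule homotopic_paths_reparam[of "{0..1}"])
      (use p in \<open>auto simp: path_def[of p] path_image_def[of p] path_image_join closed_segment_eq_real_ivl\<close>)
  moreover have "p \<circ> (linepath 0 1 +++ linepath 1 0) = p +++ reversepath p" "p \<circ> linepath 0 0 = (\<lambda>_. a)"
    using p(3) by (auto simp: joinpaths_def reversepath_def linepath_def pathstart_def fun_eq_iff)
  ultimately show ?thesis by simp
qed

text \<open>The two routes along the edges and the diagonal of a square are homotopic in the convex
  square. The first part gives the naturality of trajectories, the second the trajectory of a
  composite isotopy.\<close>

lemma homotopic_square:
  fixes K :: "real \<times> real \<Rightarrow> 'b::topological_space"
  assumes K: "continuous_on ({0..1} \<times> {0..1}) K" "K ` ({0..1} \<times> {0..1}) \<subseteq> S"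
  shows "homotopic_paths S ((\<lambda>s. K (s, 0)) +++ (\<lambda>t. K (1, t))) ((\<lambda>t. K (0, t)) +++ (\<lambda>s. K (s, 1)))"
    and "homotopic_paths S (\<lambda>t. K (t, t)) ((\<lambda>s. K (s, 0)) +++ (\<lambda>t. K (1, t)))"
proof -
  define a b where "a = linepath (0::real, 0::real) (1, 0) +++ linepath (1, 0) (1, 1)"
    and "b = linepath (0::real, 0::real) (0, 1) +++ linepath (0, 1) (1, 1)"
  have conv: "convex ({0..1::real} \<times> {0..1::real})" by (intro convex_Times) auto
  have seg: "closed_segment u v \<subseteq> {0..1} \<times> {0..1}" if "u \<in> {0..1} \<times> {0..1}" "v \<in> {0..1} \<times> {0..1}"
    for u v :: "real \<times> real"
    by (rule closed_segment_subset[OF that conv])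
  have sub: "path_image a \<subseteq> {0..1} \<times> {0..1}" "path_image b \<subseteq> {0..1} \<times> {0..1}"
    "path_image (linepath (0, 0) (1, 1)) \<subseteq> {0..1::real} \<times> {0..1::real}"
    unfolding a_def b_def
    by (((intro subset_path_image_join)?, (simp only: path_image_linepath, intro seg; simp)+)+)
  have pts: "path a" "path b" "pathstart a = (0,0)" "pathstart b = (0,0)" "pathfinish a = (1,1)" "pathfinish b = (1,1)"
    by (auto simp: a_def b_def)
  have eqs: "K \<circ> a = (\<lambda>s. K (s, 0)) +++ (\<lambda>t. K (1, t))" "K \<circ> b = (\<lambda>t. K (0, t)) +++ (\<lambda>s. K (s, 1))"
    "K \<circ> linepath (0, 0) (1, 1) = (\<lambda>t. K (t, t))"
    by (auto simp: a_def b_def joinpaths_def linepath_def fun_eq_iff algebra_simps)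
  show "homotopic_paths S ((\<lambda>s. K (s, 0)) +++ (\<lambda>t. K (1, t))) ((\<lambda>t. K (0, t)) +++ (\<lambda>s. K (s, 1)))"
    unfolding eqs[symmetric]
    by (rule homotopic_paths_reparam[OF conv K pts(1) sub(1) pts(2) sub(2)]) (simp_all add: pts)
  show "homotopic_paths S (\<lambda>t. K (t, t)) ((\<lambda>s. K (s, 0)) +++ (\<lambda>t. K (1, t)))"
    unfolding eqs[symmetric]
    by (rule homotopic_paths_reparam[OF conv K path_linepath sub(3) pts(1) sub(1)]) (simp_all add: pts)
qed

text \<open>Precomposition with \<open>linepath\<close> is the form to which
  \<open>homotopic_paths_reparam\<close> applies; \<open>s\<close> may exceed \<open>t\<close>, and
  the piece then runs backwards.\<close>

definition path_piece :: "real \<Rightarrow> real \<Rightarrow> (real \<Rightarrow> 'a) \<Rightarrow> real \<Rightarrow> 'a" where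
  "path_piece s t p = p \<circ> linepath s t"

lemma path_piece:
  assumes "path p" "s \<in> {0..1}" "t \<in> {0..1}"
  shows "path (path_piece s t p)" "path_image (path_piece s t p) = p ` closed_segment s t"
    "pathstart (path_piece s t p) = p s" "pathfinish (path_piece s t p) = p t"
    "path_image (path_piece s t p) \<subseteq> path_image p"
proof -
  have sub: "closed_segment s t \<subseteq> {0..1}"
    using assms by (intro closed_segment_subset) auto
  show "path (path_piece s t p)"
    unfolding path_piece_def using assms sub
    by (intro path_continuous_image) (auto simp: path_def intro: continuous_on_subset)
  show im: "path_image (path_piece s t p) = p ` closed_segment s t"
    by (simp add: path_piece_def path_image_compose)
  show "path_image (path_piece s t p) \<subseteq> path_image p"
    unfolding im using sub by (auto simp: path_image_def)
qed (auto simp: path_piece_def pathstart_compose pathfinish_compose)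

lemma path_piece_join:
  assumes "path p" "path_image p \<subseteq> S" "r \<in> {0..1}" "s \<in> {0..1}" "t \<in> {0..1}"
  shows "homotopic_paths S (path_piece r s p +++ path_piece s t p) (path_piece r t p)"
proof -
  have sub: "closed_segment u v \<subseteq> {0..1}" if "u \<in> {0..1}" "v \<in> {0..1}" for u v :: real
    using that by (intro closed_segment_subset) auto
  have "homotopic_paths S (p \<circ> (linepath r s +++ linepath s t)) (p \<circ> linepath r t)"
    by (rule homotopic_paths_reparam[of "{0..1}"])
      (use assms sub in \<open>auto simp: path_def[of p] path_image_def[of p] path_image_join
        closed_segment_eq_real_ivl split: if_splits\<close>)
  then show ?thesis by (simp add: path_piece_def path_compose_join)
qed

subsection \<open>The fundamental group\<close>

definition loops :: "'m::topological_space set \<Rightarrow> 'm \<Rightarrow> (real \<Rightarrow> 'm) set" where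
  "loops M x = {p. path p \<and> path_image p \<subseteq> M \<and> pathstart p = x \<and> pathfinish p = x}"

definition path_class :: "'m::topological_space set \<Rightarrow> (real \<Rightarrow> 'm) \<Rightarrow> (real \<Rightarrow> 'm) set" where
  "path_class M p = {q. homotopic_paths M p q}"

lemma path_class_eq: "homotopic_paths M p q \<Longrightarrow> path_class M p = path_class M q"
  by (auto simp: path_class_def intro: homotopic_paths_trans homotopic_paths_sym)

lemma carrier_fundamental_group: "carrier (fundamental_group M x) = path_class M ` loops M x"
  by (auto simp: fundamental_group_def quotient_def path_class_def loops_def)

lemma one_fundamental_group: "\<one>\<^bsub>fundamental_group M x\<^esub> = path_class M (\<lambda>_. x)"
  by (simp add: fundamental_group_def path_class_def)

lemma loops_join: "\<lbrakk>p \<in> loops M x; q \<in> loops M x\<rbrakk> \<Longrightarrow> p +++ q \<in> loops M x"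
  by (auto simp: loops_def path_image_join)

lemma loops_const: "x \<in> M \<Longrightarrow> (\<lambda>_. x) \<in> loops M x"
  by (auto simp: loops_def path_const path_image_def pathstart_def pathfinish_def)

lemma loops_reverse: "p \<in> loops M x \<Longrightarrow> reversepath p \<in> loops M x"
  by (auto simp: loops_def)

lemma mult_fundamental_group:
  assumes "p \<in> loops M x" "q \<in> loops M x"
  shows "path_class M p \<otimes>\<^bsub>fundamental_group M x\<^esub> path_class M q = path_class M (p +++ q)"
proof -
  have pq: "homotopic_paths M p p" "homotopic_paths M q q" "pathfinish p = pathstart q"
    using assms by (auto simp: loops_def)
  have "(\<exists>p'\<in>path_class M p. \<exists>q'\<in>path_class M q. homotopic_paths M (p' +++ q') r)
      \<longleftrightarrow> homotopic_paths M (p +++ q) r" for r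
  proof
    assume "\<exists>p'\<in>path_class M p. \<exists>q'\<in>path_class M q. homotopic_paths M (p' +++ q') r"
    then obtain p' q' where h: "homotopic_paths M p p'" "homotopic_paths M q q'"
      "homotopic_paths M (p' +++ q') r" by (auto simp: path_class_def)
    show "homotopic_paths M (p +++ q) r"
      using homotopic_paths_join[OF h(1,2) pq(3)] h(3) by (rule homotopic_paths_trans)
  next
    assume "homotopic_paths M (p +++ q) r"
    then show "\<exists>p'\<in>path_class M p. \<exists>q'\<in>path_class M q. homotopic_paths M (p' +++ q') r"
      using pq unfolding path_class_def by blast
  qed
  then show ?thesis by (simp add: fundamental_group_def path_class_def[of M "p +++ q"])
qed

lemma group_fundamental_group:
  assumes "x \<in> M"
  shows "group (fundamental_group M x)"
proof (rule groupI)
  fix a assume "a \<in> carrier (fundamental_group M x)"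
  then obtain p where p: "p \<in> loops M x" "a = path_class M p" by (auto simp: carrier_fundamental_group)
  have p': "path p" "path_image p \<subseteq> M" "pathstart p = x" "pathfinish p = x"
    using p(1) by (auto simp: loops_def)
  show "\<one>\<^bsub>fundamental_group M x\<^esub> \<otimes>\<^bsub>fundamental_group M x\<^esub> a = a"
    unfolding one_fundamental_group p(2) mult_fundamental_group[OF loops_const[OF assms] p(1)]
    by (rule path_class_eq) (use p' in \<open>intro homotopic_paths_const_left\<close>)
  have "reversepath p +++ reversepath (reversepath p) \<in> loops M x"
    using p(1) by (intro loops_join loops_reverse)
  have "homotopic_paths M (reversepath p +++ reversepath (reversepath p)) (\<lambda>_. x)"
    by (rule homotopic_paths_reverse_right) (use p' in auto)
  then have "path_class M (reversepath p) \<otimes>\<^bsub>fundamental_group M x\<^esub> a = \<one>\<^bsub>fundamental_group M x\<^esub>"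
    unfolding one_fundamental_group p(2) mult_fundamental_group[OF loops_reverse[OF p(1)] p(1)]
    by (simp add: path_class_eq)
  then show "\<exists>b\<in>carrier (fundamental_group M x). b \<otimes>\<^bsub>fundamental_group M x\<^esub> a = \<one>\<^bsub>fundamental_group M x\<^esub>"
    using loops_reverse[OF p(1)] by (auto simp: carrier_fundamental_group)
  fix b assume "b \<in> carrier (fundamental_group M x)"
  then obtain q where q: "q \<in> loops M x" "b = path_class M q" by (auto simp: carrier_fundamental_group)
  show "a \<otimes>\<^bsub>fundamental_group M x\<^esub> b \<in> carrier (fundamental_group M x)"
    unfolding p q mult_fundamental_group[OF p(1) q(1)] carrier_fundamental_group
    using loops_join[OF p(1) q(1)] by blast
  fix c assume "c \<in> carrier (fundamental_group M x)"
  then obtain r where r: "r \<in> loops M x" "c = path_class M r" by (auto simp: carrier_fundamental_group)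
  show "a \<otimes>\<^bsub>fundamental_group M x\<^esub> b \<otimes>\<^bsub>fundamental_group M x\<^esub> c
      = a \<otimes>\<^bsub>fundamental_group M x\<^esub> (b \<otimes>\<^bsub>fundamental_group M x\<^esub> c)"
    using p q r
    by (simp add: mult_fundamental_group loops_join)
      (intro path_class_eq homotopic_paths_sym[OF homotopic_paths_assoc]; simp add: loops_def)
qed (use loops_const[OF assms] in \<open>auto simp: one_fundamental_group carrier_fundamental_group\<close>)

text \<open>A choice of paths \<open>e y\<close> from the base point turns every path into an element of the fundamental
  group, multiplicatively.\<close>

locale based_paths =
  fixes M :: "'m::topological_space set" and x :: 'm and e :: "'m \<Rightarrow> real \<Rightarrow> 'm"
  assumes base: "x \<in> M"
    and e: "\<And>y. y \<in> M \<Longrightarrow> path (e y)" "\<And>y. y \<in> M \<Longrightarrow> path_image (e y) \<subseteq> M"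
      "\<And>y. y \<in> M \<Longrightarrow> pathstart (e y) = x" "\<And>y. y \<in> M \<Longrightarrow> pathfinish (e y) = y"
begin

abbreviation \<pi> where "\<pi> \<equiv> fundamental_group M x"

sublocale \<pi>: group \<pi> by (rule group_fundamental_group[OF base])

definition paths :: "(real \<Rightarrow> 'm) set" where
  "paths = {p. path p \<and> path_image p \<subseteq> M}"

definition c :: "(real \<Rightarrow> 'm) \<Rightarrow> (real \<Rightarrow> 'm) set" where
  "c p = path_class M (e (pathstart p) +++ (p +++ reversepath (e (pathfinish p))))"

lemma paths_ends: "p \<in> paths \<Longrightarrow> pathstart p \<in> M" "p \<in> paths \<Longrightarrow> pathfinish p \<in> M"
  by (auto simp: paths_def)

lemma paths_join: "\<lbrakk>p \<in> paths; q \<in> paths; pathfinish p = pathstart q\<rbrakk> \<Longrightarrow> p +++ q \<in> paths"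
  by (auto simp: paths_def path_image_join)

lemma paths_reverse: "p \<in> paths \<Longrightarrow> reversepath p \<in> paths"
  by (auto simp: paths_def)

lemma e_paths: "y \<in> M \<Longrightarrow> e y \<in> paths"
  using e by (auto simp: paths_def)

lemma c_loop: "p \<in> paths \<Longrightarrow> e (pathstart p) +++ (p +++ reversepath (e (pathfinish p))) \<in> loops M x"
  using e paths_ends[of p] by (auto simp: loops_def path_image_join paths_def)

lemma c_closed [simp]: "p \<in> paths \<Longrightarrow> c p \<in> carrier \<pi>"
  unfolding c_def carrier_fundamental_group using c_loop by blast

lemma c_homotopic:
  assumes "homotopic_paths M p q"
  shows "c p = c q"
proof -
  have pq: "p \<in> paths" "q \<in> paths"
    using homotopic_paths_imp_path[OF assms] homotopic_paths_imp_subset[OF assms] by (auto simp: paths_def)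
  have ends: "pathstart p = pathstart q" "pathfinish p = pathfinish q"
    using assms homotopic_paths_imp_pathstart homotopic_paths_imp_pathfinish by auto
  show ?thesis
    unfolding c_def ends
    by (intro path_class_eq homotopic_paths_join assms)
      (use e paths_ends[OF pq(2)] ends in auto)
qed

lemma homotopic_cancel_middle:
  assumes "p \<in> paths" "q \<in> paths" "r \<in> paths" "pathfinish p = pathfinish r" "pathfinish r = pathstart q"
  shows "homotopic_paths M ((p +++ reversepath r) +++ (r +++ q)) (p +++ q)"
proof -
  note [simp] = assms(4,5)
  have P: "path p" "path_image p \<subseteq> M" "path q" "path_image q \<subseteq> M" "path r" "path_image r \<subseteq> M"
    using assms by (auto simp: paths_def)
  have 1: "homotopic_paths M ((p +++ reversepath r) +++ (r +++ q)) (p +++ (reversepath r +++ (r +++ q)))"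
    by (rule homotopic_paths_sym, rule homotopic_paths_assoc) (use P in \<open>auto simp: path_image_join\<close>)
  have 2: "homotopic_paths M (reversepath r +++ (r +++ q)) ((reversepath r +++ r) +++ q)"
    by (rule homotopic_paths_assoc) (use P in auto)
  have "homotopic_paths M (reversepath r +++ reversepath (reversepath r)) (\<lambda>_. pathstart q)"
    by (rule homotopic_paths_reverse_right) (use P in auto)
  then have 3: "homotopic_paths M ((reversepath r +++ r) +++ q) ((\<lambda>_. pathstart q) +++ q)"
    by (intro homotopic_paths_join) (use P in auto)
  have 4: "homotopic_paths M ((\<lambda>_. pathstart q) +++ q) q"
    by (rule homotopic_paths_const_left) (use P in auto)
  have "homotopic_paths M (reversepath r +++ (r +++ q)) q"
    using 2 3 4 homotopic_paths_trans by blast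
  then have "homotopic_paths M (p +++ (reversepath r +++ (r +++ q))) (p +++ q)"
    by (intro homotopic_paths_join) (use P in auto)
  then show ?thesis using 1 homotopic_paths_trans by blast
qed

text \<open>The return along \<open>e\<close> after \<open>p\<close> and the departure along
  \<open>e\<close> before \<open>q\<close> use the same path in opposite directions and
  cancel.\<close>

lemma c_join:
  assumes p: "p \<in> paths" and q: "q \<in> paths" and pq: "pathfinish p = pathstart q"
  shows "c (p +++ q) = c p \<otimes>\<^bsub>\<pi>\<^esub> c q"
proof -
  let ?a = "e (pathstart p)" and ?b = "e (pathstart q)" and ?d = "e (pathfinish q)"
  let ?Q = "q +++ reversepath ?d"
  have ends: "pathstart p \<in> M" "pathstart q \<in> M" "pathfinish q \<in> M" using paths_ends p q by auto
  have P: "path p" "path_image p \<subseteq> M" "path q" "path_image q \<subseteq> M" using p q by (auto simp: paths_def)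
  note E = e[OF ends(1)] e[OF ends(2)] e[OF ends(3)]
  have "homotopic_paths M ((?a +++ (p +++ reversepath ?b)) +++ (?b +++ ?Q))
      (?a +++ ((p +++ reversepath ?b) +++ (?b +++ ?Q)))"
    by (rule homotopic_paths_sym, rule homotopic_paths_assoc)
      (use P E pq in \<open>auto simp: path_image_join\<close>)
  also have "homotopic_paths M \<dots> (?a +++ (p +++ ?Q))"
    by (intro homotopic_paths_join homotopic_cancel_middle)
      (use P E pq in \<open>auto simp: paths_def path_image_join\<close>)
  also have "homotopic_paths M \<dots> (?a +++ ((p +++ q) +++ reversepath ?d))"
    by (intro homotopic_paths_join homotopic_paths_assoc)
      (use P E pq in \<open>auto simp: path_image_join\<close>)
  finally have "path_class M ((?a +++ (p +++ reversepath ?b)) +++ (?b +++ ?Q)) = c (p +++ q)"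
    using path_class_eq by (simp add: c_def)
  moreover have "c p \<otimes>\<^bsub>\<pi>\<^esub> c q = path_class M ((?a +++ (p +++ reversepath ?b)) +++ (?b +++ ?Q))"
    unfolding c_def using mult_fundamental_group[OF c_loop[OF p] c_loop[OF q]] pq by simp
  ultimately show ?thesis by simp
qed

lemma const_paths: "y \<in> M \<Longrightarrow> (\<lambda>_. y) \<in> paths"
  by (auto simp: paths_def path_const path_image_def)

text \<open>A constant path joined to itself is homotopic to itself, so its value is idempotent, and
  the only idempotent of a group is the unit.\<close>

lemma c_const:
  assumes "y \<in> M"
  shows "c (\<lambda>_. y) = \<one>\<^bsub>\<pi>\<^esub>"
proof -
  have "c ((\<lambda>_. y) +++ (\<lambda>_. y)) = c (\<lambda>_. y)"
    by (rule c_homotopic, rule homotopic_paths_const_right)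
      (use assms in \<open>auto simp: path_const path_image_def pathfinish_def\<close>)
  moreover have "c ((\<lambda>_. y) +++ (\<lambda>_. y)) = c (\<lambda>_. y) \<otimes>\<^bsub>\<pi>\<^esub> c (\<lambda>_. y)"
    by (rule c_join) (use assms const_paths in \<open>auto simp: pathfinish_def pathstart_def\<close>)
  ultimately show ?thesis using const_paths[OF assms] by (metis c_closed \<pi>.r_cancel_one')
qed

lemma c_reverse:
  assumes "p \<in> paths"
  shows "c (reversepath p) = inv\<^bsub>\<pi>\<^esub> (c p)"
proof -
  have "c (p +++ reversepath p) = c (\<lambda>_. pathstart p)"
    by (rule c_homotopic, rule homotopic_paths_reverse_right) (use assms in \<open>auto simp: paths_def\<close>)
  then have "c p \<otimes>\<^bsub>\<pi>\<^esub> c (reversepath p) = \<one>\<^bsub>\<pi>\<^esub>"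
    using assms c_const[OF paths_ends(1)[OF assms]] c_join[OF assms paths_reverse[OF assms]] by simp
  then show ?thesis
    using assms paths_reverse[OF assms] by (metis c_closed \<pi>.inv_equality \<pi>.inv_inv \<pi>.inv_closed)
qed

text \<open>The path \<open>e x\<close> is a loop that need not be contractible, so the value is its
  class and not the unit. What matters is that the value does not depend on
  \<open>y\<close>.\<close>

lemma c_e:
  assumes "y \<in> M"
  shows "c (e y) = path_class M (e x)"
proof -
  have "homotopic_paths M (e x +++ (e y +++ reversepath (e y))) (e x +++ (\<lambda>_. x))"
    by (intro homotopic_paths_join homotopic_paths_reverse_right) (use e assms base in auto)
  also have "homotopic_paths M \<dots> (e x)"
    by (intro homotopic_paths_const_right) (use e assms base in auto)
  finally show ?thesis using e[OF assms] by (simp add: c_def path_class_eq)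
qed

text \<open>For a loop \<open>g\<close> at \<open>x\<close>, \<open>c g\<close> is the class of
  \<open>g\<close> conjugated by the class \<open>b\<close> of \<open>e x\<close>. Carrying
  \<open>g\<close> to \<open>y\<close> along \<open>e y\<close> conjugates back by
  \<open>c (e y) = b\<close>, so \<open>\<gamma>\<close> itself is attained and not merely a
  conjugate.\<close>

lemma c_surj_loops:
  assumes "\<gamma> \<in> carrier \<pi>" "y \<in> M"
  obtains p where "p \<in> loops M y" "c p = \<gamma>"
proof -
  obtain g where g: "g \<in> loops M x" "\<gamma> = path_class M g" using assms(1) by (auto simp: carrier_fundamental_group)
  have gp: "g \<in> paths" "pathstart g = x" "pathfinish g = x" using g by (auto simp: loops_def paths_def)
  define b where "b = path_class M (e x)"
  have ex: "e x \<in> loops M x" using e base by (auto simp: loops_def)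
  have b: "b \<in> carrier \<pi>" using ex by (auto simp: b_def carrier_fundamental_group)
  have rb: "path_class M (reversepath (e x)) = inv\<^bsub>\<pi>\<^esub> b"
  proof -
    have "homotopic_paths M (e x +++ reversepath (e x)) (\<lambda>_. x)"
      by (rule homotopic_paths_reverse_right) (use e base in auto)
    then have "b \<otimes>\<^bsub>\<pi>\<^esub> path_class M (reversepath (e x)) = \<one>\<^bsub>\<pi>\<^esub>"
      unfolding b_def mult_fundamental_group[OF ex loops_reverse[OF ex]] one_fundamental_group
      by (rule path_class_eq)
    moreover have "path_class M (reversepath (e x)) \<in> carrier \<pi>"
      using loops_reverse[OF ex] by (auto simp: carrier_fundamental_group)
    ultimately show ?thesis using b by (metis \<pi>.inv_equality \<pi>.inv_inv \<pi>.inv_closed)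
  qed
  have "c g = b \<otimes>\<^bsub>\<pi>\<^esub> (\<gamma> \<otimes>\<^bsub>\<pi>\<^esub> inv\<^bsub>\<pi>\<^esub> b)"
    unfolding rb[symmetric] unfolding b_def g(2) c_def gp(2,3)
    using g ex by (simp add: mult_fundamental_group loops_join loops_reverse)
  define p where "p = reversepath (e y) +++ (g +++ e y)"
  have "c p = inv\<^bsub>\<pi>\<^esub> b \<otimes>\<^bsub>\<pi>\<^esub> (c g \<otimes>\<^bsub>\<pi>\<^esub> b)"
    unfolding p_def b_def c_e[OF assms(2), symmetric]
    using e[OF assms(2)] e_paths[OF assms(2)] gp
    by (simp add: c_join c_reverse paths_join paths_reverse)
  also have "\<dots> = \<gamma>"
    unfolding \<open>c g = _\<close> using b assms(1) by (simp add: \<pi>.m_assoc \<pi>.inv_solve_left')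
  finally have "c p = \<gamma>" .
  moreover have "p \<in> loops M y"
    using e[OF assms(2)] g(1) by (auto simp: p_def loops_def path_image_join)
  ultimately show ?thesis using that by blast
qed

end

subsection \<open>Quasimorphisms on the quotient by the centre\<close>

lemma (in group) centre_normal: "group_centre G \<lhd> G"
proof -
  have sub: "subgroup (group_centre G) G"
  proof (rule subgroupI)
    fix a assume a: "a \<in> group_centre G"
    then have a': "a \<in> carrier G" "\<And>g. g \<in> carrier G \<Longrightarrow> a \<otimes> g = g \<otimes> a"
      by (auto simp: group_centre_def)
    have "inv a \<otimes> g = g \<otimes> inv a" if "g \<in> carrier G" for g
      using a' that by (metis inv_closed inv_solve_left inv_solve_right m_assoc m_closed)
    then show "inv a \<in> group_centre G" using a' by (auto simp: group_centre_def)
    fix b assume b: "b \<in> group_centre G"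
    then have b': "b \<in> carrier G" "\<And>g. g \<in> carrier G \<Longrightarrow> b \<otimes> g = g \<otimes> b"
      by (auto simp: group_centre_def)
    have "a \<otimes> b \<otimes> g = g \<otimes> (a \<otimes> b)" if g: "g \<in> carrier G" for g
    proof -
      have "a \<otimes> b \<otimes> g = a \<otimes> (g \<otimes> b)"
        using a'(1) b'(1) g by (simp add: m_assoc b'(2)[OF g, symmetric])
      also have "\<dots> = g \<otimes> a \<otimes> b"
        using a'(1) b'(1) g by (simp add: a'(2)[OF g, symmetric] flip: m_assoc)
      finally show ?thesis using a'(1) b'(1) g by (simp add: m_assoc)
    qed
    moreover have "a \<otimes> b \<in> carrier G" using a'(1) b'(1) by (rule m_closed)
    ultimately show "a \<otimes> b \<in> group_centre G" unfolding group_centre_def by blast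
  next
    have "\<one> \<in> group_centre G" by (auto simp: group_centre_def)
    then show "group_centre G \<noteq> {}" by blast
  qed (auto simp: group_centre_def)
  show ?thesis
  proof (rule normalI[OF sub], rule ballI)
    fix y assume y: "y \<in> carrier G"
    then have "h \<otimes> y = y \<otimes> h" if "h \<in> group_centre G" for h
      using that unfolding group_centre_def by blast
    then show "group_centre G #> y = y <# group_centre G"
      unfolding r_coset_def l_coset_def by simp
  qed
qed

text \<open>Pulling back along the quotient map makes the function blind to central factors, which
  are what a change of isotopy will contribute.\<close>

lemma (in group) homogeneous_quasimorphism_lift:
  assumes \<phi>: "homogeneous_quasimorphism (G Mod group_centre G) \<phi>"
  defines "\<phi>' \<equiv> \<lambda>g. \<phi> (group_centre G #> g)"
  shows "\<exists>D. \<forall>g\<in>carrier G. \<forall>h\<in>carrier G. \<bar>\<phi>' (g \<otimes> h) - \<phi>' g - \<phi>' h\<bar> \<le> D"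
    and "\<And>z g. \<lbrakk>z \<in> group_centre G; g \<in> carrier G\<rbrakk> \<Longrightarrow> \<phi>' (z \<otimes> g) = \<phi>' g"
    and "\<And>g n. g \<in> carrier G \<Longrightarrow> \<phi>' (g [^] (n::nat)) = real n * \<phi>' g"
proof -
  let ?Z = "group_centre G"
  interpret N: normal ?Z G by (rule centre_normal)
  interpret Q: group "G Mod ?Z" by (rule N.factorgroup_is_group)
  have car: "?Z #> g \<in> carrier (G Mod ?Z)" if "g \<in> carrier G" for g
    using that by (auto simp: FactGroup_def RCOSETS_def)
  have mult: "(?Z #> g) \<otimes>\<^bsub>G Mod ?Z\<^esub> (?Z #> h) = ?Z #> (g \<otimes> h)" if "g \<in> carrier G" "h \<in> carrier G" for g h
    using that by (simp add: FactGroup_def N.rcos_sum)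
  obtain B where "\<And>a b. \<lbrakk>a \<in> carrier (G Mod ?Z); b \<in> carrier (G Mod ?Z)\<rbrakk> \<Longrightarrow>
      \<bar>\<phi> b - \<phi> (a \<otimes>\<^bsub>G Mod ?Z\<^esub> b) + \<phi> a\<bar> \<le> B"
    using \<phi> unfolding homogeneous_quasimorphism_def quasimorphism_def by blast
  then have B: "\<bar>\<phi>' h - \<phi>' (g \<otimes> h) + \<phi>' g\<bar> \<le> B" if "g \<in> carrier G" "h \<in> carrier G" for g h
    using car[OF that(1)] car[OF that(2)] mult[OF that] unfolding \<phi>'_def by metis
  have "\<bar>\<phi>' (g \<otimes> h) - \<phi>' g - \<phi>' h\<bar> \<le> B" if "g \<in> carrier G" "h \<in> carrier G" for g h
    using B[OF that] by linarith
  then show "\<exists>D. \<forall>g\<in>carrier G. \<forall>h\<in>carrier G. \<bar>\<phi>' (g \<otimes> h) - \<phi>' g - \<phi>' h\<bar> \<le> D"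
    by blast
  show "\<phi>' (z \<otimes> g) = \<phi>' g" if "z \<in> ?Z" "g \<in> carrier G" for z g
  proof -
    have "?Z #> (z \<otimes> g) = (?Z #> z) #> g"
      using that N.subset by (simp add: coset_mult_assoc subsetD)
    also have "?Z #> z = ?Z" using that(1) N.rcos_const by blast
    finally show ?thesis by (simp add: \<phi>'_def)
  qed
  show "\<phi>' (g [^] (n::nat)) = real n * \<phi>' g" if g: "g \<in> carrier G" for g n
  proof -
    have pow: "(?Z #> g) [^]\<^bsub>G Mod ?Z\<^esub> n = ?Z #> (g [^] n)"
      using g by (induction n) (simp_all add: mult FactGroup_def N.rcos_sum coset_mult_one N.subset)
    have "\<phi> ((?Z #> g) [^]\<^bsub>G Mod ?Z\<^esub> int n) = of_int (int n) * \<phi> (?Z #> g)"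
      using \<phi> car[OF g] unfolding homogeneous_quasimorphism_def by blast
    then show ?thesis
      unfolding int_pow_int pow \<phi>'_def by simp
  qed
qed

text \<open>A linearly independent set does not contain the zero function, and for extensional
  functions being zero means vanishing on the carrier.\<close>

lemma nonzero_quasimorphism:
  assumes "infinitely_many_independent_homogeneous_quasimorphisms \<Gamma>"
  obtains \<phi> g where "homogeneous_quasimorphism \<Gamma> \<phi>" "g \<in> carrier \<Gamma>" "\<phi> g \<noteq> 0"
proof -
  interpret field real_ring by (rule field_real_ring)
  interpret F: vectorspace real_ring "real_functions (carrier \<Gamma>)"
    by (intro vectorspace.intro func_space_is_module field_axioms)
  obtain \<Phi> where \<Phi>: "\<Phi> \<subseteq> carrier (real_functions (carrier \<Gamma>))" "infinite \<Phi>"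
    "\<And>\<phi>. \<phi> \<in> \<Phi> \<Longrightarrow> homogeneous_quasimorphism \<Gamma> \<phi>" "\<not> F.lin_dep \<Phi>"
    using assms unfolding infinitely_many_independent_homogeneous_quasimorphisms_def by blast
  obtain \<phi> where \<phi>: "\<phi> \<in> \<Phi>" using \<Phi>(2) by fastforce
  have "\<exists>g\<in>carrier \<Gamma>. \<phi> g \<noteq> 0"
  proof (rule ccontr)
    assume "\<not> ?thesis"
    moreover have "\<phi> \<in> extensional (carrier \<Gamma>)" using \<phi> \<Phi>(1) by (auto simp: real_functions_simps)
    ultimately have "\<phi> = \<zero>\<^bsub>real_functions (carrier \<Gamma>)\<^esub>"
      by (auto simp: real_functions_simps extensional_def fun_eq_iff)
    then show False using \<Phi>(4) \<phi> F.zero_lin_dep[of \<Phi>] one_not_zero by auto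
  qed
  then show ?thesis using that \<Phi>(3) \<phi> by blast
qed

subsection \<open>Trajectories of isotopies\<close>

lemma (in compact_manifold) cell_inside:
  assumes "openin (top_of_set M) W" "y \<in> W"
  obtains V where "cell V" "V \<subseteq> W" "y \<in> V"
  by (rule cell_neighbourhood[OF assms]) (use that in blast)

lemma (in compact_manifold) cell_at:
  assumes "y \<in> M"
  obtains V where "cell V" "y \<in> V"
  by (rule cell_inside[of M y]) (use assms that in auto)

lemma (in compact_manifold) locally_bounded_imp_bounded:
  fixes f :: "'m \<Rightarrow> real"
  assumes "\<And>y. y \<in> M \<Longrightarrow> \<exists>W B. openin (top_of_set M) W \<and> y \<in> W \<and> (\<forall>z\<in>W. \<bar>f z\<bar> \<le> B)"
  obtains B where "\<And>y. y \<in> M \<Longrightarrow> \<bar>f y\<bar> \<le> B"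
proof -
  have "\<forall>y\<in>M. \<exists>W B. open W \<and> y \<in> W \<and> (\<forall>z\<in>M \<inter> W. \<bar>f z\<bar> \<le> B)"
    using assms by (metis Int_iff openin_open)
  then obtain W B where W: "\<And>y. y \<in> M \<Longrightarrow> open (W y) \<and> y \<in> W y \<and> (\<forall>z\<in>M \<inter> W y. \<bar>f z\<bar> \<le> B y)"
    by metis
  obtain J where J: "J \<subseteq> M" "finite J" "M \<subseteq> (\<Union>y\<in>J. W y)"
    using compactE_image[OF compact_M, of M W] W by (metis UN_iff subsetI)
  have "\<bar>f y\<bar> \<le> (\<Sum>j\<in>J. \<bar>B j\<bar>)" if y: "y \<in> M" for y
  proof -
    obtain j where j: "j \<in> J" "y \<in> W j" using J(3) y by blast
    then have "\<bar>f y\<bar> \<le> \<bar>B j\<bar>" using W J(1) y by (meson IntI abs_ge_self order_trans subsetD)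
    also have "\<dots> \<le> (\<Sum>j\<in>J. \<bar>B j\<bar>)" using j(1) J(2) by (intro member_le_sum) auto
    finally show ?thesis .
  qed
  then show ?thesis by (rule that)
qed

text \<open>The base paths are chosen through a finite cover by cells, each shrunk to a compact core;
  thereby the paths near a given point represent only finitely many group elements.\<close>

lemma (in compact_manifold) exists_locally_finite_based_paths:
  assumes x: "x \<in> M"
  obtains e where "based_paths M x e"
    "\<And>y. y \<in> M \<Longrightarrow> \<exists>V F. openin (top_of_set M) V \<and> y \<in> V \<and> finite F \<and>
       (\<forall>p. path p \<and> path_image p \<subseteq> V \<and> pathfinish p = y \<longrightarrow> based_paths.c M e p \<in> F)"
proof -
  have "\<forall>y\<in>M. \<exists>V C N. cell V \<and> compact C \<and> C \<subseteq> V \<and> open N \<and> y \<in> N \<and> M \<inter> N \<subseteq> C"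
  proof
    fix y assume "y \<in> M"
    obtain V C N where "cell V" "compact C" "C \<subseteq> V" "openin (top_of_set M) N" "y \<in> N" "N \<subseteq> C"
      by (rule cell_neighbourhood[of M y]) (use \<open>y \<in> M\<close> in auto)
    then show "\<exists>V C N. cell V \<and> compact C \<and> C \<subseteq> V \<and> open N \<and> y \<in> N \<and> M \<inter> N \<subseteq> C"
      by (metis Int_iff openin_open)
  qed
  then obtain V C N where V: "\<And>y. y \<in> M \<Longrightarrow> cell (V y)" and C: "\<And>y. y \<in> M \<Longrightarrow> compact (C y)"
    "\<And>y. y \<in> M \<Longrightarrow> C y \<subseteq> V y" and N: "\<And>y. y \<in> M \<Longrightarrow> open (N y)" "\<And>y. y \<in> M \<Longrightarrow> y \<in> N y"
    "\<And>y. y \<in> M \<Longrightarrow> M \<inter> N y \<subseteq> C y"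
    unfolding bchoice_iff by blast
  obtain J where J: "J \<subseteq> M" "finite J" "M \<subseteq> (\<Union>j\<in>J. N j)"
    using compactE_image[OF compact_M, of M N] N by (metis UN_iff subsetI)
  have VM: "V j \<subseteq> M" if "j \<in> J" for j using V cell_open J(1) that openin_imp_subset by blast
  define \<iota> where "\<iota> y = (SOME j. j \<in> J \<and> y \<in> C j)" for y
  have \<iota>: "\<iota> y \<in> J" "y \<in> C (\<iota> y)" if "y \<in> M" for y
  proof -
    have "\<exists>j. j \<in> J \<and> y \<in> C j" using J that N(3) by blast
    then show "\<iota> y \<in> J" "y \<in> C (\<iota> y)" unfolding \<iota>_def by (metis (mono_tags, lifting) someI_ex)+
  qed
  have "\<forall>j\<in>J. \<exists>d. path d \<and> path_image d \<subseteq> M \<and> pathstart d = x \<and> pathfinish d = j"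
    using path_connected_M x J(1) unfolding path_connected_def by blast
  then obtain d where d: "\<And>j. j \<in> J \<Longrightarrow> path (d j)" "\<And>j. j \<in> J \<Longrightarrow> path_image (d j) \<subseteq> M"
    "\<And>j. j \<in> J \<Longrightarrow> pathstart (d j) = x" "\<And>j. j \<in> J \<Longrightarrow> pathfinish (d j) = j" by metis
  have jV: "j \<in> V j" if "j \<in> J" for j using C(2) N(2,3) J(1) that by blast
  have "\<forall>j\<in>J. \<forall>y\<in>V j. \<exists>r. path r \<and> path_image r \<subseteq> V j \<and> pathstart r = j \<and> pathfinish r = y"
  proof (intro ballI)
    fix j y assume j: "j \<in> J" and y: "y \<in> V j"
    have "path_connected (V j)"
      using cell_path_simple[OF V, of j] J(1) j unfolding path_simple_def by blast
    then show "\<exists>r. path r \<and> path_image r \<subseteq> V j \<and> pathstart r = j \<and> pathfinish r = y"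
      using jV[OF j] y unfolding path_connected_def by simp
  qed
  then obtain r where r: "\<And>j y. \<lbrakk>j \<in> J; y \<in> V j\<rbrakk> \<Longrightarrow> path (r j y)"
    "\<And>j y. \<lbrakk>j \<in> J; y \<in> V j\<rbrakk> \<Longrightarrow> path_image (r j y) \<subseteq> V j"
    "\<And>j y. \<lbrakk>j \<in> J; y \<in> V j\<rbrakk> \<Longrightarrow> pathstart (r j y) = j"
    "\<And>j y. \<lbrakk>j \<in> J; y \<in> V j\<rbrakk> \<Longrightarrow> pathfinish (r j y) = y"
    unfolding bchoice_iff by blast
  \<comment> \<open>First to the centre of a cell whose core contains \<open>y\<close>, then inside
    that cell. Only the choice \<open>\<iota> y\<close> of the cell can jump, and it has finitely
    many values.\<close>
  define e where "e y = d (\<iota> y) +++ r (\<iota> y) y" for y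
  have \<iota>V: "y \<in> V (\<iota> y)" if "y \<in> M" for y using \<iota>[OF that] C(2) J(1) by blast
  interpret B: based_paths M x e
  proof
    fix y assume y: "y \<in> M"
    note ry = r[OF \<iota>(1)[OF y] \<iota>V[OF y]] and dy = d[OF \<iota>(1)[OF y]]
    show "path (e y)" "pathstart (e y) = x" "pathfinish (e y) = y" using ry dy by (auto simp: e_def)
    show "path_image (e y) \<subseteq> M"
      unfolding e_def using ry dy VM[OF \<iota>(1)[OF y]] by (intro subset_path_image_join) auto
  qed (rule x)
  have dp: "d j \<in> B.paths" if "j \<in> J" for j using d[OF that] by (simp add: B.paths_def)
  have rp: "r j y \<in> B.paths" if "j \<in> J" "y \<in> V j" for j y
    using r[OF that] VM[OF that(1)] by (auto simp: B.paths_def)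
  define b where "b = path_class M (e x)"
  have b: "b \<in> carrier B.\<pi>"
    unfolding b_def using B.c_e[OF x] B.c_closed[OF B.e_paths[OF x]] by simp
  \<comment> \<open>As \<open>c (e y)\<close> is always \<open>b\<close>, the value of the second
    leg is determined by \<open>\<iota> y\<close> alone.\<close>
  have cr: "B.c (r (\<iota> y) y) = inv\<^bsub>B.\<pi>\<^esub> (B.c (d (\<iota> y))) \<otimes>\<^bsub>B.\<pi>\<^esub> b" if y: "y \<in> M" for y
  proof -
    note j = \<iota>(1)[OF y] and v = \<iota>V[OF y]
    have "B.c (d (\<iota> y)) \<otimes>\<^bsub>B.\<pi>\<^esub> B.c (r (\<iota> y) y) = B.c (d (\<iota> y) +++ r (\<iota> y) y)"
      by (rule B.c_join[symmetric]) (use dp rp d r j v in auto)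
    also have "\<dots> = B.c (e y)" by (simp only: e_def[of y])
    also have "\<dots> = b" unfolding b_def by (rule B.c_e[OF y])
    finally have "B.c (d (\<iota> y)) \<otimes>\<^bsub>B.\<pi>\<^esub> B.c (r (\<iota> y) y) = b" .
    then show ?thesis
      using B.c_closed[OF dp[OF j]] B.c_closed[OF rp[OF j v]] b by (metis B.\<pi>.inv_solve_left)
  qed
  show ?thesis
  proof
    show "based_paths M x e" by (rule B.based_paths_axioms)
    fix y assume y: "y \<in> M"
    \<comment> \<open>Removing the cores that miss \<open>y\<close> forces \<open>y\<close> into the
      core selected by any \<open>z\<close> in \<open>W\<close>; intersecting the cells whose cores
      contain \<open>y\<close> then puts all of \<open>W\<close>, and with it the path, into the
      cell of \<open>z\<close>.\<close>
    define W where "W = (\<Inter>j\<in>{j\<in>J. y \<in> C j}. V j) \<inter> (M - (\<Union>j\<in>{j\<in>J. y \<notin> C j}. C j))"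
    have "openin (top_of_set M) (\<Inter>j\<in>{j\<in>J. y \<in> C j}. V j)"
    proof (rule openin_INT2)
      have "\<iota> y \<in> {j\<in>J. y \<in> C j}" using \<iota>[OF y] by simp
      then show "{j\<in>J. y \<in> C j} \<noteq> {}" by blast
    qed (use J V cell_open in auto)
    moreover have "closed (\<Union>j\<in>{j\<in>J. y \<notin> C j}. C j)"
      using J C(1) by (intro closed_UN) (auto intro: compact_imp_closed)
    then have "openin (top_of_set M) (M - (\<Union>j\<in>{j\<in>J. y \<notin> C j}. C j))"
      by (metis Diff_eq open_Compl openin_open_Int)
    ultimately have Wop: "openin (top_of_set M) W" unfolding W_def by (rule openin_Int)
    have yW: "y \<in> W" using y C(2) J(1) by (auto simp: W_def)
    \<comment> \<open>This is the value of \<open>c p\<close> when the start of \<open>p\<close>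
      selects the cell \<open>j\<close>: in that simply connected cell, \<open>p\<close> is
      homotopic to going back to the centre and out again to \<open>y\<close>.\<close>
    define a where "a j = inv\<^bsub>B.\<pi>\<^esub> (inv\<^bsub>B.\<pi>\<^esub> (B.c (d j)) \<otimes>\<^bsub>B.\<pi>\<^esub> b) \<otimes>\<^bsub>B.\<pi>\<^esub> B.c (r j y)" for j
    have "B.c p \<in> a ` J" if p: "path p" "path_image p \<subseteq> W" "pathfinish p = y" for p
    proof -
      define z where "z = pathstart p"
      have z: "z \<in> W" using p(2) pathstart_in_path_image unfolding z_def by blast
      have zM: "z \<in> M" using z by (simp add: W_def)
      note j = \<iota>(1)[OF zM]
      have yj: "y \<in> C (\<iota> z)"
        using z \<iota>[OF zM] by (auto simp: W_def)
      then have yV: "y \<in> V (\<iota> z)" using C(2) J(1) j by blast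
      have pV: "path_image p \<subseteq> V (\<iota> z)" using p(2) yj j by (auto simp: W_def)
      have pp: "p \<in> B.paths" using p(1) pV VM[OF j] by (auto simp: B.paths_def)
      have "homotopic_paths (V (\<iota> z)) (r (\<iota> z) z +++ p) (r (\<iota> z) y)"
        using cell_path_simple[OF V] J(1) j unfolding path_simple_def
        using r[OF j \<iota>V[OF zM]] r[OF j yV] p(1,3) pV
        by (auto simp: z_def[symmetric] path_image_join)
      then have "homotopic_paths M (r (\<iota> z) z +++ p) (r (\<iota> z) y)"
        using VM[OF j] homotopic_paths_subset by blast
      then have "B.c (r (\<iota> z) z) \<otimes>\<^bsub>B.\<pi>\<^esub> B.c p = B.c (r (\<iota> z) y)"
        using B.c_homotopic B.c_join[OF rp[OF j \<iota>V[OF zM]] pp] r[OF j \<iota>V[OF zM]] by (simp add: z_def)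
      then have "B.c p = inv\<^bsub>B.\<pi>\<^esub> (B.c (r (\<iota> z) z)) \<otimes>\<^bsub>B.\<pi>\<^esub> B.c (r (\<iota> z) y)"
        using B.c_closed[OF rp[OF j \<iota>V[OF zM]]] B.c_closed[OF rp[OF j yV]] B.c_closed[OF pp]
        by (metis B.\<pi>.inv_solve_left)
      then have "B.c p = a (\<iota> z)" unfolding a_def cr[OF zM] .
      then show ?thesis using j by blast
    qed
    then show "\<exists>V F. openin (top_of_set M) V \<and> y \<in> V \<and> finite F \<and>
       (\<forall>p. path p \<and> path_image p \<subseteq> V \<and> pathfinish p = y \<longrightarrow> B.c p \<in> F)"
      using Wop yW J(2) by (intro exI[of _ W] exI[of _ "a ` J"]) auto
  qed
qed

subsection \<open>Continuous logarithms\<close>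

definition has_log :: "'a::topological_space set \<Rightarrow> ('a \<Rightarrow> complex) \<Rightarrow> bool" where
  "has_log S u \<longleftrightarrow> (\<exists>l. continuous_on S l \<and> (\<forall>z\<in>S. u z = exp (l z)))"

text \<open>The exponential of \<open>l - l'\<close> is the constant \<open>K\<close>, so the
  difference takes values in a translate of the multiples of \<open>2 * pi * \<i>\<close>. A
  continuous map from a connected set to such a discrete set is constant.\<close>

lemma logs_differ_by_constant:
  fixes l l' :: "'a::topological_space \<Rightarrow> complex"
  assumes S: "connected S" and l: "continuous_on S l" "continuous_on S l'"
    and eq: "\<And>z. z \<in> S \<Longrightarrow> exp (l z) = K * exp (l' z)"
    and ab: "a \<in> S" "b \<in> S"
  shows "l a - l' a = l b - l' b"
proof -
  have "(\<lambda>z. l z - l' z) constant_on S"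
  proof (rule continuous_discrete_range_constant[OF S])
    show "continuous_on S (\<lambda>z. l z - l' z)" by (intro continuous_intros l)
    fix z assume z: "z \<in> S"
    have "1 \<le> norm ((l w - l' w) - (l z - l' z))" if w: "w \<in> S" and ne: "l w - l' w \<noteq> l z - l' z" for w
    proof -
      have K: "exp (l v - l' v) = K" if "v \<in> S" for v using eq[OF that] by (simp add: exp_diff)
      then have "exp (l w - l' w) = exp (l z - l' z)" using w z by simp
      then obtain n :: int where n: "l w - l' w = (l z - l' z) + complex_of_real (of_int (2 * n) * pi) * \<i>"
        by (auto simp: exp_eq)
      then have "n \<noteq> 0" using ne by auto
      then have "1 \<le> \<bar>real_of_int n\<bar>" by linarith
      moreover have "norm ((l w - l' w) - (l z - l' z)) = 2 * pi * \<bar>real_of_int n\<bar>"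
        using n by (simp add: norm_mult abs_mult)
      moreover have "1 \<le> 2 * pi" using pi_gt3 by linarith
      ultimately show ?thesis by (metis mult_mono' mult_1 zero_le_one)
    qed
    then show "\<exists>e>0. \<forall>w. w \<in> S \<and> l w - l' w \<noteq> l z - l' z \<longrightarrow> e \<le> norm (l w - l' w - (l z - l' z))"
      by (intro exI[of _ 1]) auto
  qed
  then show ?thesis using ab unfolding constant_on_def by metis
qed

text \<open>The unit disc around 1 lies in the right half-plane, where the principal logarithm is
  continuous.\<close>

lemma has_log_near_1:
  assumes "continuous_on S q" "\<And>z. z \<in> S \<Longrightarrow> dist (q z) 1 < 1"
  shows "continuous_on S (\<lambda>z. Ln (q z))" "\<And>z. z \<in> S \<Longrightarrow> exp (Ln (q z)) = q z"
proof -
  have re: "0 < Re (q z)" if "z \<in> S" for z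
    using assms(2)[OF that] abs_Re_le_cmod[of "1 - q z"] by (auto simp: dist_norm norm_minus_commute)
  then show "continuous_on S (\<lambda>z. Ln (q z))"
    by (intro continuous_on_Ln' assms(1)) (auto simp: complex_nonpos_Reals_iff not_le)
  show "exp (Ln (q z)) = q z" if "z \<in> S" for z
    using re[OF that] by (intro exp_Ln) auto
qed

context compact_manifold
begin

text \<open>A point leaving \<open>V\<close> would land where \<open>H t\<close> is the identity,
  against injectivity.\<close>

lemma isotopy_stays:
  assumes H: "isotopy H" and K: "K \<subseteq> V" "\<And>t z. \<lbrakk>t \<in> {0..1}; z \<notin> K\<rbrakk> \<Longrightarrow> H t z = z"
    and z: "z \<in> V" "z \<in> M" and t: "t \<in> {0..1}"
  shows "H t z \<in> V"
proof (rule ccontr)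
  assume "H t z \<notin> V"
  then have "H t (H t z) = H t z" using K t by blast
  moreover have "inj_on (H t) M" using homeo_maps_M(3)[OF isotopyD(3)[OF H t]] .
  moreover have "H t z \<in> M" using isotopyD(4)[OF H t z(2)] .
  ultimately have "H t z = z" using z(2) by (metis inj_onD)
  then show False using \<open>H t z \<notin> V\<close> z by simp
qed

lemma local_log:
  fixes u :: "'m \<Rightarrow> complex"
  assumes u: "continuous_on S u" "\<And>z. z \<in> S \<Longrightarrow> u z \<noteq> 0"
    and S: "openin (top_of_set M) S" and y: "y \<in> S"
  obtains V l where "cell V" "V \<subseteq> S" "y \<in> V" "continuous_on V l" "\<And>z. z \<in> V \<Longrightarrow> u z = exp (l z)"
proof -
  have uy: "u y \<noteq> 0" using u(2) y by blast
  have "openin (top_of_set S) (S \<inter> (\<lambda>z. u z / u y) -` ball 1 1)"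
    by (rule continuous_openin_preimage_gen) (auto intro!: continuous_intros u(1) simp: uy)
  then have "openin (top_of_set M) (S \<inter> (\<lambda>z. u z / u y) -` ball 1 1)" using S by (rule openin_trans)
  moreover have "y \<in> S \<inter> (\<lambda>z. u z / u y) -` ball 1 1" using y uy by simp
  ultimately obtain V where V: "cell V" "V \<subseteq> S \<inter> (\<lambda>z. u z / u y) -` ball 1 1" "y \<in> V"
    by (rule cell_inside)
  have c: "continuous_on V (\<lambda>z. u z / u y)"
    using V(2) u(1) by (auto intro!: continuous_intros simp: uy elim: continuous_on_subset)
  have d: "dist (u z / u y) 1 < 1" if "z \<in> V" for z using V(2) that by (auto simp: dist_commute)
  have L1: "continuous_on V (\<lambda>z. Ln (u z / u y))" by (rule has_log_near_1(1)[OF c d])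
  have L2: "exp (Ln (u z / u y)) = u z / u y" if "z \<in> V" for z by (rule has_log_near_1(2)[OF c d that])
  show ?thesis
  proof (rule that[OF V(1) _ V(3)])
    show "continuous_on V (\<lambda>z. Ln (u z / u y) + Ln (u y))" by (intro continuous_intros L1)
    show "u z = exp (Ln (u z / u y) + Ln (u y))" if "z \<in> V" for z
      using L2[OF that] uy by (simp add: exp_add)
  qed (use V in blast)
qed

text \<open>Without boundary points the strict inequality is automatic; writing it out exhibits the
  coordinate image as an open subset of Euclidean space.\<close>

lemma cell_closed_manifold:
  assumes bd: "boundary = {}" and V: "cell V"
  obtains U \<phi> a r where "(U, \<phi>) \<in> \<A>" "0 < r" "ball a r \<inter> half_space k \<subseteq> \<phi> ` U"
    "V = {z\<in>U. \<phi> z \<in> ball a r \<inter> {w. 0 < w $ k}}"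
proof -
  obtain U \<phi> a r where U: "(U, \<phi>) \<in> \<A>" "0 < r" "ball a r \<inter> half_space k \<subseteq> \<phi> ` U"
    "V = {z\<in>U. \<phi> z \<in> ball a r}"
    using V by (auto simp: cell_def)
  have "0 < \<phi> z $ k" if "z \<in> U" for z using not_boundary_iff[OF U(1) that] bd by simp
  then have "V = {z\<in>U. \<phi> z \<in> ball a r \<inter> {w. 0 < w $ k}}" using U(4) by auto
  then show ?thesis using that U by blast
qed

lemma connected_ball_half_space_delete:
  assumes "2 \<le> CARD('n)"
  shows "connected (ball (a::real^'n) r \<inter> {w. 0 < w $ k} - {b})" "open (ball (a::real^'n) r \<inter> {w. 0 < w $ k} - {b})"
proof -
  have "convex {y::real^'n. 0 < y $ k}"
    using convex_halfspace_gt[of 0 "axis k (1::real)"] by (simp add: cart_eq_inner_axis inner_commute)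
  then have c: "connected (ball a r \<inter> {w. 0 < w $ k})"
    by (intro convex_connected convex_Int convex_ball)
  have o: "open (ball a r \<inter> {w. 0 < w $ k})"
    by (intro open_Int open_ball open_halfspace_component_gt_cart)
  show "connected (ball a r \<inter> {w. 0 < w $ k} - {b})"
    by (rule connected_open_delete[OF o c]) (use assms in simp)
  show "open (ball a r \<inter> {w. 0 < w $ k} - {b})" using o by (rule open_delete)
qed

text \<open>If \<open>y\<close> lies in the cell, its coordinate point is deleted first; in
  dimension at least 2 the remaining open set is still connected, so points can be pushed inside
  it.\<close>

lemma cell_push_avoiding:
  assumes bd: "boundary = {}" and dim: "2 \<le> CARD('n)" and V: "cell V"
    and pq: "p \<in> V" "q \<in> V" "p \<noteq> y" "q \<noteq> y"
  obtains H where "isotopy H" "H 1 p = q" "H 1 y = y"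
proof (cases "y \<in> V")
  case False
  obtain H K where "isotopy H" "K \<subseteq> V" "\<And>t z. \<lbrakk>t \<in> {0..1}; z \<notin> K\<rbrakk> \<Longrightarrow> H t z = z" "H 1 p = q"
    by (rule cell_push[OF V pq(1,2)]) (use bd in auto)
  moreover from this(2,3) have "H 1 y = y" using False by (meson atLeastAtMost_iff order_refl subsetD zero_le_one)
  ultimately show ?thesis using that by blast
next
  case y: True
  obtain U \<phi> a r where U: "(U, \<phi>) \<in> \<A>" "0 < r" "ball a r \<inter> half_space k \<subseteq> \<phi> ` U"
    "V = {z\<in>U. \<phi> z \<in> ball a r \<inter> {w. 0 < w $ k}}"
    by (rule cell_closed_manifold[OF bd V])
  obtain \<psi> where \<psi>: "homeomorphism U (\<phi> ` U) \<phi> \<psi>" by (rule chart_inverse[OF U(1)])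
  have inj: "\<phi> z \<noteq> \<phi> w" if "z \<in> U" "w \<in> U" "z \<noteq> w" for z w
    using \<psi> that by (metis homeomorphism_apply1)
  obtain H K where H: "isotopy H" "K \<subseteq> {z\<in>U. \<phi> z \<in> ball a r \<inter> {w. 0 < w $ k} - {\<phi> y}}"
    "\<And>t z. \<lbrakk>t \<in> {0..1}; z \<notin> K\<rbrakk> \<Longrightarrow> H t z = z" "H 1 p = q"
  proof (rule isotopy_push_chart[OF U(1), of "ball a r \<inter> {w. 0 < w $ k} - {\<phi> y}" p q])
    show "ball a r \<inter> {w. 0 < w $ k} - {\<phi> y} \<subseteq> \<phi> ` U" using U(3) by (auto simp: half_space_def)
  qed (use connected_ball_half_space_delete[OF dim] U(4) pq y inj in auto)
  have "H 1 y = y" using H(2) H(3)[of 1 y] by auto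
  then show ?thesis using that H by blast
qed

lemma cell_delete_connected:
  assumes bd: "boundary = {}" and dim: "2 \<le> CARD('n)" and V: "cell V" and y: "y \<in> V"
  shows "connected (V - {y})"
proof -
  obtain U \<phi> a r where U: "(U, \<phi>) \<in> \<A>" "0 < r" "ball a r \<inter> half_space k \<subseteq> \<phi> ` U"
    "V = {z\<in>U. \<phi> z \<in> ball a r \<inter> {w. 0 < w $ k}}"
    by (rule cell_closed_manifold[OF bd V])
  obtain \<psi> where \<psi>: "homeomorphism U (\<phi> ` U) \<phi> \<psi>" by (rule chart_inverse[OF U(1)])
  let ?T = "ball a r \<inter> {w. 0 < w $ k} - {\<phi> y}"
  have T: "?T \<subseteq> \<phi> ` U" using U(3) by (auto simp: half_space_def)
  have "V - {y} = \<psi> ` ?T"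
  proof
    show "V - {y} \<subseteq> \<psi> ` ?T"
    proof
      fix z assume z: "z \<in> V - {y}"
      then have "\<psi> (\<phi> z) = z" "\<psi> (\<phi> y) = y" using \<psi> U(4) y by (auto simp: homeomorphism_def)
      then have "\<phi> z \<in> ?T" using z U(4) by auto
      then show "z \<in> \<psi> ` ?T" using \<open>\<psi> (\<phi> z) = z\<close> by (metis imageI)
    qed
    show "\<psi> ` ?T \<subseteq> V - {y}"
      using T \<psi> U(4) by (auto simp: homeomorphism_def)
  qed
  moreover have "continuous_on ?T \<psi>" using \<psi> T by (meson continuous_on_subset homeomorphism_cont2)
  ultimately show ?thesis
    using connected_ball_half_space_delete(1)[OF dim] by (metis connected_continuous_image)
qed

lemma openin_M_delete: "openin (top_of_set M) (M - {y})"
  by (metis Diff_eq open_Compl openin_open_Int closed_singleton)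

text \<open>A punctured cell around \<open>y\<close> is connected, hence lies on one side of any
  separation of \<open>M - {y}\<close>. Adding \<open>y\<close> to that side would separate
  \<open>M\<close>.\<close>

lemma M_delete_connected:
  assumes bd: "boundary = {}" and dim: "2 \<le> CARD('n)"
  shows "connected (M - {y})"
proof (cases "y \<in> M")
  case y: True
  obtain V where V: "cell V" "y \<in> V" by (rule cell_at[OF y])
  have VM: "V \<subseteq> M" using V cell_open openin_imp_subset by blast
  have Vc: "connected (V - {y})" by (rule cell_delete_connected[OF bd dim V])
  have aux: False if E: "openin (top_of_set (M - {y})) E1" "openin (top_of_set (M - {y})) E2"
      "M - {y} \<subseteq> E1 \<union> E2" "E1 \<inter> E2 = {}" "E1 \<noteq> {}" and VE: "V - {y} \<subseteq> E2" for E1 E2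
  proof -
    have o: "openin (top_of_set M) E1" "openin (top_of_set M) E2"
      using E(1,2) openin_M_delete openin_trans by blast+
    have "openin (top_of_set M) (E2 \<union> V)" using o(2) cell_open[OF V(1)] by (rule openin_Un)
    moreover have "M \<subseteq> E1 \<union> (E2 \<union> V)" using E(3) V(2) by blast
    moreover have "E1 \<inter> (E2 \<union> V) = {}"
      using E(4) VE openin_imp_subset[OF E(1)] by blast
    moreover have "E2 \<union> V \<noteq> {}" using V(2) by blast
    ultimately show False using connected_M o(1) E(5) unfolding connected_openin by blast
  qed
  show ?thesis
    unfolding connected_openin
  proof clarify
    fix E1 E2 assume E: "openin (top_of_set (M - {y})) E1" "openin (top_of_set (M - {y})) E2"
      "M - {y} \<subseteq> E1 \<union> E2" "E1 \<inter> E2 = {}" "E1 \<noteq> {}" "E2 \<noteq> {}"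
    have VsubM: "V - {y} \<subseteq> M - {y}" using VM by blast
    have "openin (top_of_set (V - {y})) ((V - {y}) \<inter> E)" if "openin (top_of_set (M - {y})) E" for E
      using that VsubM unfolding openin_open by blast
    then have "openin (top_of_set (V - {y})) ((V - {y}) \<inter> E1)" "openin (top_of_set (V - {y})) ((V - {y}) \<inter> E2)"
      using E(1,2) by blast+
    then have "(V - {y}) \<inter> E1 = {} \<or> (V - {y}) \<inter> E2 = {}"
      using Vc E(3,4) VsubM unfolding connected_openin by blast
    then have "V - {y} \<subseteq> E2 \<or> V - {y} \<subseteq> E1" using E(3) VsubM by blast
    then show False using aux[of E1 E2] aux[of E2 E1] E by (metis Int_commute Un_commute)
  qed
next
  case False
  then show ?thesis using connected_M by simp
qed

end

subsection \<open>Lifting homeomorphisms along a circle-valued map\<close>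

text \<open>The map \<open>u\<close> stands for a nontrivial class in the first cohomology of
  \<open>M\<close>; the dimension bound is there because the argument moves points around a deleted
  one.\<close>

locale essential_map = compact_manifold k M \<A>
  for k :: "'n::finite" and M :: "'m::t2_space set"
    and \<A> :: "('m set \<times> ('m \<Rightarrow> real ^ 'n)) set" +
  fixes u :: "'m \<Rightarrow> complex"
  assumes closed: "boundary = {}" and dim: "2 \<le> CARD('n)"
    and u: "continuous_on M u" "\<And>z. z \<in> M \<Longrightarrow> u z \<noteq> 0" and essential: "\<not> has_log M u"
begin

text \<open>\<open>F\<close> is a logarithm of the quotient of \<open>u \<circ> g\<close> by
  \<open>u\<close>. It exists although \<open>u\<close> has none, because \<open>g\<close> is
  isotopic to the identity.\<close>

definition lift :: "('m \<Rightarrow> 'm) \<Rightarrow> ('m \<Rightarrow> complex) \<Rightarrow> bool" where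
  "lift g F \<longleftrightarrow> continuous_on M F \<and> (\<forall>z\<in>M. u (g z) = u z * exp (F z))"

lemma liftD:
  assumes "lift g F"
  shows "continuous_on M F" "z \<in> M \<Longrightarrow> u (g z) = u z * exp (F z)"
  using assms unfolding lift_def by blast+

text \<open>The relation \<open>R s t\<close> says that \<open>u \<circ> H t\<close> divided by
  \<open>u \<circ> H s\<close> has a logarithm. By compactness of \<open>M\<close> this quotient is
  uniformly close to 1 for nearby times, so the classes of \<open>R\<close> are open in the unit
  interval.\<close>

lemma lift_exists:
  assumes "g \<in> carrier (Homeo0 k M \<A>)"
  obtains F where "lift g F"
proof -
  obtain H where H: "isotopy H" "H 1 = g" using assms by (auto simp: carrier_Homeo0)
  note h = isotopyD[OF H(1)]
  define R where "R s t \<longleftrightarrow> (\<exists>F. continuous_on M F \<and> (\<forall>z\<in>M. u (H t z) = u (H s z) * exp (F z)))" for s t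
  have "R 0 1"
  proof (rule connected_equivalence_relation[of "{0..1::real}" 0 1 R])
    fix s t assume "R s t"
    then obtain F where "continuous_on M F" "\<forall>z\<in>M. u (H t z) = u (H s z) * exp (F z)" by (auto simp: R_def)
    then show "R t s" unfolding R_def
      by (intro exI[of _ "\<lambda>z. - F z"]) (auto intro!: continuous_intros simp: exp_minus field_simps)
  next
    fix r s t assume "R r s" "R s t"
    then obtain F F' where "continuous_on M F" "\<forall>z\<in>M. u (H s z) = u (H r z) * exp (F z)"
      "continuous_on M F'" "\<forall>z\<in>M. u (H t z) = u (H s z) * exp (F' z)" by (auto simp: R_def)
    then show "R r t" unfolding R_def
      by (intro exI[of _ "\<lambda>z. F z + F' z"]) (auto intro!: continuous_intros simp: exp_add)
  next
    fix t :: real assume t: "t \<in> {0..1}"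
    have uH: "continuous_on ({0..1} \<times> M) (\<lambda>p. u ((\<lambda>(s, z). H s z) p))"
      by (rule continuous_on_compose2[OF u(1) h(1)]) (use h(4) in auto)
    have uHt: "continuous_on ({0..1} \<times> M) (\<lambda>p. u ((\<lambda>(s, z). H s z) (t, snd p)))"
      by (rule continuous_on_compose2[OF uH]) (use t in \<open>auto intro!: continuous_intros\<close>)
    define q where "q p = u (H (fst p) (snd p)) / u (H t (snd p))" for p
    have q: "continuous_on ({0..1} \<times> M) q"
      unfolding q_def using uH uHt u(2) h(4) t by (intro continuous_intros) (auto simp: split_beta)
    obtain W where W: "t \<in> W" "open W" "\<forall>s\<in>W \<inter> {0..1}. \<forall>z\<in>M. dist (q (s, z)) (q (t, z)) \<le> 1/2"
      by (rule continuous_on_prod_compactE[OF q compact_M t, of "1/2"]) auto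
    have "R t s" if s: "s \<in> W \<inter> {0..1}" for s
    proof -
      have qt: "q (t, z) = 1" if "z \<in> M" for z using u(2) h(4) t that by (simp add: q_def)
      have d: "dist (q (s, z)) 1 < 1" if "z \<in> M" for z
      proof -
        have "dist (q (s, z)) (q (t, z)) \<le> 1/2" using W(3) s that by blast
        then show ?thesis using qt[OF that] by simp
      qed
      have c: "continuous_on M (\<lambda>z. q (s, z))"
        by (rule continuous_on_compose2[OF q]) (use s in \<open>auto intro!: continuous_intros\<close>)
      have L1: "continuous_on M (\<lambda>z. Ln (q (s, z)))" by (rule has_log_near_1(1)[OF c d])
      have L2: "exp (Ln (q (s, z))) = q (s, z)" if "z \<in> M" for z by (rule has_log_near_1(2)[OF c d that])
      have "u (H s z) = u (H t z) * exp (Ln (q (s, z)))" if "z \<in> M" for z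
        using L2[OF that] u(2)[OF h(4)[OF t that]] by (simp add: q_def)
      then show ?thesis unfolding R_def using L1 by blast
    qed
    moreover have "openin (top_of_set {0..1}) (W \<inter> {0..1})" using W(2) by (metis Int_commute openin_open_Int)
    ultimately show "\<exists>T. openin (top_of_set {0..1}) T \<and> t \<in> T \<and> (\<forall>s\<in>T. R t s)"
      using W(1) t by blast
  qed auto
  then show ?thesis using that h(2) H(2) by (auto simp: R_def lift_def)
qed

lemma lift_unique:
  assumes "lift g F" "lift g F'" "a \<in> M" "b \<in> M"
  shows "F a - F b = F' a - F' b"
proof -
  have "exp (F z) = 1 * exp (F' z)" if "z \<in> M" for z
    using assms(1,2) u(2)[OF that] that by (auto simp: lift_def)
  then have "F a - F' a = F b - F' b"
    using assms by (intro logs_differ_by_constant[OF connected_M, of F F' 1 a b]) (auto simp: lift_def)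
  then show ?thesis by (simp add: algebra_simps)
qed

lemma lift_comp:
  assumes "lift g F" "lift h F'" "h \<in> carrier (Homeo0 k M \<A>)"
  shows "lift (g \<circ> h) (\<lambda>z. F (h z) + F' z)"
proof -
  note h = Homeo0_maps[OF assms(3)]
  have "continuous_on M (\<lambda>z. F (h z))"
    by (rule continuous_on_compose2[OF liftD(1)[OF assms(1)] h(2)]) (use h(1) in blast)
  then have "continuous_on M (\<lambda>z. F (h z) + F' z)"
    by (intro continuous_on_add liftD(1)[OF assms(2)])
  moreover have "u ((g \<circ> h) z) = u z * exp (F (h z) + F' z)" if "z \<in> M" for z
  proof -
    have "u (g (h z)) = u (h z) * exp (F (h z))" "u (h z) = u z * exp (F' z)"
      using liftD(2)[OF assms(1) h(1)[OF that]] liftD(2)[OF assms(2) that] .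
    then show ?thesis by (simp add: exp_add)
  qed
  ultimately show ?thesis by (simp add: lift_def)
qed

text \<open>The difference cancels the constant by which two lifts of the same \<open>g\<close>
  differ, so the choice of \<open>F\<close> is immaterial.\<close>

definition variation :: "('m \<Rightarrow> 'm) \<Rightarrow> 'm \<Rightarrow> 'm \<Rightarrow> complex" where
  "variation g a b = (let F = SOME F. lift g F in F a - F b)"

lemma variation_eq:
  assumes "lift g F" "a \<in> M" "b \<in> M"
  shows "variation g a b = F a - F b"
proof -
  have "lift g (SOME F. lift g F)" using someI[of "lift g" F] assms(1) by simp
  then show ?thesis unfolding variation_def Let_def using assms by (intro lift_unique)
qed

text \<open>With \<open>variation_bounded\<close> this cocycle identity bounds the change of the
  variation under left multiplication by \<open>g\<close>, uniformly in \<open>h\<close>.\<close>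

lemma variation_comp:
  assumes g: "g \<in> carrier (Homeo0 k M \<A>)" and h: "h \<in> carrier (Homeo0 k M \<A>)" and ab: "a \<in> M" "b \<in> M"
  shows "variation (g \<circ> h) a b = variation g (h a) (h b) + variation h a b"
proof -
  obtain F F' where F: "lift g F" "lift h F'" using lift_exists g h by metis
  show ?thesis
    using variation_eq[OF lift_comp[OF F h]] variation_eq[OF F(1)] variation_eq[OF F(2)]
      Homeo0_maps(1)[OF h] ab by simp
qed

lemma variation_bounded:
  assumes g: "g \<in> carrier (Homeo0 k M \<A>)"
  obtains B where "\<And>a b. \<lbrakk>a \<in> M; b \<in> M\<rbrakk> \<Longrightarrow> norm (variation g a b) \<le> B"
proof -
  obtain F where F: "lift g F" using lift_exists g by metis
  then have "bounded (F ` M)"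
    using compact_M compact_continuous_image compact_imp_bounded liftD(1) by blast
  then obtain B where B: "\<And>z. z \<in> M \<Longrightarrow> norm (F z) \<le> B" by (auto simp: bounded_iff)
  show ?thesis
  proof (rule that[of "B + B"])
    fix a b assume "a \<in> M" "b \<in> M"
    then show "norm (variation g a b) \<le> B + B"
      unfolding variation_eq[OF F \<open>a \<in> M\<close> \<open>b \<in> M\<close>]
      using B norm_triangle_ineq4[of "F a" "F b"] by (meson add_mono order_trans)
  qed
qed

lemma exp_variation:
  assumes g: "g \<in> carrier (Homeo0 k M \<A>)" and ab: "a \<in> M" "b \<in> M" and b: "g b = b"
  shows "exp (variation g a b) = u (g a) / u a"
proof -
  obtain F where F: "lift g F" using lift_exists g by metis
  have "exp (F b) = 1" using liftD(2)[OF F ab(2)] u(2)[OF ab(2)] b by simp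
  moreover have "exp (F a) = u (g a) / u a" using liftD(2)[OF F ab(1)] u(2)[OF ab(1)] by simp
  ultimately show ?thesis unfolding variation_eq[OF F ab] by (simp add: exp_diff)
qed

text \<open>The push is supported in \<open>V\<close>, where \<open>u = exp l\<close>. Hence
  \<open>l \<circ> h - l\<close> on \<open>V\<close>, continued by 0, is a lift, and it vanishes at
  \<open>y\<close>.\<close>

lemma variation_push:
  assumes V: "cell V" and l: "continuous_on V l" "\<And>z. z \<in> V \<Longrightarrow> u z = exp (l z)"
    and y: "y \<in> M" "y \<notin> V" and ab: "a \<in> V" "b \<in> V"
  obtains h where "h \<in> carrier (Homeo0 k M \<A>)" "h a = b" "h y = y" "variation h a y = l b - l a"
proof -
  have VM: "V \<subseteq> M" using V cell_open openin_imp_subset by blast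
  obtain H K where H: "isotopy H" "compact K" "K \<subseteq> V"
    "\<And>t z. \<lbrakk>t \<in> {0..1}; z \<notin> K\<rbrakk> \<Longrightarrow> H t z = z" "H 1 a = b"
    by (rule cell_push[OF V ab]) (use closed in auto)
  let ?h = "H 1"
  have h: "?h \<in> carrier (Homeo0 k M \<A>)" using H(1) by (auto simp: carrier_Homeo0)
  have hV: "?h z \<in> V" if "z \<in> V" for z
    using isotopy_stays[OF H(1,3) H(4) that] that VM by auto
  define F where "F z = (if z \<in> V then l (?h z) - l z else 0)" for z
  have "lift ?h F" unfolding lift_def
  proof
    show "continuous_on M F"
    proof (rule continuous_on_open_cover2)
      show "openin (top_of_set M) V" by (rule cell_open[OF V])
      show "openin (top_of_set M) (M - K)"
        using compact_imp_closed[OF H(2)] by (metis Diff_eq open_Compl openin_open_Int)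
      show "M \<subseteq> V \<union> (M - K)" using H(3) by blast
      have "continuous_on V ?h" using Homeo0_maps(2)[OF h] VM continuous_on_subset by blast
      then have "continuous_on V (\<lambda>z. l (?h z) - l z)"
        using hV by (intro continuous_intros l(1) continuous_on_compose2[OF l(1)]) auto
      then show "continuous_on V F" by (rule continuous_on_eq) (simp add: F_def)
      have "continuous_on (M - K) (\<lambda>_. 0 :: complex)" by (intro continuous_intros)
      then show "continuous_on (M - K) F" by (rule continuous_on_eq) (auto simp: F_def H(4))
    qed
    show "\<forall>z\<in>M. u (?h z) = u z * exp (F z)"
    proof
      fix z assume "z \<in> M"
      show "u (?h z) = u z * exp (F z)"
      proof (cases "z \<in> V")
        case True
        then show ?thesis using l(2) hV by (simp add: F_def exp_diff)
      next
        case False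
        then have "?h z = z" using H(3) H(4)[of 1 z] by auto
        then show ?thesis using False by (simp add: F_def)
      qed
    qed
  qed
  then have "variation ?h a y = F a - F y" by (rule variation_eq) (use ab VM y in auto)
  also have "\<dots> = l b - l a" using ab y H(5) by (simp add: F_def)
  finally have v: "variation ?h a y = l b - l a" .
  have "?h y = y" using y(2) H(3) H(4)[of 1 y] by auto
  then show ?thesis using that[of ?h] h H(5) v by blast
qed

text \<open>Pushes in small cells make the orbits of the stabilizer of \<open>y\<close> open in the
  connected set \<open>M - {y}\<close>.\<close>

lemma transitive_avoiding:
  assumes y: "y \<in> M" and z: "z \<in> M - {y}" "z' \<in> M - {y}"
  obtains g where "g \<in> carrier (Homeo0 k M \<A>)" "g z = z'" "g y = y"
proof -
  define R where "R z z' \<longleftrightarrow> (\<exists>g\<in>carrier (Homeo0 k M \<A>). g z = z' \<and> g y = y)" for z z'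
  have trans: "R a c" if "R a b" "R b c" for a b c
  proof -
    obtain g h where "g \<in> carrier (Homeo0 k M \<A>)" "g a = b" "g y = y"
      "h \<in> carrier (Homeo0 k M \<A>)" "h b = c" "h y = y" using \<open>R a b\<close> \<open>R b c\<close> by (auto simp: R_def)
    then show ?thesis unfolding R_def by (intro bexI[of _ "h \<circ> g"]) (auto intro: Homeo0_comp)
  qed
  have "R z z' \<and> R z' z"
  proof (rule connected_equivalence_relation[OF M_delete_connected[OF closed dim] z,
        where R = "\<lambda>a b. R a b \<and> R b a"])
    fix a assume a: "a \<in> M - {y}"
    obtain V where V: "cell V" "V \<subseteq> M - {y}" "a \<in> V" by (rule cell_inside[OF openin_M_delete a])
    have push: "R c b" if cb: "c \<in> V" "b \<in> V" for b c
    proof -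
      obtain H where "isotopy H" "H 1 c = b" "H 1 y = y"
        by (rule cell_push_avoiding[OF closed dim V(1) cb, of y]) (use cb V(2) in auto)
      then show ?thesis unfolding R_def by (intro bexI[of _ "H 1"]) (auto simp: carrier_Homeo0)
    qed
    have "openin (top_of_set (M - {y})) V"
      using cell_open[OF V(1)] V(2) by (meson Diff_subset openin_subset_trans)
    then show "\<exists>T. openin (top_of_set (M - {y})) T \<and> a \<in> T \<and> (\<forall>b\<in>T. R a b \<and> R b a)"
      using V(3) push by (intro exI[of _ V]) auto
  qed (auto intro: trans)
  then show ?thesis using that by (auto simp: R_def)
qed

text \<open>If every homeomorphism fixing \<open>x\<close> and \<open>y\<close> had zero variation between them, the variation
  of homeomorphisms moving \<open>x\<close> to \<open>z\<close> would define a logarithm of \<open>u\<close> at \<open>z\<close>.\<close>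

lemma exists_nonzero_variation:
  assumes xy: "x \<in> M" "y \<in> M" "x \<noteq> y"
  obtains P where "P \<in> carrier (Homeo0 k M \<A>)" "P x = x" "P y = y" "variation P x y \<noteq> 0"
proof (rule ccontr)
  let ?G = "carrier (Homeo0 k M \<A>)"
  assume "\<not> thesis"
  then have zero: "variation P x y = 0" if "P \<in> ?G" "P x = x" "P y = y" for P
    using that \<open>\<And>P. \<lbrakk>P \<in> ?G; P x = x; P y = y; variation P x y \<noteq> 0\<rbrakk> \<Longrightarrow> thesis\<close> by blast
  have "\<forall>z\<in>M - {y}. \<exists>Q\<in>?G. Q x = z \<and> Q y = y"
    using transitive_avoiding[OF xy(2), of x] xy by (metis Diff_iff singletonD)
  then obtain Q where Q: "\<And>z. z \<in> M - {y} \<Longrightarrow> Q z \<in> ?G" "\<And>z. z \<in> M - {y} \<Longrightarrow> Q z x = z"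
    "\<And>z. z \<in> M - {y} \<Longrightarrow> Q z y = y"
    unfolding bchoice_iff by (metis (no_types, lifting))
  \<comment> \<open>Following both homeomorphisms by the same \<open>S\<close>, which returns
    \<open>z\<close> to \<open>x\<close>, gives elements fixing \<open>x\<close> and
    \<open>y\<close>. Their variations vanish, and the contribution of \<open>S\<close> is the same
    in both.\<close>
  have well: "variation g x y = variation g' x y"
    if g: "g \<in> ?G" "g x = z" "g y = y" and g': "g' \<in> ?G" "g' x = z" "g' y = y" and z: "z \<in> M - {y}" for g g' z
  proof -
    obtain S where S: "S \<in> ?G" "S z = x" "S y = y"
      by (rule transitive_avoiding[OF xy(2) z, of x]) (use xy in auto)
    have "variation (S \<circ> g) x y = 0" "variation (S \<circ> g') x y = 0"
      using g g' S by (auto intro!: zero Homeo0_comp)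
    then show ?thesis
      using variation_comp[OF S(1) g(1) xy(1,2)] variation_comp[OF S(1) g'(1) xy(1,2)] g g' by (metis add_left_cancel)
  qed
  define L where "L z = variation (Q z) x y" for z
  have expL: "exp (L z) = u z / u x" if "z \<in> M - {y}" for z
    using exp_variation[OF Q(1)[OF that] xy(1,2) Q(3)[OF that]] Q(2)[OF that] by (simp add: L_def)
  have contL: "continuous_on (M - {y}) L"
  proof (rule continuous_on_eq_continuous_within[THEN iffD2], rule ballI)
    fix z assume z: "z \<in> M - {y}"
    have "continuous_on (M - {y}) u" using u(1) continuous_on_subset by blast
    then obtain V l where V: "cell V" "V \<subseteq> M - {y}" "z \<in> V" "continuous_on V l" "\<And>w. w \<in> V \<Longrightarrow> u w = exp (l w)"
      by (rule local_log[OF _ _ openin_M_delete z]) (use u(2) in auto)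
    \<comment> \<open>A push from \<open>z\<close> to \<open>w\<close> after \<open>Q z\<close> is
      as good a choice as \<open>Q w\<close>, so \<open>L\<close> changes on \<open>V\<close>
      exactly as the local logarithm \<open>l\<close> does.\<close>
    have step: "L w = L z + (l w - l z)" if w: "w \<in> V" for w
    proof -
      obtain h where h: "h \<in> ?G" "h z = w" "h y = y" "variation h z y = l w - l z"
        by (rule variation_push[OF V(1,4,5) xy(2) _ V(3) w]) (use V(2) in auto)
      have wM: "w \<in> M - {y}" using w V(2) by blast
      have "L w = variation (h \<circ> Q z) x y"
        unfolding L_def using Q wM z h by (intro well[of _ w]) (auto intro!: Homeo0_comp)
      also have "\<dots> = variation h z y + L z"
        using variation_comp[OF h(1) Q(1)[OF z] xy(1,2)] Q(2,3)[OF z] by (simp add: L_def)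
      finally show ?thesis using h(4) by simp
    qed
    have "continuous_on V (\<lambda>w. L z + (l w - l z))" by (intro continuous_intros V(4))
    then have "continuous_on V L" by (rule continuous_on_eq) (rule step[symmetric])
    then have "continuous (at z within V) L" using V(3) by (simp add: continuous_on_eq_continuous_within)
    moreover obtain T where T: "open T" "V = (M - {y}) \<inter> T"
      using cell_open[OF V(1)] V(2) by (meson Diff_subset openin_open openin_subset_trans)
    then have "at z within V = at z within (M - {y})"
      using V(3) at_within_open_subset by (intro at_within_nhd[of _ T]) auto
    ultimately show "continuous (at z within M - {y}) L" by simp
  qed
  \<comment> \<open>So far \<open>L\<close> is defined off \<open>y\<close> only. On a punctured
    cell around \<open>y\<close>, which is connected, it differs from a local logarithm of
    \<open>u\<close> by a constant and therefore extends over \<open>y\<close>.\<close>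
  obtain V l where V: "cell V" "V \<subseteq> M" "y \<in> V" "continuous_on V l" "\<And>w. w \<in> V \<Longrightarrow> u w = exp (l w)"
    by (rule local_log[OF u, of y]) (use xy(2) in auto)
  obtain w where w: "w \<in> V - {y}"
  proof -
    have "\<not> V \<subseteq> {y}"
    proof
      assume "V \<subseteq> {y}"
      then have "openin (top_of_set M) {y}" using cell_open[OF V(1)] V(3) by (metis subset_singletonD empty_iff)
      moreover have "openin (top_of_set M) (M - {y})" by (rule openin_M_delete)
      ultimately show False
        using connected_M xy unfolding connected_openin by blast
    qed
    then show ?thesis using that by blast
  qed
  have ux: "u x \<noteq> 0" using u(2) xy by blast
  have diff: "L z - l z = L w - l w" if z: "z \<in> V - {y}" for z
  proof (rule logs_differ_by_constant[OF cell_delete_connected[OF closed dim V(1,3)], where K = "inverse (u x)"])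
    show "continuous_on (V - {y}) L" using contL V(2) by (auto elim: continuous_on_subset)
    show "continuous_on (V - {y}) l" using V(4) by (auto elim: continuous_on_subset)
    show "exp (L z) = inverse (u x) * exp (l z)" if "z \<in> V - {y}" for z
    proof -
      have "z \<in> M - {y}" "z \<in> V" using that V(2) by auto
      then show ?thesis using expL[of z] V(5)[of z] by (simp add: field_simps)
    qed
  qed (use z w in auto)
  \<comment> \<open>The summand \<open>Ln (u x)\<close> is due to
    \<open>exp (L z) = u z / u x\<close>.\<close>
  define L' where "L' z = (if z = y then l y + (L w - l w) else L z) + Ln (u x)" for z
  have "has_log M u" unfolding has_log_def
  proof (intro exI[of _ L'] conjI ballI)
    show "continuous_on M L'"
    proof (rule continuous_on_open_cover2[OF cell_open[OF V(1)] openin_M_delete])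
      show "M \<subseteq> V \<union> (M - {y})" using V(3) by blast
      have eq: "l z + (L w - l w) + Ln (u x) = L' z" if "z \<in> V" for z
      proof (cases "z = y")
        case False
        then have "L z - l z = L w - l w" using diff that by blast
        then show ?thesis using False by (simp add: L'_def algebra_simps)
      qed (simp add: L'_def)
      have "continuous_on V (\<lambda>z. l z + (L w - l w) + Ln (u x))" by (intro continuous_intros V(4))
      then show "continuous_on V L'" by (rule continuous_on_eq) (rule eq)
      have "continuous_on (M - {y}) (\<lambda>z. L z + Ln (u x))" by (intro continuous_intros contL)
      then show "continuous_on (M - {y}) L'" by (rule continuous_on_eq) (simp add: L'_def)
    qed
    fix z assume z: "z \<in> M"
    show "u z = exp (L' z)"
    proof (cases "z = y")
      case False
      then show ?thesis using expL[of z] z ux by (simp add: L'_def exp_add)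
    next
      case True
      have wM: "w \<in> M - {y}" using w V(2) by blast
      have "exp (L w - l w) = 1 / u x"
        using expL[OF wM] V(5)[of w] w u(2)[of w] wM by (simp add: exp_diff)
      then show ?thesis using True V(5)[OF V(3)] ux by (simp add: L'_def exp_add)
    qed
  qed
  then show False using essential by simp
qed

theorem infinite_dim_cohomology:
  "\<not> vectorspace.fin_dim real_ring (bounded_cohomology (Homeo0 k M \<A>) 1 2)"
proof -
  let ?G = "Homeo0 k M \<A>"
  obtain x where x: "x \<in> M" using M_nonempty by blast
  have "\<not> M \<subseteq> {x}"
  proof
    assume "M \<subseteq> {x}"
    then have "has_log M u" unfolding has_log_def
      using u(2)[OF x] by (intro exI[of _ "\<lambda>_. Ln (u x)"]) (auto intro!: continuous_intros)
    then show False using essential by simp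
  qed
  then obtain y where y: "y \<in> M" "x \<noteq> y" by blast
  obtain P where P: "P \<in> carrier ?G" "P x = x" "P y = y" "variation P x y \<noteq> 0"
    by (rule exists_nonzero_variation[OF x y])
  define f where "f g = Im (variation g x y)" for g
  \<comment> \<open>Because \<open>P\<close> fixes both points, its nonzero variation is a multiple
    of \<open>2 * pi * \<i>\<close>; hence its imaginary part is what grows along the powers of
    \<open>P\<close>.\<close>
  have "exp (variation P x y) = 1" using exp_variation[OF P(1) x y(1) P(3)] P(2) u(2)[OF x] by simp
  then have "Re (variation P x y) = 0" by (simp add: exp_eq_1)
  then have w: "f P \<noteq> 0" using P(4) by (simp add: f_def complex_eq_iff)
  have Pn: "P ^^ n \<in> carrier ?G \<and> (P ^^ n) x = x \<and> (P ^^ n) y = y" for n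
    using P Homeo0_id Homeo0_comp[OF P(1)] by (induction n) (auto simp: id_def)
  have fcomp: "f (g \<circ> h) = Im (variation g (h x) (h y)) + f h" if "g \<in> carrier ?G" "h \<in> carrier ?G" for g h
    using variation_comp[OF that x y(1)] by (simp add: f_def)
  show ?thesis
  proof (rule infinite_dim_H2[where f = f and p = P and P = "\<lambda>n. P ^^ n" and w = "f P"])
    show "f (P ^^ n) = real n * f P" for n
    proof (induction n)
      case 0
      have "lift id (\<lambda>_. 0)" by (simp add: lift_def)
      then show ?case using variation_eq[of id "\<lambda>_. 0"] x y(1) by (simp add: f_def id_def)
    next
      case (Suc n)
      have "f (P ^^ Suc n) = f P + f (P ^^ n)"
        unfolding funpow.simps using fcomp[OF P(1), of "P ^^ n"] Pn[of n] by (simp only: f_def)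
      also have "\<dots> = real (Suc n) * f P" unfolding Suc by (simp add: algebra_simps)
      finally show ?case .
    qed
    fix g assume g: "g \<in> carrier ?G"
    obtain B where B: "\<And>a b. \<lbrakk>a \<in> M; b \<in> M\<rbrakk> \<Longrightarrow> norm (variation g a b) \<le> B"
      by (rule variation_bounded[OF g]) blast
    have "\<bar>f (g \<otimes>\<^bsub>?G\<^esub> h) - f h\<bar> \<le> B" if h: "h \<in> carrier ?G" for h
      using fcomp[OF g h] B[OF Homeo0_maps(1)[OF h x] Homeo0_maps(1)[OF h y(1)]]
        abs_Im_le_cmod[of "variation g (h x) (h y)"] by simp
    then show "\<exists>C. \<forall>h\<in>carrier ?G. \<bar>f (g \<otimes>\<^bsub>?G\<^esub> h) - f h\<bar> \<le> C" by blast
  qed (use P w Pn Homeo0_comp in \<open>auto simp: o_assoc\<close>)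
qed

end

section \<open>Values of a quasimorphism on trajectories of isotopies\<close>

locale centre_invariant_quasimorphism = compact_manifold k M \<A> + based_paths M x e
  for k :: "'n::finite" and M :: "'m::t2_space set"
    and \<A> :: "('m set \<times> ('m \<Rightarrow> real ^ 'n)) set" and x e +
  fixes \<phi> :: "(real \<Rightarrow> 'm) set \<Rightarrow> real" and D :: real
  assumes locally_finite: "\<And>y. y \<in> M \<Longrightarrow> \<exists>V F. openin (top_of_set M) V \<and> y \<in> V \<and> finite F \<and>
       (\<forall>p. path p \<and> path_image p \<subseteq> V \<and> pathfinish p = y \<longrightarrow> c p \<in> F)"
    and defect: "\<And>g h. \<lbrakk>g \<in> carrier \<pi>; h \<in> carrier \<pi>\<rbrakk> \<Longrightarrow> \<bar>\<phi> (g \<otimes>\<^bsub>\<pi>\<^esub> h) - \<phi> g - \<phi> h\<bar> \<le> D"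
    and central: "\<And>z g. \<lbrakk>z \<in> group_centre \<pi>; g \<in> carrier \<pi>\<rbrakk> \<Longrightarrow> \<phi> (z \<otimes>\<^bsub>\<pi>\<^esub> g) = \<phi> g"
    and homogeneous: "\<And>g n. g \<in> carrier \<pi> \<Longrightarrow> \<phi> (g [^]\<^bsub>\<pi>\<^esub> (n::nat)) = real n * \<phi> g"
begin

definition trajectory :: "(real \<Rightarrow> 'm \<Rightarrow> 'm) \<Rightarrow> 'm \<Rightarrow> real \<Rightarrow> 'm" where
  "trajectory H y = (\<lambda>t. H t y)"

lemma trajectory_paths:
  assumes "isotopy H" "y \<in> M"
  shows "trajectory H y \<in> paths" "pathstart (trajectory H y) = y" "pathfinish (trajectory H y) = H 1 y"
proof -
  note H = isotopyD[OF assms(1)]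
  have "continuous_on {0..1} (\<lambda>t. (\<lambda>(t, x). H t x) (t, y))"
    by (rule continuous_on_compose2[OF H(1)]) (use assms(2) in \<open>auto intro!: continuous_intros\<close>)
  then show "trajectory H y \<in> paths"
    using H(4) assms(2) by (auto simp: paths_def trajectory_def path_def path_image_def)
qed (auto simp: trajectory_def pathstart_def pathfinish_def isotopyD(2)[OF assms(1)])

lemma image_path_paths:
  assumes "isotopy H" "p \<in> paths"
  shows "H 1 \<circ> p \<in> paths"
proof -
  have h: "H 1 \<in> homeos_rel_boundary k M \<A>" using isotopyD(3)[OF assms(1)] by simp
  then have "continuous_on (path_image p) (H 1)"
    using homeo_maps_M(1) assms(2) continuous_on_subset unfolding paths_def by blast
  then show ?thesis
    using assms(2) homeo_maps_M(2)[OF h] by (auto simp: paths_def path_image_compose intro: path_continuous_image)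
qed

text \<open>The four paths are the sides of the square \<open>H t (p s)\<close>.\<close>

lemma trajectory_natural:
  assumes H: "isotopy H" and p: "p \<in> paths"
  shows "c p \<otimes>\<^bsub>\<pi>\<^esub> c (trajectory H (pathfinish p)) = c (trajectory H (pathstart p)) \<otimes>\<^bsub>\<pi>\<^esub> c (H 1 \<circ> p)"
proof -
  note h = isotopyD[OF H]
  note ends = paths_ends[OF p]
  let ?K = "\<lambda>st. H (snd st) (p (fst st))"
  have pM: "p s \<in> M" if "s \<in> {0..1}" for s using p that by (auto simp: paths_def path_image_def)
  have pc: "continuous_on {0..1} p" using p by (simp add: paths_def path_def)
  have "continuous_on ({0..1} \<times> {0..1}) (\<lambda>st. (\<lambda>(t, x). H t x) (snd st, p (fst st)))"
    by (rule continuous_on_compose2[OF h(1)])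
      (use pM in \<open>auto intro!: continuous_intros continuous_on_compose2[OF pc]\<close>)
  then have K: "continuous_on ({0..1} \<times> {0..1}) ?K" by simp
  have "homotopic_paths M ((\<lambda>s. ?K (s, 0)) +++ (\<lambda>t. ?K (1, t))) ((\<lambda>t. ?K (0, t)) +++ (\<lambda>s. ?K (s, 1)))"
    by (rule homotopic_square(1)[OF K]) (use h(4) pM in auto)
  moreover have "(\<lambda>s. ?K (s, 0)) = p" "(\<lambda>t. ?K (1, t)) = trajectory H (pathfinish p)"
    "(\<lambda>t. ?K (0, t)) = trajectory H (pathstart p)" "(\<lambda>s. ?K (s, 1)) = H 1 \<circ> p"
    by (auto simp: h(2) trajectory_def pathstart_def pathfinish_def)
  ultimately have "c (p +++ trajectory H (pathfinish p)) = c (trajectory H (pathstart p) +++ (H 1 \<circ> p))"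
    by (metis c_homotopic)
  then show ?thesis
    using c_join[OF p trajectory_paths(1)[OF H ends(2)]]
      c_join[OF trajectory_paths(1)[OF H ends(1)] image_path_paths[OF H p]]
      trajectory_paths[OF H ends(1)] trajectory_paths[OF H ends(2)]
    by (simp add: pathstart_compose)
qed

text \<open>The trajectory of the composite is the diagonal of the square
  \<open>H t (H' s y)\<close>, hence homotopic to following \<open>H'\<close> first and then
  \<open>H\<close> from the point reached.\<close>

lemma trajectory_comp:
  assumes H: "isotopy H" and H': "isotopy H'" and y: "y \<in> M"
  shows "c (trajectory (\<lambda>t. H t \<circ> H' t) y) = c (trajectory H' y) \<otimes>\<^bsub>\<pi>\<^esub> c (trajectory H (H' 1 y))"
proof -
  note h = isotopyD[OF H] and h' = isotopyD[OF H']
  let ?K = "\<lambda>st. H (snd st) (H' (fst st) y)"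
  have "continuous_on {0..1} (\<lambda>t. H' t y)"
    using trajectory_paths(1)[OF H' y] by (simp add: paths_def path_def trajectory_def)
  then have "continuous_on ({0..1} \<times> {0..1}) (\<lambda>st. (\<lambda>(t, x). H t x) (snd st, H' (fst st) y))"
    by (intro continuous_on_compose2[OF h(1)] continuous_intros)
      (use h'(4) y in \<open>auto intro!: continuous_intros elim!: continuous_on_compose2\<close>)
  then have K: "continuous_on ({0..1} \<times> {0..1}) ?K" by simp
  have "homotopic_paths M (\<lambda>t. ?K (t, t)) ((\<lambda>s. ?K (s, 0)) +++ (\<lambda>t. ?K (1, t)))"
    by (rule homotopic_square(2)[OF K]) (use h(4) h'(4) y in auto)
  moreover have "(\<lambda>t. ?K (t, t)) = trajectory (\<lambda>t. H t \<circ> H' t) y" "(\<lambda>s. ?K (s, 0)) = trajectory H' y"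
    "(\<lambda>t. ?K (1, t)) = trajectory H (H' 1 y)"
    by (auto simp: h(2) trajectory_def)
  ultimately have "c (trajectory (\<lambda>t. H t \<circ> H' t) y) = c (trajectory H' y +++ trajectory H (H' 1 y))"
    by (metis c_homotopic)
  also have "\<dots> = c (trajectory H' y) \<otimes>\<^bsub>\<pi>\<^esub> c (trajectory H (H' 1 y))"
    using trajectory_paths[OF H' y] trajectory_paths[OF H, of "H' 1 y"] h'(4)[of 1 y] y
    by (intro c_join) auto
  finally show ?thesis .
qed

text \<open>Two isotopies with the same end differ by a loop of homeomorphisms, whose trajectories are
  central.\<close>

lemma trajectory_unique:
  assumes H: "isotopy H" and H': "isotopy H'" and eq: "H 1 = H' 1" and y: "y \<in> M"
  shows "\<phi> (c (trajectory H y)) = \<phi> (c (trajectory H' y))"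
proof -
  let ?p = "c (trajectory H y)" and ?q = "c (trajectory H' y)"
  have pq: "?p \<in> carrier \<pi>" "?q \<in> carrier \<pi>" using trajectory_paths(1)[OF _ y] H H' by auto
  have "?p \<otimes>\<^bsub>\<pi>\<^esub> inv\<^bsub>\<pi>\<^esub> ?q \<otimes>\<^bsub>\<pi>\<^esub> g = g \<otimes>\<^bsub>\<pi>\<^esub> (?p \<otimes>\<^bsub>\<pi>\<^esub> inv\<^bsub>\<pi>\<^esub> ?q)" if g: "g \<in> carrier \<pi>" for g
  proof -
    obtain l where l: "l \<in> loops M y" "c l = g" by (rule c_surj_loops[OF g y])
    then have lp: "l \<in> paths" "pathstart l = y" "pathfinish l = y" by (auto simp: loops_def paths_def)
    let ?g = "c (H 1 \<circ> l)"
    have g': "?g \<in> carrier \<pi>" using image_path_paths[OF H lp(1)] by simp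
    \<comment> \<open>The element \<open>?g\<close> depends on the end of the isotopy only, so
      \<open>?p\<close> and \<open>?q\<close> conjugate \<open>g\<close> to the same element and
      their quotient commutes with \<open>g\<close>. Every \<open>g\<close> is covered, being the
      value of a loop at \<open>y\<close>.\<close>
    have 1: "g \<otimes>\<^bsub>\<pi>\<^esub> ?p = ?p \<otimes>\<^bsub>\<pi>\<^esub> ?g" using trajectory_natural[OF H lp(1)] l lp by simp
    have 2: "g \<otimes>\<^bsub>\<pi>\<^esub> ?q = ?q \<otimes>\<^bsub>\<pi>\<^esub> ?g" using trajectory_natural[OF H' lp(1)] l lp eq by simp
    have "inv\<^bsub>\<pi>\<^esub> ?q \<otimes>\<^bsub>\<pi>\<^esub> g = ?g \<otimes>\<^bsub>\<pi>\<^esub> inv\<^bsub>\<pi>\<^esub> ?q"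
      using 2 g g' pq by (metis \<pi>.inv_closed \<pi>.inv_solve_left \<pi>.inv_solve_right \<pi>.m_assoc \<pi>.m_closed)
    then have "?p \<otimes>\<^bsub>\<pi>\<^esub> inv\<^bsub>\<pi>\<^esub> ?q \<otimes>\<^bsub>\<pi>\<^esub> g = ?p \<otimes>\<^bsub>\<pi>\<^esub> ?g \<otimes>\<^bsub>\<pi>\<^esub> inv\<^bsub>\<pi>\<^esub> ?q"
      using g g' pq by (simp add: \<pi>.m_assoc)
    then show ?thesis using 1 g g' pq by (metis \<pi>.inv_closed \<pi>.m_assoc)
  qed
  then have "?p \<otimes>\<^bsub>\<pi>\<^esub> inv\<^bsub>\<pi>\<^esub> ?q \<in> group_centre \<pi>" using pq by (auto simp: group_centre_def)
  then have "\<phi> (?p \<otimes>\<^bsub>\<pi>\<^esub> inv\<^bsub>\<pi>\<^esub> ?q \<otimes>\<^bsub>\<pi>\<^esub> ?q) = \<phi> ?q" using central pq(2) by blast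
  then show ?thesis using pq by (simp add: \<pi>.m_assoc)
qed

text \<open>By naturality along a short path \<open>p\<close> from \<open>z\<close> to
  \<open>y\<close>, the value at \<open>z\<close> is the value at \<open>y\<close> multiplied on the
  two sides by \<open>c p\<close> and the inverse of \<open>c (H 1 \<circ> p)\<close>. Both come
  from finite sets for \<open>z\<close> near \<open>y\<close>, and compactness makes the local
  bounds global.\<close>

lemma trajectory_bounded:
  assumes H: "isotopy H"
  obtains B where "\<And>y. y \<in> M \<Longrightarrow> \<bar>\<phi> (c (trajectory H y))\<bar> \<le> B"
proof (rule locally_bounded_imp_bounded[of "\<lambda>y. \<phi> (c (trajectory H y))"])
  fix y assume y: "y \<in> M"
  have Hy: "H 1 y \<in> M" using isotopyD(4)[OF H] y by simp
  have cont: "continuous_on M (H 1)" and im: "H 1 ` M = M"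
    using homeo_maps_M[OF isotopyD(3)[OF H]] by auto
  obtain V F where V: "openin (top_of_set M) V" "y \<in> V" "finite F"
    "\<And>p. \<lbrakk>path p; path_image p \<subseteq> V; pathfinish p = y\<rbrakk> \<Longrightarrow> c p \<in> F"
    using locally_finite[OF y] by blast
  obtain V' F' where V': "openin (top_of_set M) V'" "H 1 y \<in> V'" "finite F'"
    "\<And>p. \<lbrakk>path p; path_image p \<subseteq> V'; pathfinish p = H 1 y\<rbrakk> \<Longrightarrow> c p \<in> F'"
    using locally_finite[OF Hy] by blast
  have "openin (top_of_set M) (M \<inter> H 1 -` V')"
    using cont V'(1) im by (intro continuous_openin_preimage) auto
  then have op: "openin (top_of_set M) (V \<inter> (M \<inter> H 1 -` V'))" by (rule openin_Int[OF V(1)])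
  obtain W where W: "cell W" "W \<subseteq> V \<inter> (M \<inter> H 1 -` V')" "y \<in> W"
    by (rule cell_inside[OF op, of y]) (use V V' y in auto)
  let ?g = "c (trajectory H y)"
  define E where "E = (\<lambda>(a, b). \<bar>\<phi> (a \<otimes>\<^bsub>\<pi>\<^esub> ?g \<otimes>\<^bsub>\<pi>\<^esub> inv\<^bsub>\<pi>\<^esub> b)\<bar>) ` (F \<times> F')"
  have "\<bar>\<phi> (c (trajectory H z))\<bar> \<le> Max E" if z: "z \<in> W" for z
  proof -
    obtain p where p: "path p" "path_image p \<subseteq> W" "pathstart p = z" "pathfinish p = y"
      using cell_path_simple[OF W(1)] z W(3) unfolding path_simple_def path_connected_def by blast
    have zM: "z \<in> M" using z W(2) by blast
    have pp: "p \<in> paths" using p W(2) by (auto simp: paths_def)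
    have "path_image (H 1 \<circ> p) \<subseteq> V'" using p(2) W(2) by (auto simp: path_image_compose)
    then have in': "c (H 1 \<circ> p) \<in> F'"
      using image_path_paths[OF H pp] p(4) by (intro V'(4)) (auto simp: paths_def pathfinish_compose)
    have "c p \<in> F" using p W(2) by (intro V(4)) auto
    then have "\<bar>\<phi> (c p \<otimes>\<^bsub>\<pi>\<^esub> ?g \<otimes>\<^bsub>\<pi>\<^esub> inv\<^bsub>\<pi>\<^esub> (c (H 1 \<circ> p)))\<bar> \<in> E"
      using in' by (auto simp: E_def)
    moreover have "c (trajectory H z) = c p \<otimes>\<^bsub>\<pi>\<^esub> ?g \<otimes>\<^bsub>\<pi>\<^esub> inv\<^bsub>\<pi>\<^esub> (c (H 1 \<circ> p))"
    proof -
      have "c p \<otimes>\<^bsub>\<pi>\<^esub> ?g = c (trajectory H z) \<otimes>\<^bsub>\<pi>\<^esub> c (H 1 \<circ> p)"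
        using trajectory_natural[OF H pp] p by simp
      then show ?thesis
        using c_closed[OF pp] c_closed[OF image_path_paths[OF H pp]]
          c_closed[OF trajectory_paths(1)[OF H zM]] c_closed[OF trajectory_paths(1)[OF H y]]
        by (metis \<pi>.inv_solve_right \<pi>.m_closed)
    qed
    ultimately show ?thesis using V(3) V'(3) by (auto simp: E_def)
  qed
  then show "\<exists>W B. openin (top_of_set M) W \<and> y \<in> W \<and> (\<forall>z\<in>W. \<bar>\<phi> (c (trajectory H z))\<bar> \<le> B)"
    using W cell_open by blast
qed (rule that)

subsection \<open>Realizing loops by trajectories\<close>

definition realized :: "'m \<Rightarrow> (real \<Rightarrow> 'm) set \<Rightarrow> 'm \<Rightarrow> bool" where
  "realized y g z \<longleftrightarrow> (\<exists>H. isotopy H \<and> H 1 y = z \<and> c (trajectory H y) = g)"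

lemma realized_id: "y \<in> M \<Longrightarrow> realized y \<one>\<^bsub>\<pi>\<^esub> y"
  unfolding realized_def
  by (intro exI[of _ "\<lambda>_. id"]) (auto simp: isotopy_id trajectory_def c_const)

text \<open>The trajectory of a push inside \<open>V\<close> need not be \<open>p\<close>, but has
  the same ends; in a simply connected cell that makes them homotopic.\<close>

lemma realized_push:
  assumes y: "y \<in> M" and R: "realized y g z" and V: "cell V" and z: "z \<in> V" "z \<notin> boundary"
    and p: "path p" "path_image p \<subseteq> V" "pathstart p = z" "pathfinish p \<notin> boundary"
  shows "realized y (g \<otimes>\<^bsub>\<pi>\<^esub> c p) (pathfinish p)"
proof -
  obtain H where H: "isotopy H" "H 1 y = z" "c (trajectory H y) = g"
    using R by (auto simp: realized_def)
  have VM: "V \<subseteq> M" using cell_open[OF V] openin_imp_subset by blast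
  have "pathfinish p \<in> V" using p(2) pathfinish_in_path_image by blast
  then obtain H' K where H': "isotopy H'" "K \<subseteq> V"
    "\<And>t z. \<lbrakk>t \<in> {0..1}; z \<notin> K\<rbrakk> \<Longrightarrow> H' t z = z" "H' 1 z = pathfinish p"
    using cell_push[OF V z(1) _ z(2) p(4)] by metis
  have zM: "z \<in> M" using z VM by blast
  have "path_image (trajectory H' z) \<subseteq> V"
    using isotopy_stays[OF H'(1,2) H'(3) z(1) zM] by (auto simp: path_image_def trajectory_def)
  then have "homotopic_paths V (trajectory H' z) p"
    using cell_path_simple[OF V] p trajectory_paths[OF H'(1) zM] H'(4)
    unfolding path_simple_def by (auto simp: paths_def)
  then have "c (trajectory H' z) = c p" using VM homotopic_paths_subset c_homotopic by blast
  then have "c (trajectory (\<lambda>t. H' t \<circ> H t) y) = g \<otimes>\<^bsub>\<pi>\<^esub> c p"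
    using trajectory_comp[OF H'(1) H(1) y] H by simp
  then show ?thesis
    unfolding realized_def using isotopy_comp[OF H'(1) H(1)] H(2) H'(4)
    by (intro exI[of _ "\<lambda>t. H' t \<circ> H t"]) auto
qed

text \<open>The point is pushed along the loop from cell to cell. The loop may touch the boundary,
  where nothing can be moved, so the pushed point only has to shadow the loop from the
  interior.\<close>

lemma realized_loop:
  assumes y: "y \<in> M" "y \<notin> boundary" and a: "a \<in> loops M y"
  shows "realized y (c a) y"
proof -
  have ap: "path a" "path_image a \<subseteq> M" "pathstart a = y" "pathfinish a = y" "a \<in> paths"
    using a by (auto simp: loops_def paths_def)
  have aM: "a t \<in> M" if "t \<in> {0..1}" for t using ap(2) that by (auto simp: path_image_def)
  have piece: "path_piece s t a \<in> paths" if "s \<in> {0..1}" "t \<in> {0..1}" for s t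
    using path_piece[OF ap(1) that] ap(2) by (auto simp: paths_def)
  \<comment> \<open>At time \<open>t\<close> the pushed point sits at the end of a detour
    \<open>p\<close> inside a cell containing \<open>a t\<close>; the realized element is that of
    the loop up to \<open>t\<close> followed by the detour.\<close>
  define T where "T V t \<longleftrightarrow> (\<exists>p. path p \<and> path_image p \<subseteq> V \<and> pathstart p = a t \<and> pathfinish p \<notin> boundary \<and>
      realized y (c (path_piece 0 t a) \<otimes>\<^bsub>\<pi>\<^esub> c p) (pathfinish p))" for V t
  have inp: "p \<in> paths" if "path p" "path_image p \<subseteq> V" "cell V" for p V
    using that cell_open openin_imp_subset unfolding paths_def by blast
  \<comment> \<open>To pass to another cell, a smaller one in the intersection is entered: the point
    is pushed back along the detour and then along \<open>q\<close>, a path that stays in the old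
    cell.\<close>
  have change: "T V t" if t: "t \<in> {0..1}" and V1: "cell V1" "T V1 t" and V: "cell V" "a t \<in> V" for V1 V t
  proof -
    obtain p where p: "path p" "path_image p \<subseteq> V1" "pathstart p = a t" "pathfinish p \<notin> boundary"
      "realized y (c (path_piece 0 t a) \<otimes>\<^bsub>\<pi>\<^esub> c p) (pathfinish p)"
      using V1(2) by (auto simp: T_def)
    have aV1: "a t \<in> V1" using p(2,3) pathstart_in_path_image[of p] by auto
    have op: "openin (top_of_set M) (V1 \<inter> V)" using V1 V cell_open by (intro openin_Int) auto
    obtain W where W: "cell W" "W \<subseteq> V1 \<inter> V" "a t \<in> W"
      by (rule cell_inside[OF op, of "a t"]) (use aV1 V(2) in auto)
    obtain z where z: "z \<in> W" "z \<notin> boundary" by (rule cell_interior_point[OF W(1,3)])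
    obtain q where q: "path q" "path_image q \<subseteq> W" "pathstart q = a t" "pathfinish q = z"
      using cell_path_simple[OF W(1)] z W(3) unfolding path_simple_def path_connected_def by blast
    have pq: "p \<in> paths" "q \<in> paths" using inp p q W(1) V1(1) by auto
    have "realized y (c (path_piece 0 t a) \<otimes>\<^bsub>\<pi>\<^esub> c p \<otimes>\<^bsub>\<pi>\<^esub> c (reversepath p +++ q)) (pathfinish (reversepath p +++ q))"
    proof (rule realized_push[OF y(1) p(5) V1(1)])
      show "pathfinish p \<in> V1" using p(2) pathfinish_in_path_image by blast
      show "path_image (reversepath p +++ q) \<subseteq> V1"
        using p q W(2) by (intro subset_path_image_join) auto
    qed (use p q z in auto)
    moreover have "c (path_piece 0 t a) \<otimes>\<^bsub>\<pi>\<^esub> c p \<otimes>\<^bsub>\<pi>\<^esub> c (reversepath p +++ q) = c (path_piece 0 t a) \<otimes>\<^bsub>\<pi>\<^esub> c q"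
    proof -
      have "c (reversepath p +++ q) = inv\<^bsub>\<pi>\<^esub> (c p) \<otimes>\<^bsub>\<pi>\<^esub> c q"
        using pq p(3) q(3) by (simp add: c_join c_reverse paths_reverse)
      moreover have "c (path_piece 0 t a) \<in> carrier \<pi>" using piece t by simp
      ultimately show ?thesis
        using c_closed[OF pq(1)] c_closed[OF pq(2)]
        by (simp add: \<pi>.m_assoc) (simp add: \<pi>.m_assoc[symmetric])
    qed
    ultimately show ?thesis unfolding T_def using q z W(2) by (intro exI[of _ q]) auto
  qed
  have cells: "\<exists>V. cell V \<and> z \<in> V" if "z \<in> M" for z
    by (rule cell_at[OF that]) blast
  have "\<forall>V. cell V \<and> a 1 \<in> V \<longrightarrow> T V 1"
  proof (rule connected_induction_simple[of "{0..1::real}" 0 1 "\<lambda>t. \<forall>V. cell V \<and> a t \<in> V \<longrightarrow> T V t"])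
    have a0: "a 0 = y" using ap(3) by (simp add: pathstart_def)
    have c0: "c (path_piece 0 0 a) = \<one>\<^bsub>\<pi>\<^esub>"
      using c_const[OF y(1)] a0 by (simp add: path_piece_def comp_def linepath_def)
    have "T V 0" if "cell V" "a 0 \<in> V" for V
      unfolding T_def using that a0 y realized_id[OF y(1)] c0 c_const[OF y(1)]
      by (intro exI[of _ "\<lambda>_. y"]) (auto simp: path_const path_image_def pathstart_def pathfinish_def)
    then show "\<forall>V. cell V \<and> a 0 \<in> V \<longrightarrow> T V 0" by blast
    fix t :: real assume t: "t \<in> {0..1}"
    obtain V where V: "cell V" "a t \<in> V" using cells aM t by blast
    have "openin (top_of_set {0..1}) ({0..1} \<inter> a -` V)"
      using ap cell_open[OF V(1)] by (intro continuous_openin_preimage) (auto simp: path_def path_image_def)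
    then obtain d where d: "0 < d" "ball t d \<inter> {0..1} \<subseteq> {0..1} \<inter> a -` V"
      using t V(2) unfolding openin_contains_ball by (metis Int_iff vimageI)
    have step: "\<forall>U. cell U \<and> a r \<in> U \<longrightarrow> T U r"
      if s: "s \<in> ball t d \<inter> {0..1}" and r: "r \<in> ball t d \<inter> {0..1}"
        and Ts: "\<forall>V. cell V \<and> a s \<in> V \<longrightarrow> T V s" for s r
    proof -
      have sr: "s \<in> {0..1}" "r \<in> {0..1}" using s r by auto
      have conv: "convex (ball t d \<inter> {0..1})" by (intro convex_Int convex_ball) auto
      have "closed_segment s r \<subseteq> ball t d \<inter> {0..1}" by (rule closed_segment_subset[OF s r conv])
      then have segV: "path_image (path_piece s r a) \<subseteq> V" using path_piece(2)[OF ap(1) sr] d(2) by auto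
      have "a s \<in> V" using s d(2) by auto
      then have "T V s" using Ts V(1) by blast
      then obtain p where p: "path p" "path_image p \<subseteq> V" "pathstart p = a s" "pathfinish p \<notin> boundary"
        "realized y (c (path_piece 0 s a) \<otimes>\<^bsub>\<pi>\<^esub> c p) (pathfinish p)"
        by (auto simp: T_def)
      have pp: "p \<in> paths" using inp p V(1) by blast
      let ?s = "path_piece s r a"
      note ps = piece[OF sr] and pz = piece[of 0 s] piece[of 0 r]
      \<comment> \<open>From time \<open>s\<close> to \<open>r\<close> the isotopy is kept; only the
        recorded detour changes, by first going back along the piece of the loop between
        them.\<close>
      let ?q = "reversepath ?s +++ p"
      have "c (path_piece 0 r a) = c (path_piece 0 s a) \<otimes>\<^bsub>\<pi>\<^esub> c ?s"
        using c_homotopic[OF path_piece_join[OF ap(1,2), of 0 s r]] sr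
          c_join[OF pz(1) ps] path_piece[OF ap(1)] by auto
      moreover have "c ?q = inv\<^bsub>\<pi>\<^esub> (c ?s) \<otimes>\<^bsub>\<pi>\<^esub> c p"
        using c_join[OF paths_reverse[OF ps] pp] p(3) path_piece[OF ap(1) sr] c_reverse[OF ps] by simp
      ultimately have "c (path_piece 0 r a) \<otimes>\<^bsub>\<pi>\<^esub> c ?q = c (path_piece 0 s a) \<otimes>\<^bsub>\<pi>\<^esub> c p"
        using c_closed[OF ps] c_closed[OF pp] c_closed[OF pz(1)] sr
        by (simp add: \<pi>.m_assoc) (simp add: \<pi>.m_assoc[symmetric])
      then have "realized y (c (path_piece 0 r a) \<otimes>\<^bsub>\<pi>\<^esub> c ?q) (pathfinish ?q)" using p(5) by simp
      moreover have "path_image ?q \<subseteq> V"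
        by (rule subset_path_image_join) (use segV p(2) in auto)
      moreover have "path ?q" "pathstart ?q = a r" "pathfinish ?q \<notin> boundary"
        using p path_piece[OF ap(1) sr] by auto
      ultimately have "T V r" unfolding T_def by blast
      then show ?thesis using change[OF sr(2) V(1)] by blast
    qed
    have op: "openin (top_of_set {0..1}) (ball t d \<inter> {0..1})"
      by (metis Int_commute open_ball openin_open_Int)
    have "t \<in> ball t d \<inter> {0..1}" using t d(1) by simp
    with op step show "\<exists>S. openin (top_of_set {0..1}) S \<and> t \<in> S \<and>
        (\<forall>s\<in>S. \<forall>r\<in>S. (\<forall>V. cell V \<and> a s \<in> V \<longrightarrow> T V s) \<longrightarrow> (\<forall>V. cell V \<and> a r \<in> V \<longrightarrow> T V r))"
      by (intro exI[of _ "ball t d \<inter> {0..1}"] conjI ballI impI)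
  qed auto
  moreover obtain V where V: "cell V" "y \<in> V" using cells y by blast
  moreover have "a 1 = y" using ap(4) by (simp add: pathfinish_def)
  ultimately obtain p where p: "path p" "path_image p \<subseteq> V" "pathstart p = y" "pathfinish p \<notin> boundary"
      "realized y (c (path_piece 0 1 a) \<otimes>\<^bsub>\<pi>\<^esub> c p) (pathfinish p)"
    by (auto simp: T_def)
  have pp: "p \<in> paths" using inp p V(1) by blast
  have "path_piece 0 1 a = a" by (simp add: path_piece_def comp_def linepath_def)
  \<comment> \<open>A last push undoes the remaining detour and brings the point back to
    \<open>y\<close>.\<close>
  then have "realized y (c a \<otimes>\<^bsub>\<pi>\<^esub> c p \<otimes>\<^bsub>\<pi>\<^esub> c (reversepath p)) (pathfinish (reversepath p))"
    using p V y by (intro realized_push[OF y(1) _ V(1)]) auto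
  then show ?thesis
    using p pp ap c_closed[OF pp] c_closed[OF ap(5)] by (simp add: c_reverse \<pi>.m_assoc)
qed

lemma infinite_dim_cohomology:
  assumes "g \<in> carrier \<pi>" "\<phi> g \<noteq> 0"
  shows "\<not> vectorspace.fin_dim real_ring (bounded_cohomology (Homeo0 k M \<A>) 1 2)"
proof -
  let ?G = "Homeo0 k M \<A>"
  obtain V where V: "cell V" "x \<in> V" by (rule cell_at[OF base])
  obtain y where "y \<in> V" "y \<notin> boundary" by (rule cell_interior_point[OF V])
  then have y: "y \<in> M" "y \<notin> boundary" using openin_imp_subset[OF cell_open[OF V(1)]] by auto
  obtain a where a: "a \<in> loops M y" "c a = g" by (rule c_surj_loops[OF assms(1) y(1)])
  then obtain A where A: "isotopy A" "A 1 y = y" "c (trajectory A y) = g"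
    using realized_loop[OF y a(1)] by (auto simp: realized_def)
  define iso where "iso f = (SOME H. isotopy H \<and> H 1 = f)" for f
  have iso: "isotopy (iso f)" "iso f 1 = f" if "f \<in> carrier ?G" for f
  proof -
    have "\<exists>H. isotopy H \<and> H 1 = f" using that by (auto simp: carrier_Homeo0)
    then show "isotopy (iso f)" "iso f 1 = f" unfolding iso_def by (metis (mono_tags, lifting) someI_ex)+
  qed
  define F where "F f = \<phi> (c (trajectory (iso f) y))" for f
  have F: "F (H 1) = \<phi> (c (trajectory H y))" if "isotopy H" for H
  proof -
    have "H 1 \<in> carrier ?G" using that by (auto simp: carrier_Homeo0)
    then show ?thesis unfolding F_def using iso that y by (intro trajectory_unique) auto
  qed
  define P where "P n = A 1 ^^ n" for n
  have P: "\<exists>H. isotopy H \<and> H 1 = P n \<and> c (trajectory H y) = g [^]\<^bsub>\<pi>\<^esub> n \<and> P n y = y" for n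
  proof (induction n)
    case 0
    show ?case
      using y by (intro exI[of _ "\<lambda>_. id"]) (auto simp: isotopy_id[unfolded id_def] P_def trajectory_def c_const)
  next
    case (Suc n)
    then obtain H where H: "isotopy H" "H 1 = P n" "c (trajectory H y) = g [^]\<^bsub>\<pi>\<^esub> n" "P n y = y" by blast
    have "c (trajectory (\<lambda>t. A t \<circ> H t) y) = g [^]\<^bsub>\<pi>\<^esub> Suc n"
      using trajectory_comp[OF A(1) H(1) y(1)] H A by simp
    moreover have "A 1 \<circ> H 1 = P (Suc n)" "P (Suc n) y = y" using H(2,4) A(2) by (simp_all add: P_def)
    ultimately show ?case
      by (intro exI[of _ "\<lambda>t. A t \<circ> H t"] conjI isotopy_comp[OF A(1) H(1)])
  qed
  show ?thesis
  proof (rule infinite_dim_H2[where f = F and p = "A 1" and P = P and w = "\<phi> g"])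
    show "A 1 \<in> carrier ?G" using A(1) by (auto simp: carrier_Homeo0)
    show "P n \<in> carrier ?G" for n
    proof -
      obtain H where "isotopy H" "P n = H 1" using P[of n] by metis
      then show ?thesis unfolding carrier_Homeo0 mem_Collect_eq by (intro exI[of _ H] conjI)
    qed
    show "P (Suc n) = A 1 \<otimes>\<^bsub>?G\<^esub> P n" for n by (simp add: P_def)
    show "F (P n) = real n * \<phi> g" for n
      using P[of n] F homogeneous[OF assms(1)] by metis
    fix f assume f: "f \<in> carrier ?G"
    obtain B where B: "\<And>z. z \<in> M \<Longrightarrow> \<bar>\<phi> (c (trajectory (iso f) z))\<bar> \<le> B"
      by (rule trajectory_bounded[OF iso(1)[OF f]]) blast
    \<comment> \<open>The defect \<open>D\<close> accounts for splitting the composite trajectory,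
      and \<open>B\<close> bounds the second factor wherever \<open>h\<close> has carried
      \<open>y\<close>.\<close>
    have "\<bar>F (f \<otimes>\<^bsub>?G\<^esub> h) - F h\<bar> \<le> D + B" if h: "h \<in> carrier ?G" for h
    proof -
      have hy: "h y \<in> M" using Homeo0_maps(1)[OF h y(1)] .
      have "F (f \<otimes>\<^bsub>?G\<^esub> h) = \<phi> (c (trajectory (\<lambda>t. iso f t \<circ> iso h t) y))"
        using F[OF isotopy_comp[OF iso(1)[OF f] iso(1)[OF h]]] iso f h by simp
      also have "\<dots> = \<phi> (c (trajectory (iso h) y) \<otimes>\<^bsub>\<pi>\<^esub> c (trajectory (iso f) (h y)))"
        using trajectory_comp[OF iso(1)[OF f] iso(1)[OF h] y(1)] iso(2)[OF h] by simp
      finally show ?thesis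
        using defect[OF c_closed[OF trajectory_paths(1)[OF iso(1)[OF h] y(1)]]
            c_closed[OF trajectory_paths(1)[OF iso(1)[OF f] hy]]] B[OF hy]
        unfolding F_def by linarith
    qed
    then show "\<exists>C. \<forall>h\<in>carrier ?G. \<bar>F (f \<otimes>\<^bsub>?G\<^esub> h) - F h\<bar> \<le> C" by blast
  qed (use assms Homeo0_comp in \<open>auto simp: o_assoc\<close>)
qed

end

lemma (in compact_manifold) infinite_dim_of_quasimorphisms:
  assumes x: "x \<in> M"
    and inf: "infinitely_many_independent_homogeneous_quasimorphisms
      (fundamental_group M x Mod group_centre (fundamental_group M x))"
  shows "\<not> vectorspace.fin_dim real_ring (bounded_cohomology (Homeo0 k M \<A>) 1 2)"
proof -
  let ?\<pi> = "fundamental_group M x"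
  interpret \<pi>: group ?\<pi> by (rule group_fundamental_group[OF x])
  obtain \<phi> \<gamma> where \<phi>: "homogeneous_quasimorphism (?\<pi> Mod group_centre ?\<pi>) \<phi>"
    "\<gamma> \<in> carrier (?\<pi> Mod group_centre ?\<pi>)" "\<phi> \<gamma> \<noteq> 0"
    by (rule nonzero_quasimorphism[OF inf])
  obtain g where g: "g \<in> carrier ?\<pi>" "\<gamma> = group_centre ?\<pi> #>\<^bsub>?\<pi>\<^esub> g"
    using \<phi>(2) by (auto simp: FactGroup_def RCOSETS_def)
  define \<phi>' where "\<phi>' h = \<phi> (group_centre ?\<pi> #>\<^bsub>?\<pi>\<^esub> h)" for h
  note lift = \<pi>.homogeneous_quasimorphism_lift[OF \<phi>(1), folded \<phi>'_def]
  obtain D where D: "\<And>h l. \<lbrakk>h \<in> carrier ?\<pi>; l \<in> carrier ?\<pi>\<rbrakk> \<Longrightarrow>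
      \<bar>\<phi>' (h \<otimes>\<^bsub>?\<pi>\<^esub> l) - \<phi>' h - \<phi>' l\<bar> \<le> D"
    using lift(1) by blast
  obtain e where e: "based_paths M x e"
    "\<And>y. y \<in> M \<Longrightarrow> \<exists>V F. openin (top_of_set M) V \<and> y \<in> V \<and> finite F \<and>
       (\<forall>p. path p \<and> path_image p \<subseteq> V \<and> pathfinish p = y \<longrightarrow> based_paths.c M e p \<in> F)"
    using exists_locally_finite_based_paths[OF x] by blast
  interpret B: based_paths M x e by (rule e(1))
  interpret centre_invariant_quasimorphism k M \<A> x e \<phi>' D
  proof
    show "\<exists>V F. openin (top_of_set M) V \<and> y \<in> V \<and> finite F \<and>
       (\<forall>p. path p \<and> path_image p \<subseteq> V \<and> pathfinish p = y \<longrightarrow> B.c p \<in> F)" if "y \<in> M" for y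
      by (rule e(2)[OF that])
    show "\<bar>\<phi>' (h \<otimes>\<^bsub>?\<pi>\<^esub> l) - \<phi>' h - \<phi>' l\<bar> \<le> D" if "h \<in> carrier ?\<pi>" "l \<in> carrier ?\<pi>" for h l
      by (rule D[OF that])
    show "\<phi>' (z \<otimes>\<^bsub>?\<pi>\<^esub> h) = \<phi>' h" if "z \<in> group_centre ?\<pi>" "h \<in> carrier ?\<pi>" for z h
      by (rule lift(2)[OF that])
    show "\<phi>' (h [^]\<^bsub>?\<pi>\<^esub> n) = real n * \<phi>' h" if "h \<in> carrier ?\<pi>" for h and n :: nat
      by (rule lift(3)[OF that])
  qed
  show ?thesis
    by (rule infinite_dim_cohomology[OF g(1)]) (use \<phi>(3) g(2) in \<open>simp add: \<phi>'_def\<close>)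
qed

subsection \<open>Logarithms in the plane\<close>

lemma has_logD:
  assumes "has_log S u"
  obtains l where "continuous_on S l" "\<And>z. z \<in> S \<Longrightarrow> u z = exp (l z)"
  using assms unfolding has_log_def by blast

lemma has_log_subset: "has_log S u \<Longrightarrow> T \<subseteq> S \<Longrightarrow> has_log T u"
  unfolding has_log_def by (meson continuous_on_subset subsetD)

lemma has_log_mult:
  assumes "has_log S u" "has_log S w" "\<And>z. z \<in> S \<Longrightarrow> f z = u z * w z"
  shows "has_log S f"
proof -
  obtain l l' where "continuous_on S l" "\<And>z. z \<in> S \<Longrightarrow> u z = exp (l z)"
    "continuous_on S l'" "\<And>z. z \<in> S \<Longrightarrow> w z = exp (l' z)"
    using has_logD assms(1,2) by metis
  then show ?thesis
    unfolding has_log_def using assms(3)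
    by (intro exI[of _ "\<lambda>z. l z + l' z"] conjI ballI continuous_on_add) (auto simp: exp_add)
qed

text \<open>Along the circle a logarithm would differ from \<open>\<i> * t\<close> by a constant,
  yet it must return to its initial value at \<open>2 * pi\<close>.\<close>

lemma no_log_on_circle:
  assumes "0 < r" shows "\<not> has_log (sphere a r) (\<lambda>z. z - a)"
proof
  assume "has_log (sphere a r) (\<lambda>z. z - a)"
  then obtain l where l: "continuous_on (sphere a r) l" "\<And>z. z \<in> sphere a r \<Longrightarrow> z - a = exp (l z)"
    by (rule has_logD) blast
  define e where "e t = a + of_real r * exp (\<i> * of_real t)" for t :: real
  have e: "e t \<in> sphere a r" for t
    using assms by (simp add: e_def dist_norm norm_mult)
  have ec: "continuous_on {0..2*pi} e" unfolding e_def by (intro continuous_intros)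
  have "continuous_on {0..2*pi} (\<lambda>t. l (e t))"
    by (rule continuous_on_compose2[OF l(1) ec]) (use e in blast)
  moreover have "continuous_on {0..2*pi} (\<lambda>t. \<i> * of_real t)" by (intro continuous_intros)
  moreover have "exp (l (e t)) = of_real r * exp (\<i> * of_real t)" for t
    using l(2)[OF e[of t]] by (simp add: e_def)
  ultimately have "l (e 0) - \<i> * of_real 0 = l (e (2*pi)) - \<i> * of_real (2*pi)"
    by (intro logs_differ_by_constant[of "{0..2*pi}"]) auto
  moreover have "e (2*pi) = e 0"
    by (simp add: e_def mult.commute[of \<i>] exp_two_pi_i)
  ultimately show False by simp
qed

text \<open>Contracting the path to its starting point along itself gives the homotopy to a constant
  map of which a logarithm is the lift.\<close>

lemma has_log_off_path:
  fixes g :: "real \<Rightarrow> complex"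
  assumes "path g"
  shows "has_log (- path_image g) (\<lambda>z. (z - pathfinish g) / (z - pathstart g))"
proof -
  have g: "continuous_on {0..1} g" using assms by (simp add: path_def)
  have gmem: "g t \<in> path_image g" if "0 \<le> t" "t \<le> 1" for t using that by (auto simp: path_image_def)
  have gz: "g t \<noteq> z" if "z \<notin> path_image g" "t \<in> {0..1}" for t z using that by (auto simp: path_image_def)
  have "homotopic_with_canon (\<lambda>h. True) (- path_image g) (- {0})
      (\<lambda>z. (z - g 0) / (z - g 0)) (\<lambda>z. (z - g 1) / (z - g 0))"
  proof -
    let ?h = "\<lambda>p. (snd p - g (fst p)) / (snd p - g 0)"
    have "continuous_on ({0..1} \<times> - path_image g) ?h"
      using gz[of _ 0] by (intro continuous_intros continuous_on_compose2[OF g]) auto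
    moreover have "?h ` ({0..1} \<times> - path_image g) \<subseteq> - {0}" using gmem by auto
    ultimately show ?thesis
      unfolding homotopic_with_def by (intro exI[of _ ?h]) (use gmem in auto)
  qed
  then have "homotopic_with_canon (\<lambda>h. True) (- path_image g) (- {0})
      (\<lambda>z. (z - g 1) / (z - g 0)) (\<lambda>z. (z - g 0) / (z - g 0))"
    by (rule homotopic_with_symD)
  then have "homotopic_with_canon (\<lambda>h. True) (- path_image g) (- {0})
      (\<lambda>z. (z - g 1) / (z - g 0)) (\<lambda>z. 1)"
    by (rule homotopic_with_eq) (use gz[of _ 0] in auto)
  then show ?thesis
    using inessential_eq_continuous_logarithm[of "- path_image g" "\<lambda>z. (z - g 1) / (z - g 0)"]
    unfolding has_log_def pathstart_def pathfinish_def by blast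
qed

text \<open>The function \<open>v\<close> is a logarithm of the quotient, faded out by the cutoff
  \<open>\<rho>\<close> between the radii \<open>r\<close> and \<open>2 * r\<close>. Its exponential
  continues across the inner points of the path as the plain quotient, whereas \<open>v\<close> is
  only defined off the path. Being constant far away, both can be transplanted to a surface.\<close>

lemma planar_piece:
  fixes g :: "real \<Rightarrow> complex"
  assumes g: "path g" "path_image g \<subseteq> ball c r"
  obtains v w where "continuous_on (- path_image g) v"
    "continuous_on (- {pathstart g, pathfinish g}) w"
    "\<And>z. z \<notin> path_image g \<Longrightarrow> w z = exp (v z)"
    "\<And>z. 2 * r \<le> dist c z \<Longrightarrow> v z = 0" "\<And>z. 2 * r \<le> dist c z \<Longrightarrow> w z = 1"
    "\<And>z. dist c z < r \<Longrightarrow> w z = (z - pathfinish g) / (z - pathstart g)"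
proof -
  let ?a = "pathstart g" and ?b = "pathfinish g"
  have ends: "?a \<in> path_image g" "?b \<in> path_image g" by auto
  have "?a \<in> ball c r" using ends(1) g(2) by blast
  then have r: "0 < r" using zero_le_dist[of c ?a] unfolding mem_ball by linarith
  obtain l where l: "continuous_on (- path_image g) l"
    "\<And>z. z \<in> - path_image g \<Longrightarrow> (z - ?b) / (z - ?a) = exp (l z)"
    using has_log_off_path[OF g(1)] by (rule has_logD) blast
  define \<rho> where "\<rho> z = max 0 (min 1 (2 - dist c z / r))" for z
  have \<rho>: "continuous_on S \<rho>" for S unfolding \<rho>_def using r by (intro continuous_intros) auto
  have \<rho>1: "\<rho> z = 1" if "dist c z < r" for z
  proof -
    have "dist c z / r < 1" using that r by simp
    then show ?thesis by (simp add: \<rho>_def)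
  qed
  have \<rho>0: "\<rho> z = 0" if "2 * r \<le> dist c z" for z
  proof -
    have "2 \<le> dist c z / r" using that r by (simp add: le_divide_eq)
    then show ?thesis by (simp add: \<rho>_def)
  qed
  define v where "v z = of_real (\<rho> z) * l z" for z
  define w where "w z = (if dist c z < r then (z - ?b) / (z - ?a) else exp (v z))" for z
  have v: "continuous_on (- path_image g) v" unfolding v_def by (intro continuous_intros \<rho> l(1))
  have wv: "w z = exp (v z)" if "z \<notin> path_image g" for z
    using l(2)[of z] \<rho>1[of z] that by (simp add: w_def v_def)
  show ?thesis
  proof (rule that[OF v _ wv])
    show "continuous_on (- {?a, ?b}) w"
    proof (rule continuous_on_open_cover2[of _ "ball c r - {?a, ?b}" "- path_image g"])
      show "openin (top_of_set (- {?a, ?b})) (ball c r - {?a, ?b})"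
        by (intro open_subset) (auto intro: open_Diff)
      show "openin (top_of_set (- {?a, ?b})) (- path_image g)"
        using ends g(1) by (intro open_subset) (auto intro: closed_path_image)
      show "- {?a, ?b} \<subseteq> (ball c r - {?a, ?b}) \<union> - path_image g" using g(2) by auto
      have "continuous_on (ball c r - {?a, ?b}) (\<lambda>z. (z - ?b) / (z - ?a))"
        by (intro continuous_intros) auto
      then show "continuous_on (ball c r - {?a, ?b}) w"
        by (rule continuous_on_eq) (simp add: w_def)
      have "continuous_on (- path_image g) (\<lambda>z. exp (v z))" by (intro continuous_intros v)
      then show "continuous_on (- path_image g) w"
        by (rule continuous_on_eq) (use wv in auto)
    qed
    show "v z = 0" if "2 * r \<le> dist c z" for z using \<rho>0[OF that] by (simp add: v_def)
    show "w z = 1" if "2 * r \<le> dist c z" for z using \<rho>0[OF that] that r by (simp add: w_def v_def)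
  qed (auto simp: w_def)
qed

subsection \<open>Closed oriented surfaces\<close>

text \<open>The index type is known only to consist of \<open>k\<close> and \<open>l\<close>, so the
  sum over permutations is written out: the identity and one transposition.\<close>

lemma det_two_indices:
  fixes A :: "real ^ 'n ^ 'n"
  assumes kl: "k \<noteq> l" "UNIV = {k, l}"
  shows "det A = A $ k $ k * A $ l $ l - A $ k $ l * A $ l $ k"
proof -
  have "{p. p permutes (UNIV :: 'n set)} = {id, Transposition.transpose k l}"
  proof
    show "{p. p permutes (UNIV :: 'n set)} \<subseteq> {id, Transposition.transpose k l}"
    proof
      fix p :: "'n \<Rightarrow> 'n" assume "p \<in> {p. p permutes UNIV}"
      then have inj: "inj p" by (auto simp: permutes_inj)
      have in': "z = k \<or> z = l" for z using kl(2) by blast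
      show "p \<in> {id, Transposition.transpose k l}"
      proof (cases "p k = k")
        case True
        then have "p l = l" using inj kl(1) in' by (metis injD)
        then have "p z = id z" for z using True in'[of z] by auto
        then show ?thesis by (simp add: fun_eq_iff)
      next
        case False
        then have 1: "p k = l" using in' by blast
        then have "p l = k" using inj kl(1) in' by (metis injD)
        then have "p z = Transposition.transpose k l z" for z
          using 1 in'[of z] by auto
        then show ?thesis by (simp add: fun_eq_iff)
      qed
    qed
  qed (auto simp: permutes_id permutes_swap_id)
  moreover have "id \<noteq> Transposition.transpose k l" using kl(1) by (metis id_apply transpose_apply_first)
  moreover have "(\<Prod>i\<in>UNIV. f i) = f k * f l" for f :: "'n \<Rightarrow> real"
    unfolding kl(2) using kl(1) by simp
  ultimately show ?thesis
    unfolding det_def using kl(1) by (simp add: sign_swap_id)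
qed

locale closed_surface = compact_manifold k M \<A>
  for k :: "'n::finite" and M :: "'m::t2_space set"
    and \<A> :: "('m set \<times> ('m \<Rightarrow> real ^ 'n)) set" +
  fixes l :: 'n
  assumes closed: "boundary = {}" and kl: "k \<noteq> l" "UNIV = {k, l}"
begin

definition to_complex :: "real ^ 'n \<Rightarrow> complex" where
  "to_complex v = Complex (v $ k) (v $ l)"

definition of_complex :: "complex \<Rightarrow> real ^ 'n" where
  "of_complex w = (\<chi> i. if i = k then Re w else Im w)"

lemma of_to_complex [simp]: "of_complex (to_complex v) = v"
proof -
  have "i = k \<or> i = l" for i using kl(2) by blast
  then show ?thesis using kl(1) by (auto simp: of_complex_def to_complex_def vec_eq_iff)
qed

lemma to_of_complex [simp]: "to_complex (of_complex w) = w"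
  using kl(1) by (simp add: of_complex_def to_complex_def)

lemma bounded_linear_to_complex: "bounded_linear to_complex"
proof -
  have "linear to_complex"
    by (rule linearI) (simp_all add: to_complex_def complex_eq_iff)
  then show ?thesis by (simp add: linear_conv_bounded_linear)
qed

lemma bounded_linear_of_complex: "bounded_linear of_complex"
proof -
  have "linear of_complex"
    by (rule linearI) (simp_all add: of_complex_def vec_eq_iff)
  then show ?thesis by (simp add: linear_conv_bounded_linear)
qed

lemma continuous_to_complex: "continuous_on S to_complex"
  and continuous_of_complex: "continuous_on T of_complex"
  using bounded_linear_to_complex bounded_linear_of_complex
  by (auto intro: linear_continuous_on)

definition complex_chart :: "'m set \<Rightarrow> ('m \<Rightarrow> complex) \<Rightarrow> bool" where
  "complex_chart U \<kappa> \<longleftrightarrow> (\<exists>\<phi>. (U, \<phi>) \<in> \<A> \<and> \<kappa> = to_complex \<circ> \<phi>)"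

lemma chart_image_open:
  assumes "(U, \<phi>) \<in> \<A>" shows "open (\<phi> ` U)"
proof -
  obtain T where T: "open T" "\<phi> ` U = half_space k \<inter> T"
    using chart_inverse[OF assms] by (metis openin_open)
  have "0 < \<phi> z $ k" if "z \<in> U" for z using not_boundary_iff[OF assms that] closed by simp
  then have "\<phi> ` U \<subseteq> {y. 0 < y $ k}" by auto
  moreover have "{y. 0 < y $ k} \<subseteq> half_space k" by (auto simp: half_space_def)
  ultimately have "\<phi> ` U = {y. 0 < y $ k} \<inter> T" using T(2) by blast
  then show ?thesis using T(1) open_halfspace_component_gt_cart by (metis open_Int)
qed

lemma complex_chartE:
  assumes "complex_chart U \<kappa>"
  obtains \<psi> where "openin (top_of_set M) U" "open (\<kappa> ` U)" "homeomorphism U (\<kappa> ` U) \<kappa> \<psi>"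
proof -
  obtain \<phi> where \<phi>: "(U, \<phi>) \<in> \<A>" "\<kappa> = to_complex \<circ> \<phi>" using assms by (auto simp: complex_chart_def)
  obtain \<psi> where \<psi>: "openin (top_of_set M) U" "homeomorphism U (\<phi> ` U) \<phi> \<psi>"
    by (rule chart_inverse[OF \<phi>(1)])
  have "\<kappa> ` U = of_complex -` (\<phi> ` U)"
    unfolding \<phi>(2) by (auto simp: image_iff) (metis to_of_complex)
  moreover have "open (of_complex -` (\<phi> ` U))"
    by (rule open_vimage[OF chart_image_open[OF \<phi>(1)] continuous_of_complex])
  ultimately have o: "open (\<kappa> ` U)" by simp
  have "homeomorphism (\<phi> ` U) (to_complex ` \<phi> ` U) to_complex of_complex"
    unfolding homeomorphism_def by (auto intro: continuous_to_complex continuous_of_complex simp: image_iff)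
  then have "homeomorphism U (\<kappa> ` U) \<kappa> (\<psi> \<circ> of_complex)"
    using homeomorphism_compose[OF \<psi>(2)] by (simp add: \<phi>(2) image_comp)
  then show ?thesis using that \<psi>(1) o by blast
qed

lemma complex_chart_at:
  assumes "y \<in> M"
  obtains U \<kappa> r where "complex_chart U \<kappa>" "y \<in> U" "0 < r" "ball (\<kappa> y) r \<subseteq> \<kappa> ` U"
proof -
  obtain U \<phi> where U: "(U, \<phi>) \<in> \<A>" "y \<in> U" by (rule chart_at[OF assms])
  then have c: "complex_chart U (to_complex \<circ> \<phi>)" by (auto simp: complex_chart_def)
  then have "open ((to_complex \<circ> \<phi>) ` U)" by (rule complex_chartE)
  then obtain r where "0 < r" "ball ((to_complex \<circ> \<phi>) y) r \<subseteq> (to_complex \<circ> \<phi>) ` U"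
    using U(2) openE by (metis imageI)
  then show ?thesis using that c U(2) by blast
qed

lemma openin_complex_chart:
  assumes "complex_chart U \<kappa>" "open T"
  shows "openin (top_of_set M) {z\<in>U. \<kappa> z \<in> T}"
proof -
  obtain \<psi> where \<psi>: "openin (top_of_set M) U" "homeomorphism U (\<kappa> ` U) \<kappa> \<psi>"
    by (rule complex_chartE[OF assms(1)])
  have "openin (top_of_set U) (U \<inter> \<kappa> -` T)"
    using \<psi>(2) assms(2) by (meson continuous_openin_preimage_gen homeomorphism_cont1)
  then show ?thesis
    using \<psi>(1) openin_trans by (simp add: Collect_conj_eq vimage_def)
qed

text \<open>This is the only place where the orientation enters: writing the derivative of a coordinate
  change as \<open>\<alpha> h + \<beta> cnj h\<close>, positivity of its determinant says \<open>|\<beta>| < |\<alpha>|\<close>, so that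
  difference quotients of the coordinate change stay in a disc around \<open>\<alpha>\<close> avoiding 0.\<close>

lemma transition_log:
  assumes U: "complex_chart U \<kappa>" and V: "complex_chart V \<kappa>'" and a: "a \<in> U" "a \<in> V"
  obtains W where "openin (top_of_set M) W" "a \<in> W" "W \<subseteq> U \<inter> V"
    "has_log (W - {a}) (\<lambda>z. (\<kappa>' z - \<kappa>' a) / (\<kappa> z - \<kappa> a))"
proof -
  obtain \<phi> \<theta> where \<phi>: "(U, \<phi>) \<in> \<A>" "\<kappa> = to_complex \<circ> \<phi>" and \<theta>: "(V, \<theta>) \<in> \<A>" "\<kappa>' = to_complex \<circ> \<theta>"
    using U V by (auto simp: complex_chart_def)
  obtain \<psi> where \<psi>: "openin (top_of_set M) U" "homeomorphism U (\<phi> ` U) \<phi> \<psi>" by (rule chart_inverse[OF \<phi>(1)])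
  obtain \<psi>' where \<psi>': "openin (top_of_set M) V" "homeomorphism V (\<theta> ` V) \<theta> \<psi>'" by (rule chart_inverse[OF \<theta>(1)])
  have inj: "inj_on \<phi> U" using \<psi>(2) by (metis homeomorphism_def inj_on_inverseI)
  define \<tau> where "\<tau> = \<theta> \<circ> inv_into U \<phi>"
  let ?S = "\<phi> ` (U \<inter> V)"
  have "oriented_compatible (U, \<phi>) (V, \<theta>)"
    using manifold \<phi>(1) \<theta>(1)
    unfolding compact_connected_oriented_manifold_def oriented_smooth_atlas_def by blast
  then obtain D where D: "(\<tau> has_derivative D) (at (\<phi> a) within ?S)" "0 < det (matrix D)"
    using a by (auto simp: oriented_compatible_def Let_def \<tau>_def)
  have "openin (top_of_set U) (U \<inter> V)"
    using \<psi>(1) \<psi>'(1) by (meson openin_Int openin_subset_trans inf_le1 openin_imp_subset)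
  then have "openin (top_of_set (\<phi> ` U)) ?S" using homeomorphism_imp_open_map[OF \<psi>(2)] by blast
  then have oS: "open ?S" using chart_image_open[OF \<phi>(1)] openin_open_trans by blast
  have "\<phi> a \<in> ?S" using a by blast
  then have D': "(\<tau> has_derivative D) (at (\<phi> a))"
    using D(1) at_within_open[OF _ oS] by metis
  define \<sigma> where "\<sigma> = to_complex \<circ> \<tau> \<circ> of_complex"
  define E where "E = to_complex \<circ> D \<circ> of_complex"
  have "(\<sigma> has_derivative E) (at (\<kappa> a))"
    unfolding \<sigma>_def E_def o_assoc[symmetric]
    by (intro diff_chain_at bounded_linear_imp_has_derivative bounded_linear_to_complex bounded_linear_of_complex)
      (simp add: \<phi>(2) D')
  then have \<sigma>: "\<exists>d>0. \<forall>w. norm (w - \<kappa> a) < d \<longrightarrow> norm (\<sigma> w - \<sigma> (\<kappa> a) - E (w - \<kappa> a)) \<le> e * norm (w - \<kappa> a)"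
    if "0 < e" for e using that unfolding has_derivative_at_alt by blast
  have \<sigma>\<kappa>: "\<sigma> (\<kappa> z) = \<kappa>' z" if "z \<in> U" for z
    using inj that by (simp add: \<sigma>_def \<phi>(2) \<theta>(2) \<tau>_def)
  define m where "m = matrix D"
  have Dm: "D v = m *v v" for v
    using D(1) by (simp add: m_def has_derivative_linear)
  \<comment> \<open>The two Wirtinger coefficients of the real-linear map \<open>E\<close>.\<close>
  define \<alpha> where "\<alpha> = Complex (m$k$k + m$l$l) (m$l$k - m$k$l) / 2"
  define \<beta> where "\<beta> = Complex (m$k$k - m$l$l) (m$l$k + m$k$l) / 2"
  have E: "E h = \<alpha> * h + \<beta> * cnj h" for h
  proof -
    have s: "(\<Sum>i\<in>UNIV. f i) = f k + f l" for f :: "'n \<Rightarrow> real" unfolding kl(2) using kl(1) by simp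
    have "E h = Complex (m$k$k * Re h + m$k$l * Im h) (m$l$k * Re h + m$l$l * Im h)"
      using kl(1) by (simp add: E_def Dm to_complex_def of_complex_def matrix_vector_mult_def s)
    also have "\<dots> = \<alpha> * h + \<beta> * cnj h"
      by (simp add: \<alpha>_def \<beta>_def complex_eq_iff field_simps)
    finally show ?thesis .
  qed
  have "(norm \<alpha>)\<^sup>2 - (norm \<beta>)\<^sup>2 = det m"
    unfolding det_two_indices[OF kl] \<alpha>_def \<beta>_def
    by (simp add: norm_divide power_divide cmod_power2) (simp add: power2_eq_square field_simps)
  then have "(norm \<beta>)\<^sup>2 < (norm \<alpha>)\<^sup>2" using D(2) by (simp add: m_def)
  then have ab: "norm \<beta> < norm \<alpha>" by (rule power2_less_imp_less) simp
  then have \<alpha>0: "\<alpha> \<noteq> 0" by auto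
  \<comment> \<open>Half of the gap: an error \<open>e\<close> together with
    \<open>norm \<beta>\<close> stays below \<open>norm \<alpha>\<close>.\<close>
  define e where "e = (norm \<alpha> - norm \<beta>) / 2"
  have e: "0 < e" using ab by (simp add: e_def)
  obtain d where d: "0 < d" "\<And>w. norm (w - \<kappa> a) < d \<Longrightarrow>
      norm (\<sigma> w - \<sigma> (\<kappa> a) - E (w - \<kappa> a)) \<le> e * norm (w - \<kappa> a)"
    using \<sigma>[OF e] by blast
  define W where "W = {z\<in>U. \<kappa> z \<in> ball (\<kappa> a) d} \<inter> V"
  define q where "q z = (\<kappa>' z - \<kappa>' a) / (\<kappa> z - \<kappa> a)" for z
  have ne: "\<kappa> z \<noteq> \<kappa> a" if "z \<in> U" "z \<noteq> a" for z
    using that a(1) inj by (metis \<phi>(2) comp_apply inj_onD of_to_complex)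
  have close: "dist (q z / \<alpha>) 1 < 1" if z: "z \<in> W - {a}" for z
  proof -
    let ?h = "\<kappa> z - \<kappa> a"
    have zU: "z \<in> U" "z \<noteq> a" "norm ?h < d" using z by (auto simp: W_def dist_norm norm_minus_commute)
    have h0: "?h \<noteq> 0" using ne[OF zU(1,2)] by simp
    have "norm (\<kappa>' z - \<kappa>' a - (\<alpha> * ?h + \<beta> * cnj ?h)) \<le> e * norm ?h"
      using d(2)[OF zU(3)] \<sigma>\<kappa>[OF zU(1)] \<sigma>\<kappa>[OF a(1)] E by simp
    moreover have "\<kappa>' z - \<kappa>' a - \<alpha> * ?h = (\<kappa>' z - \<kappa>' a - (\<alpha> * ?h + \<beta> * cnj ?h)) + \<beta> * cnj ?h" by simp
    ultimately have "norm (\<kappa>' z - \<kappa>' a - \<alpha> * ?h) \<le> e * norm ?h + norm \<beta> * norm ?h"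
      by (metis (no_types, lifting) add_mono complex_mod_cnj norm_mult norm_triangle_le order_refl)
    also have "\<dots> = (e + norm \<beta>) * norm ?h" by (simp add: algebra_simps)
    finally have "norm (\<kappa>' z - \<kappa>' a - \<alpha> * ?h) / norm ?h \<le> e + norm \<beta>"
      using h0 by (simp add: divide_le_eq)
    moreover have "q z - \<alpha> = (\<kappa>' z - \<kappa>' a - \<alpha> * ?h) / ?h" using h0 by (simp add: q_def field_simps)
    ultimately have "norm (q z - \<alpha>) \<le> e + norm \<beta>" by (simp add: norm_divide)
    also have "\<dots> < norm \<alpha>" using ab by (simp add: e_def field_simps)
    finally have "norm (q z - \<alpha>) / norm \<alpha> < 1" using \<alpha>0 by simp
    moreover have "q z / \<alpha> - 1 = (q z - \<alpha>) / \<alpha>" using \<alpha>0 by (simp add: field_simps)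
    ultimately show ?thesis by (simp add: dist_norm norm_divide)
  qed
  have \<kappa>c: "continuous_on U \<kappa>" "continuous_on V \<kappa>'"
    using U V complex_chartE homeomorphism_cont1 by metis+
  have "continuous_on (W - {a}) \<kappa>" "continuous_on (W - {a}) \<kappa>'"
    using \<kappa>c by (auto simp: W_def elim!: continuous_on_subset)
  then have "continuous_on (W - {a}) (\<lambda>z. q z / \<alpha>)"
    unfolding q_def using ne \<alpha>0 by (intro continuous_intros) (auto simp: W_def)
  note L = has_log_near_1[OF this]
  have "has_log (W - {a}) q"
    unfolding has_log_def
  proof (intro exI conjI ballI)
    show "continuous_on (W - {a}) (\<lambda>z. Ln (q z / \<alpha>) + Ln \<alpha>)"
      by (intro continuous_intros L(1) close)
    show "q z = exp (Ln (q z / \<alpha>) + Ln \<alpha>)" if "z \<in> W - {a}" for z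
      using L(2)[OF close that] \<alpha>0 by (simp add: exp_add)
  qed
  moreover have "openin (top_of_set M) W"
    unfolding W_def using openin_complex_chart[OF U open_ball] \<psi>'(1) by (rule openin_Int)
  moreover have "a \<in> W" using a d(1) by (simp add: W_def)
  moreover have "W \<subseteq> U \<inter> V" by (auto simp: W_def)
  ultimately show ?thesis using that unfolding q_def by blast
qed

end

section \<open>Cutoff functions and removal of punctures\<close>

context compact_manifold
begin

lemma openin_diff_compact: "compact K \<Longrightarrow> openin (top_of_set M) (M - K)"
  using compact_imp_closed by (metis Diff_eq open_Compl openin_open_Int)

lemma continuous_extension_by_constant:
  fixes f :: "'m \<Rightarrow> complex"
  assumes "openin (top_of_set M) V" "S \<subseteq> M" "compact K" "K \<subseteq> V"
    and "continuous_on (S \<inter> V) f" "\<And>z. z \<in> V - K \<Longrightarrow> f z = d"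
  shows "continuous_on S (\<lambda>z. if z \<in> V then f z else d)"
proof (rule continuous_on_open_cover2)
  show "openin (top_of_set S) (S \<inter> V)"
    using assms(1,2) unfolding openin_open by blast
  show "openin (top_of_set S) (S \<inter> (M - K))"
    using openin_diff_compact[OF assms(3)] assms(2) unfolding openin_open by blast
  show "S \<subseteq> (S \<inter> V) \<union> (S \<inter> (M - K))" using assms(2,4) by blast
  show "continuous_on (S \<inter> V) (\<lambda>z. if z \<in> V then f z else d)"
    by (rule continuous_on_eq[OF assms(5)]) simp
  have "continuous_on (S \<inter> (M - K)) (\<lambda>_. d)" by (intro continuous_intros)
  then show "continuous_on (S \<inter> (M - K)) (\<lambda>z. if z \<in> V then f z else d)"
    by (rule continuous_on_eq) (use assms(6) in auto)
qed

text \<open>A Urysohn function is 0 on a compact core and 1 off \<open>W\<close>. Truncating it at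
  height \<open>1/2\<close> moves the support into the compact set where it is at most
  \<open>1/2\<close>, which lies inside \<open>W\<close>.\<close>

lemma cutoff_exists:
  assumes W: "openin (top_of_set M) W" and a: "a \<in> W"
  obtains \<chi>' :: "'m \<Rightarrow> real" and N K where "continuous_on M \<chi>'" "openin (top_of_set M) N" "a \<in> N"
    "\<And>z. z \<in> N \<Longrightarrow> \<chi>' z = 1" "compact K" "K \<subseteq> W" "\<And>z. z \<in> M - K \<Longrightarrow> \<chi>' z = 0"
proof -
  let ?X = "top_of_set M"
  have cX: "compact_space ?X" using compact_M by (simp add: compact_space_subtopology)
  have "Hausdorff_space (euclidean :: 'm topology)"
    unfolding Hausdorff_space_def disjnt_def using separation_t2 by (simp, blast)
  then have hX: "Hausdorff_space ?X" by (rule Hausdorff_space_subtopology)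
  have nX: "normal_space ?X" by (rule compact_Hausdorff_or_regular_imp_normal_space[OF cX]) (use hX in simp)
  obtain V C N where V: "cell V" "V \<subseteq> W" "compact C" "C \<subseteq> V" "openin ?X N" "a \<in> N" "N \<subseteq> C"
    by (rule cell_neighbourhood[OF W a])
  have WM: "W \<subseteq> M" using W openin_imp_subset by blast
  have "closedin ?X C"
    using compact_imp_closed[OF V(3)] V(2,4) WM by (meson closed_subset order_trans)
  moreover have "closedin ?X (M - W)" using W by (metis closedin_diff closedin_topspace topspace_euclidean_subtopology)
  moreover have "disjnt C (M - W)" using V(2,4) by (auto simp: disjnt_def)
  ultimately obtain f where f: "continuous_map ?X (top_of_set {0..1::real}) f" "f ` C \<subseteq> {0}" "f ` (M - W) \<subseteq> {1}"
    by (rule Urysohn_lemma[OF nX _ _ _ zero_le_one])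
  have fc: "continuous_on M f" using f(1) by (simp add: continuous_map_in_subtopology)
  define K where "K = M \<inter> f -` {..1/2}"
  have "closedin ?X K" unfolding K_def by (rule continuous_closedin_preimage[OF fc]) simp
  then have "compact K" using compact_M closedin_compact by blast
  show ?thesis
  proof (rule that[of "\<lambda>z. max 0 (1 - 2 * f z)" N K])
    show "continuous_on M (\<lambda>z. max 0 (1 - 2 * f z))" by (intro continuous_intros fc)
    show "max 0 (1 - 2 * f z) = 1" if "z \<in> N" for z using that V(7) f(2) by force
    show "K \<subseteq> W"
    proof
      fix z assume "z \<in> K"
      then have "f z \<le> 1/2" "z \<in> M" by (auto simp: K_def)
      then show "z \<in> W" using f(3) by force
    qed
    show "max 0 (1 - 2 * f z) = 0" if "z \<in> M - K" for z using that by (auto simp: K_def)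
  qed (use V \<open>compact K\<close> in auto)
qed

text \<open>Punctures are filled one at a time. Near \<open>a\<close>, dividing \<open>u\<close> by
  the exponential of its faded local logarithm gives a function equal to 1, which extends over
  \<open>a\<close>; the correction \<open>exp \<eta>\<close> has a logarithm off the punctures, so
  nothing is lost. The function changes at each stage, hence the induction over all
  \<open>u\<close>.\<close>

lemma has_log_fill:
  assumes all: "\<And>u. \<lbrakk>continuous_on M u; \<And>z. z \<in> M \<Longrightarrow> u z \<noteq> 0\<rbrakk> \<Longrightarrow> has_log M u"
    and "finite F" and "F \<subseteq> M" and "continuous_on (M - F) u" and "\<And>z. z \<in> M - F \<Longrightarrow> u z \<noteq> 0"
    and "\<And>a. a \<in> F \<Longrightarrow> \<exists>W. openin (top_of_set M) W \<and> a \<in> W \<and> W \<inter> F = {a} \<and> has_log (W - {a}) u"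
  shows "has_log (M - F) u"
  using assms(2-)
proof (induction F arbitrary: u rule: finite_induct)
  case empty
  then show ?case using all by simp
next
  case (insert a F)
  have opaF: "openin (top_of_set M) (M - insert a F)"
    using insert.hyps(1) by (intro openin_diff_compact finite_imp_compact) simp
  obtain W where W: "openin (top_of_set M) W" "a \<in> W" "W \<inter> insert a F = {a}" "has_log (W - {a}) u"
    using insert.prems(4)[of a] by blast
  have WM: "W \<subseteq> M" using W(1) openin_imp_subset by blast
  obtain l where l: "continuous_on (W - {a}) l" "\<And>z. z \<in> W - {a} \<Longrightarrow> u z = exp (l z)"
    using W(4) by (rule has_logD) blast
  obtain \<rho> N K where \<rho>: "continuous_on M \<rho>" "openin (top_of_set M) N" "a \<in> N"
    "\<And>z. z \<in> N \<Longrightarrow> \<rho> z = 1" "compact K" "K \<subseteq> W" "\<And>z. z \<in> M - K \<Longrightarrow> \<rho> z = (0::real)"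
    by (rule cutoff_exists[OF W(1,2)]) blast
  define \<eta> where "\<eta> z = (if z \<in> W then - of_real (\<rho> z) * l z else 0)" for z
  have \<eta>: "continuous_on (M - insert a F) \<eta>"
    unfolding \<eta>_def
  proof (rule continuous_extension_by_constant[OF W(1) _ \<rho>(5,6)])
    have "continuous_on ((M - insert a F) \<inter> W) \<rho>" by (rule continuous_on_subset[OF \<rho>(1)]) blast
    moreover have "continuous_on ((M - insert a F) \<inter> W) l" by (rule continuous_on_subset[OF l(1)]) blast
    ultimately show "continuous_on ((M - insert a F) \<inter> W) (\<lambda>z. - of_real (\<rho> z) * l z)"
      by (intro continuous_intros)
    show "- of_real (\<rho> z) * l z = 0" if "z \<in> W - K" for z
    proof -
      have "z \<in> M - K" using that WM by blast
      then show ?thesis using \<rho>(7) by simp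
    qed
  qed blast
  define u' where "u' z = (if z = a then 1 else u z * exp (\<eta> z))" for z
  have u'N: "u' z = 1" if "z \<in> N \<inter> W" for z
    using that l(2)[of z] \<rho>(4)[of z] by (auto simp: u'_def \<eta>_def exp_minus)
  have u'c: "continuous_on (M - F) u'"
  proof (rule continuous_on_open_cover2)
    show "openin (top_of_set (M - F)) (M - insert a F)"
      by (rule openin_subset_trans[OF opaF]) blast+
    have "z \<notin> F" if "z \<in> W" for z
      using that W(3) insert.hyps(2) by (metis IntI insertCI singletonD)
    then have sub: "N \<inter> W \<subseteq> M - F" using WM by blast
    have "openin (top_of_set M) (N \<inter> W)" using \<rho>(2) W(1) by (rule openin_Int)
    then show "openin (top_of_set (M - F)) (N \<inter> W)"
      by (rule openin_subset_trans[OF _ sub]) blast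
    show "M - F \<subseteq> M - insert a F \<union> N \<inter> W" using W(2) \<rho>(3) by blast
    have "continuous_on (M - insert a F) (\<lambda>z. u z * exp (\<eta> z))"
      by (intro continuous_intros \<eta> insert.prems(2))
    then show "continuous_on (M - insert a F) u'" by (rule continuous_on_eq) (auto simp: u'_def)
    have "continuous_on (N \<inter> W) (\<lambda>_. 1 :: complex)" by (intro continuous_intros)
    then show "continuous_on (N \<inter> W) u'" by (rule continuous_on_eq) (use u'N in auto)
  qed
  have "has_log (M - F) u'"
  proof (rule insert.IH[OF _ u'c])
    show "F \<subseteq> M" using insert.prems(1) by blast
    show "u' z \<noteq> 0" if "z \<in> M - F" for z
      using insert.prems(3)[of z] that by (auto simp: u'_def)
    fix b assume b: "b \<in> F"
    then obtain Y where Y: "openin (top_of_set M) Y" "b \<in> Y" "Y \<inter> insert a F = {b}" "has_log (Y - {b}) u"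
      using insert.prems(4)[of b] by blast
    have YM: "Y - {b} \<subseteq> M - insert a F" using Y(1,3) openin_imp_subset by blast
    have "has_log (Y - {b}) (\<lambda>z. exp (\<eta> z))"
      unfolding has_log_def using continuous_on_subset[OF \<eta> YM] by blast
    with Y(4) have "has_log (Y - {b}) u'"
      by (rule has_log_mult) (use YM in \<open>auto simp: u'_def\<close>)
    moreover have "Y \<inter> F = {b}" using Y(3) b by blast
    ultimately show "\<exists>W. openin (top_of_set M) W \<and> b \<in> W \<and> W \<inter> F = {b} \<and> has_log (W - {b}) u'"
      using Y(1,2) by blast
  qed
  then have 1: "has_log (M - insert a F) u'" by (rule has_log_subset) auto
  have 2: "has_log (M - insert a F) (\<lambda>z. exp (- \<eta> z))"
    unfolding has_log_def using \<eta> by (intro exI[of _ "\<lambda>z. - \<eta> z"]) (auto intro: continuous_on_minus)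
  show ?case
    by (rule has_log_mult[OF 1 2]) (auto simp: u'_def exp_minus)
qed

end

context closed_surface
begin

text \<open>The planar construction is read in a chart and continued by constants. The factor 3
  leaves room for the compact disc of radius \<open>2 * r\<close>, outside of which the planar
  functions are constant.\<close>

lemma surface_piece:
  assumes U: "complex_chart U \<kappa>" and c: "0 < r" "ball c (3 * r) \<subseteq> \<kappa> ` U"
    and g: "path g" "path_image g \<subseteq> {z\<in>U. \<kappa> z \<in> ball c r}"
  obtains v w where "continuous_on (M - path_image g) v"
    "continuous_on (M - {pathstart g, pathfinish g}) w"
    "\<And>z. z \<in> M - path_image g \<Longrightarrow> w z = exp (v z)"
    "\<And>z. z \<in> M - {pathstart g, pathfinish g} \<Longrightarrow> w z \<noteq> 0"
    "\<And>z. \<lbrakk>z \<in> U; \<kappa> z \<in> ball c r\<rbrakk> \<Longrightarrow> w z = (\<kappa> z - \<kappa> (pathfinish g)) / (\<kappa> z - \<kappa> (pathstart g))"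
proof -
  obtain \<psi> where \<psi>: "openin (top_of_set M) U" "homeomorphism U (\<kappa> ` U) \<kappa> \<psi>"
    by (rule complex_chartE[OF U])
  have \<psi>\<kappa>: "\<psi> (\<kappa> z) = z" if "z \<in> U" for z using \<psi>(2) that by (simp add: homeomorphism_def)
  have \<kappa>c: "continuous_on U \<kappa>" using \<psi>(2) by (rule homeomorphism_cont1)
  let ?g = "\<kappa> \<circ> g" and ?a = "pathstart g" and ?b = "pathfinish g"
  have gU: "path_image g \<subseteq> U" using g(2) by blast
  have "path ?g" using g(1) gU \<kappa>c by (intro path_continuous_image) (auto intro: continuous_on_subset)
  moreover have "path_image ?g \<subseteq> ball c r" using g(2) by (auto simp: path_image_compose)
  ultimately obtain V W where VW: "continuous_on (- path_image ?g) V"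
    "continuous_on (- {pathstart ?g, pathfinish ?g}) W"
    "\<And>z. z \<notin> path_image ?g \<Longrightarrow> W z = exp (V z)"
    "\<And>z. 2 * r \<le> dist c z \<Longrightarrow> V z = 0" "\<And>z. 2 * r \<le> dist c z \<Longrightarrow> W z = 1"
    "\<And>z. dist c z < r \<Longrightarrow> W z = (z - pathfinish ?g) / (z - pathstart ?g)"
    by (rule planar_piece) blast
  have im: "\<kappa> z \<notin> path_image ?g" if "z \<in> U" "z \<notin> path_image g" for z
    using that gU \<psi>\<kappa> unfolding path_image_compose by (metis imageE subsetD)
  have ends: "?a \<in> U" "?b \<in> U" using gU pathstart_in_path_image pathfinish_in_path_image by blast+
  have pe: "pathstart ?g = \<kappa> ?a" "pathfinish ?g = \<kappa> ?b" by (simp_all add: pathstart_compose pathfinish_compose)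
  have ne: "\<kappa> z \<noteq> \<kappa> y" if "z \<in> U" "y \<in> U" "z \<noteq> y" for y z using \<psi>\<kappa> that by metis
  define K where "K = \<psi> ` cball c (2 * r)"
  have cb: "cball c (2 * r) \<subseteq> \<kappa> ` U" using c by (force simp: subset_eq)
  have K: "compact K"
    unfolding K_def using \<psi>(2) cb
    by (meson compact_cball compact_continuous_image continuous_on_subset homeomorphism_cont2)
  have KU: "K \<subseteq> U" using cb \<psi>(2) by (force simp: K_def homeomorphism_def)
  have far: "2 * r \<le> dist c (\<kappa> z)" if "z \<in> U - K" for z
    using that \<psi>\<kappa> unfolding K_def by (metis DiffD1 DiffD2 image_eqI linear mem_cball)
  define v where "v z = (if z \<in> U then V (\<kappa> z) else 0)" for z
  define w where "w z = (if z \<in> U then W (\<kappa> z) else 1)" for z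
  have wv: "w z = exp (v z)" if "z \<in> M - path_image g" for z
    using VW(3)[OF im] that by (auto simp: v_def w_def)
  show ?thesis
  proof (rule that[OF _ _ wv])
    show "continuous_on (M - path_image g) v"
      unfolding v_def
    proof (rule continuous_extension_by_constant[OF \<psi>(1) _ K KU])
      show "continuous_on ((M - path_image g) \<inter> U) (\<lambda>z. V (\<kappa> z))"
        by (rule continuous_on_compose2[OF VW(1)]) (use im \<kappa>c in \<open>auto elim: continuous_on_subset\<close>)
    qed (use far VW(4) in auto)
    show "continuous_on (M - {?a, ?b}) w"
      unfolding w_def
    proof (rule continuous_extension_by_constant[OF \<psi>(1) _ K KU])
      show "continuous_on ((M - {?a, ?b}) \<inter> U) (\<lambda>z. W (\<kappa> z))"
        by (rule continuous_on_compose2[OF VW(2)])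
          (use ne ends \<kappa>c in \<open>auto simp: pe elim: continuous_on_subset\<close>)
    qed (use far VW(5) in auto)
    show w': "w z = (\<kappa> z - \<kappa> ?b) / (\<kappa> z - \<kappa> ?a)" if "z \<in> U" "\<kappa> z \<in> ball c r" for z
      using VW(6)[of "\<kappa> z"] that by (simp add: w_def pe)
    show "w z \<noteq> 0" if z: "z \<in> M - {?a, ?b}" for z
    proof (cases "z \<in> path_image g")
      case True
      then have "z \<in> U" "\<kappa> z \<in> ball c r" using g(2) by auto
      then show ?thesis using w' ne ends z by auto
    qed (use wv z in auto)
  qed
qed

text \<open>The disc of three times the radius fits into the chart, as \<open>surface_piece\<close>
  demands.\<close>

definition good_disc :: "'m set \<Rightarrow> bool" where
  "good_disc S \<longleftrightarrow> (\<exists>U \<kappa> c r. complex_chart U \<kappa> \<and> 0 < r \<and> ball c (3 * r) \<subseteq> \<kappa> ` U \<and>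
     S = {z\<in>U. \<kappa> z \<in> ball c r})"

lemma good_disc_at:
  assumes "y \<in> M" obtains S where "good_disc S" "y \<in> S" "openin (top_of_set M) S"
proof -
  obtain U \<kappa> r where U: "complex_chart U \<kappa>" "y \<in> U" "0 < r" "ball (\<kappa> y) r \<subseteq> \<kappa> ` U"
    by (rule complex_chart_at[OF assms])
  show ?thesis
  proof (rule that[of "{z\<in>U. \<kappa> z \<in> ball (\<kappa> y) (r/3)}"])
    show "good_disc {z\<in>U. \<kappa> z \<in> ball (\<kappa> y) (r/3)}"
      unfolding good_disc_def
      by (rule exI[of _ U], rule exI[of _ \<kappa>], rule exI[of _ "\<kappa> y"], rule exI[of _ "r/3"]) (use U in auto)
    show "openin (top_of_set M) {z\<in>U. \<kappa> z \<in> ball (\<kappa> y) (r/3)}"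
      using openin_complex_chart[OF U(1)] by blast
  qed (use U in auto)
qed

lemma path_subdivision:
  assumes p: "path p" "path_image p \<subseteq> M"
  obtains n :: nat where "2 \<le> n" "\<And>i. i < n \<Longrightarrow> \<exists>S. good_disc S \<and> p ` {real i / n..real (Suc i) / n} \<subseteq> S"
proof -
  define \<C> where "\<C> = {B :: real set. open B \<and> (\<exists>S. good_disc S \<and> p ` (B \<inter> {0..1}) \<subseteq> S)}"
  have pc: "continuous_on {0..1} p" using p(1) by (simp add: path_def)
  have "\<exists>B\<in>\<C>. t \<in> B" if t: "t \<in> {0..1}" for t
  proof -
    have "p t \<in> M" using p(2) t by (auto simp: path_image_def)
    then obtain S where S: "good_disc S" "p t \<in> S" "openin (top_of_set M) S" by (rule good_disc_at)
    have "openin (top_of_set {0..1}) ({0..1} \<inter> p -` S)"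
      using pc S(3) p(2) by (intro continuous_openin_preimage) (auto simp: path_image_def)
    then obtain B where B: "open B" "{0..1} \<inter> p -` S = {0..1} \<inter> B" by (auto simp: openin_open)
    then have "p ` (B \<inter> {0..1}) \<subseteq> S" by auto
    then show ?thesis using B S t by (auto simp: \<C>_def intro!: exI[of _ B])
  qed
  then have cover: "{0..1} \<subseteq> \<Union>\<C>" by blast
  have ne: "\<C> \<noteq> {}" using cover by auto
  have op: "open B" if "B \<in> \<C>" for B using that by (simp add: \<C>_def)
  obtain d where d: "0 < d" "\<And>T. \<lbrakk>T \<subseteq> {0..1}; diameter T < d\<rbrakk> \<Longrightarrow> \<exists>B\<in>\<C>. T \<subseteq> B"
    by (rule Lebesgue_number_lemma[OF compact_Icc ne cover op]) blast+
  obtain n0 :: nat where n0: "1 / d < real n0" using reals_Archimedean2 by blast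
  \<comment> \<open>At least two pieces: then no piece of a closed simple curve contains both ends
    of the parameter interval, and the curve is injective on each.\<close>
  define n where "n = n0 + 2"
  have n: "1 / real n < d"
  proof -
    have "1 / d < real n" using n0 by (simp add: n_def)
    then show ?thesis using d(1) by (simp add: n_def field_simps)
  qed
  show ?thesis
  proof
    show "2 \<le> n" by (simp add: n_def)
    fix i assume i: "i < n"
    let ?T = "{real i / n..real (Suc i) / n}"
    have "0 \<le> real i / n" "real (Suc i) / n \<le> 1" using i by (simp_all add: divide_le_eq)
    then have T: "?T \<subseteq> {0..1}" by auto
    have "diameter ?T \<le> 1 / real n"
    proof (rule diameter_le)
      fix s t assume "s \<in> ?T" "t \<in> ?T"
      then have "\<bar>s - t\<bar> \<le> real (Suc i) / n - real i / n" by auto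
      then show "norm (s - t) \<le> 1 / real n" by (simp add: diff_divide_distrib[symmetric])
    qed simp
    then have "diameter ?T < d" using n by simp
    then obtain B where B: "B \<in> \<C>" "?T \<subseteq> B" using d(2)[OF T] by blast
    then obtain S where S: "good_disc S" "p ` (B \<inter> {0..1}) \<subseteq> S" by (auto simp: \<C>_def)
    have "p ` ?T \<subseteq> S" using S(2) B(2) T by blast
    then show "\<exists>S. good_disc S \<and> p ` ?T \<subseteq> S" using S(1) by blast
  qed
qed

end

lemma simple_path_inj:
  assumes "simple_path p" "p s = p t" "0 \<le> s" "s < 1" "0 \<le> t" "t < 1"
  shows "s = t"
proof -
  have "s \<in> {0..1}" "t \<in> {0..1}" using assms by auto
  then show ?thesis using assms unfolding simple_path_def loop_free_def by fastforce
qed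

context closed_surface
begin

lemma complex_chart_inj:
  assumes "complex_chart U \<kappa>" shows "inj_on \<kappa> U"
  using complex_chartE[OF assms] by (metis homeomorphism_def inj_on_inverseI)

lemma complex_chart_continuous:
  assumes "complex_chart U \<kappa>" shows "continuous_on U \<kappa>"
  using complex_chartE[OF assms] homeomorphism_cont1 by metis

text \<open>In a chart the inverse of the arc would map a nonempty open subset of the plane
  continuously and injectively into the line, against invariance of dimension.\<close>

lemma arc_no_interior:
  assumes S: "good_disc S" and T: "compact T" "continuous_on T p" "inj_on p T" "p ` T \<subseteq> S"
    and O: "openin (top_of_set M) O'" "O' \<noteq> {}" and sub: "O' \<subseteq> p ` (T :: real set)"
  shows False
proof -
  obtain U \<kappa> c r where U: "complex_chart U \<kappa>" "S = {z\<in>U. \<kappa> z \<in> ball c r}"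
    using S by (auto simp: good_disc_def)
  obtain \<psi> where \<psi>: "openin (top_of_set M) U" "open (\<kappa> ` U)" "homeomorphism U (\<kappa> ` U) \<kappa> \<psi>"
    by (rule complex_chartE[OF U(1)])
  have pU: "p ` T \<subseteq> U" using T(4) U(2) by blast
  have "openin (top_of_set U) O'"
    by (rule openin_subset_trans[OF O(1)]) (use sub pU openin_imp_subset[OF \<psi>(1)] in auto)
  then have "openin (top_of_set (\<kappa> ` U)) (\<kappa> ` O')" by (rule homeomorphism_imp_open_map[OF \<psi>(3)])
  then have op: "open (\<kappa> ` O')" using \<psi>(2) openin_open_trans by blast
  have "continuous_on T (\<kappa> \<circ> p)"
    using T(2) continuous_on_subset[OF complex_chart_continuous[OF U(1)] pU] by (rule continuous_on_compose)
  moreover have "inj_on (\<kappa> \<circ> p) T"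
    using T(3) inj_on_subset[OF complex_chart_inj[OF U(1)] pU] by (rule comp_inj_on)
  ultimately obtain g where g: "homeomorphism T ((\<kappa> \<circ> p) ` T) (\<kappa> \<circ> p) g"
    using homeomorphism_compact[OF T(1)] by blast
  have s: "\<kappa> ` O' \<subseteq> (\<kappa> \<circ> p) ` T" using sub by (metis image_comp image_mono)
  have "continuous_on (\<kappa> ` O') g" using g s by (meson continuous_on_subset homeomorphism_cont2)
  moreover have "inj_on g (\<kappa> ` O')" using g s by (metis homeomorphism_def inj_on_inverseI inj_on_subset)
  ultimately have "DIM(complex) \<le> DIM(real)"
    using op O(2) by (intro invariance_of_dimension[of "\<kappa> ` O'" g]) auto
  then show False by simp
qed

lemma simple_path_subdivision:
  assumes p: "simple_path p" "path_image p \<subseteq> M"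
  obtains n :: nat where "2 \<le> n"
    "\<And>i. i < n \<Longrightarrow> \<exists>S. good_disc S \<and> p ` {real i / n..real (Suc i) / n} \<subseteq> S"
    "\<And>i. i < n \<Longrightarrow> inj_on p {real i / n..real (Suc i) / n}"
    "path_image p = (\<Union>i<n. p ` {real i / n..real (Suc i) / n})"
proof -
  obtain n :: nat where n: "2 \<le> n" "\<And>i. i < n \<Longrightarrow> \<exists>S. good_disc S \<and> p ` {real i / n..real (Suc i) / n} \<subseteq> S"
    using path_subdivision[OF simple_path_imp_path[OF p(1)] p(2)] by blast
  have inj: "inj_on p {real i / n..real (Suc i) / n}" if i: "i < n" for i
  proof (rule inj_onI)
    fix s t assume st: "s \<in> {real i / n..real (Suc i) / n}" "t \<in> {real i / n..real (Suc i) / n}" "p s = p t"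
    have 1: "0 \<le> real i / n" "real (Suc i) / n \<le> 1" using i by (simp_all add: divide_le_eq)
    have st': "s \<in> {0..1}" "t \<in> {0..1}"
      using st(1,2) 1 unfolding atLeastAtMost_iff by linarith+
    have "\<bar>s - t\<bar> \<le> real (Suc i) / n - real i / n" using st(1,2) by auto
    also have "\<dots> = 1 / n" by (simp add: diff_divide_distrib[symmetric])
    also have "\<dots> < 1" using n(1) by simp
    finally have "\<not> (s = 0 \<and> t = 1 \<or> s = 1 \<and> t = 0)" by auto
    then show "s = t" using p(1) st(3) st' unfolding simple_path_def loop_free_def by blast
  qed
  have "path_image p = (\<Union>i<n. p ` {real i / n..real (Suc i) / n})"
  proof
    show "path_image p \<subseteq> (\<Union>i<n. p ` {real i / n..real (Suc i) / n})"
    proof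
      fix z assume "z \<in> path_image p"
      then obtain t where t: "0 \<le> t" "t \<le> 1" "z = p t" by (auto simp: path_image_def)
      show "z \<in> (\<Union>i<n. p ` {real i / n..real (Suc i) / n})"
      proof (cases "t = 1")
        case True
        have "t \<in> {real (n - 1) / n..real (Suc (n - 1)) / n}" using n(1) True by (simp add: divide_le_eq)
        then show ?thesis using t(3) n(1) by (intro UN_I[of "n - 1"]) auto
      next
        case False
        define i where "i = nat \<lfloor>t * n\<rfloor>"
        have "real i = of_int \<lfloor>t * n\<rfloor>" using t(1) by (simp add: i_def)
        then have "real i \<le> t * n" "t * n < real (Suc i)" by linarith+
        moreover have "t * n < n" using False t(2) n(1) by simp
        ultimately have "real i < real n" "t \<in> {real i / n..real (Suc i) / n}"
          using n(1) by (linarith, simp add: divide_le_eq le_divide_eq)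
        then show ?thesis unfolding t(3) by (intro UN_I[of i] imageI) simp_all
      qed
    qed
    show "(\<Union>i<n. p ` {real i / n..real (Suc i) / n}) \<subseteq> path_image p"
    proof clarify
      fix i t assume i: "i < n" and t: "t \<in> {real i / n..real (Suc i) / n}"
      have "0 \<le> real i / n" "real (Suc i) / n \<le> 1" using i by (simp_all add: divide_le_eq)
      then have "t \<in> {0..1}" using t unfolding atLeastAtMost_iff by linarith
      then show "p t \<in> path_image p" unfolding path_image_def by (rule imageI)
    qed
  qed
  with n inj show ?thesis using that by blast
qed

text \<open>The arcs are removed one by one. Each is compact without interior, so what is left of
  the open set stays open and nonempty.\<close>

lemma simple_path_no_interior:
  assumes p: "simple_path p" "path_image p \<subseteq> M" and O: "openin (top_of_set M) O'" "O' \<noteq> {}"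
  shows "O' - path_image p \<noteq> {}"
proof -
  obtain n :: nat where n: "2 \<le> n" "\<And>i. i < n \<Longrightarrow> \<exists>S. good_disc S \<and> p ` {real i / n..real (Suc i) / n} \<subseteq> S"
    "\<And>i. i < n \<Longrightarrow> inj_on p {real i / n..real (Suc i) / n}"
    "path_image p = (\<Union>i<n. p ` {real i / n..real (Suc i) / n})"
    using simple_path_subdivision[OF p] by blast
  define C where "C i = p ` {real i / n..real (Suc i) / n}" for i
  have pc: "continuous_on {real i / n..real (Suc i) / n} p" if "i < n" for i
  proof -
    have "0 \<le> real i / n" "real (Suc i) / n \<le> 1" using that by (simp_all add: divide_le_eq)
    then show ?thesis
      using simple_path_imp_path[OF p(1)] unfolding path_def by (elim continuous_on_subset) auto
  qed
  have "openin (top_of_set M) (O' - (\<Union>i<m. C i)) \<and> O' - (\<Union>i<m. C i) \<noteq> {}" if "m \<le> n" for m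
    using that
  proof (induction m)
    case 0
    then show ?case using O by simp
  next
    case (Suc m)
    then have m: "m < n" and IH: "openin (top_of_set M) (O' - (\<Union>i<m. C i))" "O' - (\<Union>i<m. C i) \<noteq> {}" by auto
    have eq: "O' - (\<Union>i<Suc m. C i) = (O' - (\<Union>i<m. C i)) \<inter> (M - C m)"
      using openin_imp_subset[OF O(1)] by (auto simp: lessThan_Suc)
    have "compact (C m)" unfolding C_def using pc[OF m] by (intro compact_continuous_image) auto
    then have op: "openin (top_of_set M) (O' - (\<Union>i<Suc m. C i))"
      unfolding eq using IH(1) openin_diff_compact by (intro openin_Int)
    obtain S where S: "good_disc S" "C m \<subseteq> S" using n(2)[OF m] unfolding C_def by blast
    have "\<not> O' - (\<Union>i<m. C i) \<subseteq> C m"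
      using arc_no_interior[OF S(1) compact_Icc pc[OF m] n(3)[OF m] _ IH] S(2) unfolding C_def by blast
    then have "O' - (\<Union>i<Suc m. C i) \<noteq> {}" unfolding lessThan_Suc by blast
    with op show ?case by blast
  qed
  then show ?thesis unfolding n(4) C_def[symmetric] by blast
qed

definition simple_closed_curve :: "'m set \<Rightarrow> bool" where
  "simple_closed_curve c \<longleftrightarrow>
     (\<exists>p. simple_path p \<and> pathfinish p = pathstart p \<and> path_image p = c \<and> c \<subseteq> M)"

lemma curves_no_interior:
  assumes "finite \<C>" "\<And>c. c \<in> \<C> \<Longrightarrow> simple_closed_curve c" "openin (top_of_set M) O'" "O' \<noteq> {}"
  shows "openin (top_of_set M) (O' - \<Union>\<C>) \<and> O' - \<Union>\<C> \<noteq> {}"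
  using assms
proof (induction \<C> rule: finite_induct)
  case (insert c \<C>)
  then have IH: "openin (top_of_set M) (O' - \<Union>\<C>)" "O' - \<Union>\<C> \<noteq> {}" by auto
  obtain p where p: "simple_path p" "path_image p = c" "c \<subseteq> M"
    using insert.prems(1)[of c] by (auto simp: simple_closed_curve_def)
  have eq: "O' - \<Union>(insert c \<C>) = (O' - \<Union>\<C>) \<inter> (M - c)"
    using openin_imp_subset[OF insert.prems(2)] by auto
  have "compact c" using p simple_path_imp_path compact_path_image by blast
  then have "openin (top_of_set M) (O' - \<Union>(insert c \<C>))"
    unfolding eq using IH(1) openin_diff_compact by (intro openin_Int)
  moreover have "O' - \<Union>\<C> - c \<noteq> {}"
    using simple_path_no_interior[OF p(1) _ IH] p(2,3) by simp
  ultimately show ?case by (simp add: Diff_Un[symmetric] set_diff_eq) blast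
qed simp

text \<open>Each arc of a subdivided curve carries a map to the punctured plane with a logarithm that
  jumps across the arc; their product is a candidate for the map whose degree on a loop is the
  intersection number with the curve.\<close>

lemma essential_map_exists:
  assumes fin: "finite \<C>" and curves: "\<And>c. c \<in> \<C> \<Longrightarrow> simple_closed_curve c"
    and conn: "connected (M - \<Union>\<C>)" and c0: "c0 \<in> \<C>"
  shows "\<exists>u. continuous_on M u \<and> (\<forall>z\<in>M. u z \<noteq> 0) \<and> \<not> has_log M u"
proof (rule ccontr)
  assume "\<not> ?thesis"
  then have all: "has_log M u" if "continuous_on M u" "\<And>z. z \<in> M \<Longrightarrow> u z \<noteq> 0" for u using that by blast

  \<comment> \<open>Subdivision of the curve into arcs\<close>
  obtain p where p: "simple_path p" "pathfinish p = pathstart p" "path_image p = c0" "c0 \<subseteq> M"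
    using curves[OF c0] by (auto simp: simple_closed_curve_def)
  have pp: "path p" using p(1) by (rule simple_path_imp_path)
  obtain n :: nat where n: "2 \<le> n" "\<And>i. i < n \<Longrightarrow> \<exists>S. good_disc S \<and> p ` {real i / n..real (Suc i) / n} \<subseteq> S"
    "\<And>i. i < n \<Longrightarrow> inj_on p {real i / n..real (Suc i) / n}"
    "path_image p = (\<Union>i<n. p ` {real i / n..real (Suc i) / n})"
    using simple_path_subdivision[OF p(1)] p(3,4) by blast
  define C where "C i = p ` {real i / n..real (Suc i) / n}" for i
  define a where "a i = p (real i / n)" for i :: nat
  have bounds: "real i / n \<in> {0..1}" "real (Suc i) / n \<in> {0..1}" "real i / n < 1" if "i < n" for i
    using that by (simp_all add: divide_le_eq divide_less_eq)
  have an: "a n = a 0" using n(1) p(2) by (simp add: a_def pathstart_def pathfinish_def)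
  have a_inj: "i = j" if "a i = a j" "i < n" "j < n" for i j
  proof -
    have "real i / n = real j / n"
      using simple_path_inj[OF p(1), of "real i / n" "real j / n"] that bounds by (auto simp: a_def)
    then show ?thesis using n(1) by simp
  qed
  \<comment> \<open>The arc that ends at the vertex \<open>a j\<close>, in cyclic order; with at
    least two arcs it differs from the arc that starts there.\<close>
  define prev where "prev j = (if j = 0 then n - 1 else j - 1)" for j
  have prev: "prev j < n" "a (Suc (prev j)) = a j" "prev j \<noteq> j" if "j < n" for j
    using that n(1) an by (auto simp: prev_def)
  have prev_unique: "i = prev j" if "a (Suc i) = a j" "i < n" "j < n" for i j
  proof (cases "Suc i = n")
    case True
    then have "j = 0" using that an a_inj[of 0 j] n(1) by auto
    then show ?thesis using True by (auto simp: prev_def)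
  next
    case False
    then have "Suc i = j" using that a_inj[of "Suc i" j] by auto
    then show ?thesis by (auto simp: prev_def)
  qed
  have Cp: "C i \<subseteq> c0" if "i < n" for i using n(4) p(3) that by (auto simp: C_def)
  have CM: "C i \<subseteq> M" if "i < n" for i using Cp[OF that] p(4) by blast
  have aC: "a i \<in> C i" "a (Suc i) \<in> C i" if "i < n" for i
    by (auto simp: a_def C_def intro!: imageI divide_right_mono)
  have Ccomp: "compact (C i)" if "i < n" for i
  proof -
    have "{real i / n..real (Suc i) / n} \<subseteq> {0..1}" using bounds[OF that] by auto
    then have "continuous_on {real i / n..real (Suc i) / n} p"
      using pp unfolding path_def by (rule continuous_on_subset[rotated])
    then show ?thesis unfolding C_def by (intro compact_continuous_image) auto
  qed

  \<comment> \<open>The factors attached to the arcs and their product\<close>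
  define Q where "Q i U \<kappa> c r v w \<longleftrightarrow> complex_chart U \<kappa> \<and> C i \<subseteq> {z\<in>U. \<kappa> z \<in> ball c r} \<and>
      continuous_on (M - C i) v \<and> continuous_on (M - {a i, a (Suc i)}) w \<and>
      (\<forall>z\<in>M - C i. w z = exp (v z)) \<and> (\<forall>z\<in>M - {a i, a (Suc i)}. w z \<noteq> 0) \<and>
      (\<forall>z\<in>{z\<in>U. \<kappa> z \<in> ball c r}. w z = (\<kappa> z - \<kappa> (a (Suc i))) / (\<kappa> z - \<kappa> (a i)))"
    for i U c r and \<kappa> v w :: "'m \<Rightarrow> complex"
  have "\<exists>U \<kappa> c r v w. Q i U \<kappa> c r v w"
    if i: "i < n" for i
  proof -
    obtain U \<kappa> c r where U: "complex_chart U \<kappa>" "0 < r" "ball c (3 * r) \<subseteq> \<kappa> ` U"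
      "C i \<subseteq> {z\<in>U. \<kappa> z \<in> ball c r}"
      using n(2)[OF i] unfolding good_disc_def C_def by blast
    define g where "g = path_piece (real i / n) (real (Suc i) / n) p"
    have le: "real i / n \<le> real (Suc i) / n" by (simp add: divide_right_mono)
    have g: "path g" "path_image g = C i" "pathstart g = a i" "pathfinish g = a (Suc i)"
      using path_piece[OF pp bounds(1,2)[OF i]] le
      by (simp_all add: g_def C_def a_def closed_segment_eq_real_ivl)
    obtain v w where "continuous_on (M - path_image g) v" "continuous_on (M - {pathstart g, pathfinish g}) w"
      "\<And>z. z \<in> M - path_image g \<Longrightarrow> w z = exp (v z)"
      "\<And>z. z \<in> M - {pathstart g, pathfinish g} \<Longrightarrow> w z \<noteq> 0"
      "\<And>z. \<lbrakk>z \<in> U; \<kappa> z \<in> ball c r\<rbrakk> \<Longrightarrow> w z = (\<kappa> z - \<kappa> (pathfinish g)) / (\<kappa> z - \<kappa> (pathstart g))"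
      by (rule surface_piece[OF U(1-3) g(1)]) (use U(4) g(2) in auto)
    then have "Q i U \<kappa> c r v w" unfolding Q_def g(2-4) using U(1,4) by blast
    then show ?thesis by blast
  qed
  then have "\<forall>i\<in>{..<n}. \<exists>U \<kappa> c r v w. Q i U \<kappa> c r v w" by simp
  then obtain U \<kappa> c r v w where "\<forall>i\<in>{..<n}. Q i (U i) (\<kappa> i) (c i) (r i) (v i) (w i)"
    unfolding bchoice_iff by blast
  then have Q: "Q i (U i) (\<kappa> i) (c i) (r i) (v i) (w i)" if "i < n" for i using that by simp
  have chart: "\<And>i. i < n \<Longrightarrow> complex_chart (U i) (\<kappa> i)"
    and CD: "\<And>i. i < n \<Longrightarrow> C i \<subseteq> {z\<in>U i. \<kappa> i z \<in> ball (c i) (r i)}"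
    and v: "\<And>i. i < n \<Longrightarrow> continuous_on (M - C i) (v i)"
    and w: "\<And>i. i < n \<Longrightarrow> continuous_on (M - {a i, a (Suc i)}) (w i)"
    and wv: "\<And>i z. \<lbrakk>i < n; z \<in> M - C i\<rbrakk> \<Longrightarrow> w i z = exp (v i z)"
    and w0: "\<And>i z. \<lbrakk>i < n; z \<in> M - {a i, a (Suc i)}\<rbrakk> \<Longrightarrow> w i z \<noteq> 0"
    and wD: "\<And>i z. \<lbrakk>i < n; z \<in> {z\<in>U i. \<kappa> i z \<in> ball (c i) (r i)}\<rbrakk> \<Longrightarrow>
      w i z = (\<kappa> i z - \<kappa> i (a (Suc i))) / (\<kappa> i z - \<kappa> i (a i))"
    using Q unfolding Q_def by blast+
  define D where "D i = {z\<in>U i. \<kappa> i z \<in> ball (c i) (r i)}" for i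
  have Dop: "openin (top_of_set M) (D i)" if "i < n" for i
    unfolding D_def by (rule openin_complex_chart[OF chart[OF that] open_ball])
  have aD: "a i \<in> D i" "a (Suc i) \<in> D i" if "i < n" for i
    using CD[OF that] aC[OF that] unfolding D_def by blast+
  have \<kappa>ne: "\<kappa> i z \<noteq> \<kappa> i y" if "i < n" "z \<in> D i" "y \<in> D i" "z \<noteq> y" for i z y
    using complex_chart_inj[OF chart[OF that(1)]] that(2-4) unfolding D_def inj_on_def by blast
  have \<kappa>c: "continuous_on (D i) (\<kappa> i)" if "i < n" for i
    by (rule continuous_on_subset[OF complex_chart_continuous[OF chart[OF that]]]) (auto simp: D_def)
  define F where "F = a ` {..<n}"
  have FM: "F \<subseteq> M" using aC(1) CM by (auto simp: F_def)
  have aSF: "a (Suc i) \<in> F" if "i < n" for i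
  proof (cases "Suc i = n")
    case True
    then show ?thesis using an n(1) by (auto simp: F_def)
  qed (use that in \<open>auto simp: F_def\<close>)
  define u where "u z = (\<Prod>i<n. w i z)" for z
  have uc: "continuous_on (M - F) u"
    unfolding u_def
  proof (rule continuous_on_prod)
    fix i assume "i \<in> {..<n}"
    then have i: "i < n" by simp
    show "continuous_on (M - F) (w i)"
      by (rule continuous_on_subset[OF w[OF i]]) (use aSF[OF i] i in \<open>auto simp: F_def\<close>)
  qed
  have u0: "u z \<noteq> 0" if "z \<in> M - F" for z
  proof -
    have "w i z \<noteq> 0" if i: "i < n" for i
      using w0[OF i, of z] \<open>z \<in> M - F\<close> aSF[OF i] i by (auto simp: F_def)
    then show ?thesis by (simp add: u_def)
  qed
  \<comment> \<open>At the vertex \<open>b\<close> the factor of the outgoing arc has a simple pole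
    and that of the incoming arc a simple zero, each in its own chart. The two nearly cancel: what
    is left of them is the quotient treated in \<open>transition_log\<close>. All other factors
    combine into \<open>R\<close>, continuous and nonzero at \<open>b\<close>.\<close>
  have local: "\<exists>W. openin (top_of_set M) W \<and> b \<in> W \<and> W \<inter> F = {b} \<and> has_log (W - {b}) u" if bF: "b \<in> F" for b
  proof -
    obtain j where j: "j < n" "b = a j" using bF by (auto simp: F_def)
    define j' where "j' = prev j"
    have j': "j' < n" "a (Suc j') = b" "j' \<noteq> j" using prev[OF j(1)] j(2) by (auto simp: j'_def)
    have bD: "b \<in> D j" "b \<in> D j'" using aD(1)[OF j(1)] aD(2)[OF j'(1)] j j' by auto
    have nej: "a (Suc j) \<noteq> b" using prev_unique[OF _ j(1) j(1)] prev(3)[OF j(1)] j(2) by metis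
    have nej': "a j' \<noteq> b" using a_inj[OF _ j'(1) j(1)] j(2) j'(3) by blast
    have bU: "b \<in> U j" "b \<in> U j'" using bD by (auto simp: D_def)
    obtain W0 where W0: "openin (top_of_set M) W0" "b \<in> W0"
      "has_log (W0 - {b}) (\<lambda>z. (\<kappa> j' z - \<kappa> j' b) / (\<kappa> j z - \<kappa> j b))"
      by (rule transition_log[OF chart[OF j(1)] chart[OF j'(1)] bU]) blast
    define S where "S = D j \<inter> D j' \<inter> (M - (F - {b}))"
    have Sop: "openin (top_of_set M) S"
      unfolding S_def using Dop[OF j(1)] Dop[OF j'(1)]
      by (intro openin_Int openin_diff_compact finite_imp_compact) (auto simp: F_def)
    have bS: "b \<in> S" using bD bF FM by (auto simp: S_def)
    define R where "R z = (\<kappa> j z - \<kappa> j (a (Suc j))) / (\<kappa> j' z - \<kappa> j' (a j')) * (\<Prod>i\<in>{..<n} - {j, j'}. w i z)" for z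
    have S1: "\<kappa> j z \<noteq> \<kappa> j (a (Suc j))" if "z \<in> S" for z
    proof (rule \<kappa>ne[OF j(1)])
      show "z \<noteq> a (Suc j)" using that aSF[OF j(1)] nej by (auto simp: S_def)
    qed (use that aD[OF j(1)] in \<open>auto simp: S_def\<close>)
    have S2: "\<kappa> j' z \<noteq> \<kappa> j' (a j')" if "z \<in> S" for z
    proof (rule \<kappa>ne[OF j'(1)])
      have "a j' \<in> F" using j'(1) by (auto simp: F_def)
      then show "z \<noteq> a j'" using that nej' by (auto simp: S_def)
    qed (use that aD[OF j'(1)] in \<open>auto simp: S_def\<close>)
    have S3: "S \<subseteq> M - {a i, a (Suc i)}" if i: "i \<in> {..<n} - {j, j'}" for i
    proof -
      have "a i \<in> F" "a (Suc i) \<in> F" using i aSF by (auto simp: F_def)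
      moreover have "a i \<noteq> b" using a_inj[of i j] i j by auto
      moreover have "a (Suc i) \<noteq> b" using prev_unique[of i j] i j by (auto simp: j'_def)
      ultimately show ?thesis by (auto simp: S_def)
    qed
    have "continuous_on S R"
      unfolding R_def
    proof (intro continuous_on_mult continuous_on_divide continuous_on_diff continuous_on_const continuous_on_prod)
      show "continuous_on S (\<kappa> j)" by (rule continuous_on_subset[OF \<kappa>c[OF j(1)]]) (auto simp: S_def)
      show "continuous_on S (\<kappa> j')" by (rule continuous_on_subset[OF \<kappa>c[OF j'(1)]]) (auto simp: S_def)
      show "\<forall>z\<in>S. \<kappa> j' z - \<kappa> j' (a j') \<noteq> 0" using S2 by simp
      show "continuous_on S (w i)" if "i \<in> {..<n} - {j, j'}" for i
        by (rule continuous_on_subset[OF w S3[OF that]]) (use that in auto)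
    qed
    moreover have "R z \<noteq> 0" if "z \<in> S" for z
    proof -
      have "w i z \<noteq> 0" if i: "i \<in> {..<n} - {j, j'}" for i
        using w0[of i z] S3[OF i] \<open>z \<in> S\<close> i by blast
      then show ?thesis using S1[OF that] S2[OF that] by (simp add: R_def)
    qed
    ultimately obtain V where V: "cell V" "V \<subseteq> S" "b \<in> V" "has_log V R"
      using local_log[OF _ _ Sop bS] unfolding has_log_def by metis
    define W where "W = V \<inter> W0"
    have 1: "has_log (W - {b}) R" using V(4) by (rule has_log_subset) (auto simp: W_def)
    have 2: "has_log (W - {b}) (\<lambda>z. (\<kappa> j' z - \<kappa> j' b) / (\<kappa> j z - \<kappa> j b))"
      using W0(3) by (rule has_log_subset) (auto simp: W_def)
    have "has_log (W - {b}) u"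
    proof (rule has_log_mult[OF 1 2])
      fix z assume "z \<in> W - {b}"
      then have z: "z \<in> D j" "z \<in> D j'" using V(2) by (auto simp: W_def S_def)
      have "u z = w j z * (w j' z * (\<Prod>i\<in>{..<n} - {j, j'}. w i z))"
      proof -
        have "u z = w j z * (\<Prod>i\<in>{..<n} - {j}. w i z)"
          unfolding u_def using j(1) by (intro prod.remove) auto
        also have "(\<Prod>i\<in>{..<n} - {j}. w i z) = w j' z * (\<Prod>i\<in>{..<n} - {j} - {j'}. w i z)"
          using j' by (intro prod.remove) auto
        also have "{..<n} - {j} - {j'} = {..<n} - {j, j'}" by blast
        finally show ?thesis .
      qed
      moreover have "w j z = (\<kappa> j z - \<kappa> j (a (Suc j))) / (\<kappa> j z - \<kappa> j b)"
        using wD[OF j(1)] z(1) j(2) unfolding D_def by blast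
      moreover have "w j' z = (\<kappa> j' z - \<kappa> j' b) / (\<kappa> j' z - \<kappa> j' (a j'))"
        using wD[OF j'(1)] z(2) j'(2) unfolding D_def by blast
      ultimately show "u z = R z * ((\<kappa> j' z - \<kappa> j' b) / (\<kappa> j z - \<kappa> j b))"
        unfolding R_def by (simp only: times_divide_eq_left times_divide_eq_right divide_divide_eq_left mult_ac)
    qed
    moreover have "openin (top_of_set M) W" unfolding W_def using cell_open[OF V(1)] W0(1) by (rule openin_Int)
    moreover have "W \<inter> F = {b}" using V(2,3) W0(2) bF by (auto simp: W_def S_def)
    ultimately show ?thesis using V(3) W0(2) by (auto simp: W_def)
  qed
  \<comment> \<open>Here the assumption for contradiction enters, through the functions obtained by
    filling the vertices.\<close>
  have "has_log (M - F) u"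
    by (rule has_log_fill[OF all _ FM uc u0 local]) (auto simp: F_def)
  then obtain \<Lambda> where \<Lambda>: "continuous_on (M - F) \<Lambda>" "\<And>z. z \<in> M - F \<Longrightarrow> u z = exp (\<Lambda> z)"
    by (rule has_logD) blast
  have Fc: "F \<subseteq> c0" using aC(1) Cp by (auto simp: F_def)
  have Mc: "M - c0 \<subseteq> M - F" "\<And>i. i < n \<Longrightarrow> M - c0 \<subseteq> M - C i" using Fc Cp by blast+

  \<comment> \<open>Comparison with the sum of the arc logarithms\<close>
  define G where "G z = \<Lambda> z - (\<Sum>i<n. v i z)" for z
  have Gc: "continuous_on (M - c0) G"
    unfolding G_def
  proof (intro continuous_on_diff continuous_on_sum)
    show "continuous_on (M - c0) (v i)" if "i \<in> {..<n}" for i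
      by (rule continuous_on_subset[OF v Mc(2)]) (use that in auto)
  qed (rule continuous_on_subset[OF \<Lambda>(1) Mc(1)])
  have expG: "exp (\<Lambda> z) = 1 * exp (\<Sum>i<n. v i z)" if z: "z \<in> M - c0" for z
  proof -
    have "u z = (\<Prod>i<n. exp (v i z))"
      unfolding u_def using wv Mc(2) z by (intro prod.cong) auto
    then show ?thesis using \<Lambda>(2) Mc(1) z by (auto simp: exp_sum)
  qed
  define Z where "Z = M - \<Union>\<C>"
  have Xc: "Z \<subseteq> M - c0" using c0 by (auto simp: Z_def)
  have "Z \<noteq> {}"
    using curves_no_interior[OF fin curves, of M] M_nonempty unfolding Z_def by simp
  then obtain x0 where x0: "x0 \<in> Z" by blast
  define d where "d = G x0"
  \<comment> \<open>Both parts of \<open>G\<close> are logarithms of \<open>u\<close> off the curve,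
    and the complement of all curves is connected: this is where nonseparation is used.\<close>
  have GX: "G z = d" if "z \<in> Z" for z
    unfolding d_def G_def
  proof (rule logs_differ_by_constant[where K = 1])
    show "connected Z" using conn by (simp add: Z_def)
    show "continuous_on Z \<Lambda>" using \<Lambda>(1) Xc Mc(1) by (meson continuous_on_subset order_trans)
    show "continuous_on Z (\<lambda>z. \<Sum>i<n. v i z)"
    proof (rule continuous_on_sum)
      show "continuous_on Z (v i)" if "i \<in> {..<n}" for i
        by (rule continuous_on_subset[OF v]) (use that Xc Mc(2)[of i] in auto)
    qed
    show "exp (\<Lambda> y) = 1 * exp (\<Sum>i<n. v i y)" if "y \<in> Z" for y using expG Xc that by blast
  qed (use that x0 in auto)
  \<comment> \<open>By continuity, since the other curves have no interior.\<close>
  have Gd: "G z = d" if z: "z \<in> M - c0" for z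
  proof (rule ccontr)
    assume ne: "G z \<noteq> d"
    have "compact c0" using compact_path_image[OF pp] p(3) by simp
    then have o: "openin (top_of_set M) (M - c0)" by (rule openin_diff_compact)
    have "openin (top_of_set (M - c0)) ((M - c0) \<inter> G -` (- {d}))"
      by (rule continuous_openin_preimage_gen[OF Gc]) auto
    then have o': "openin (top_of_set M) ((M - c0) \<inter> G -` (- {d}))" using o by (rule openin_trans)
    have "(M - c0) \<inter> G -` (- {d}) \<noteq> {}" using z ne by blast
    then have "(M - c0) \<inter> G -` (- {d}) - \<Union>\<C> \<noteq> {}"
      using curves_no_interior[OF fin curves o'] by blast
    then show False using GX by (auto simp: Z_def)
  qed
  have ed: "exp d = 1" using expG[of x0] x0 Xc by (auto simp: d_def G_def exp_diff)
  have n0: "0 < n" using n(1) by simp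

  \<comment> \<open>A logarithm of the first factor across its own arc\<close>
  define Y where "Y = M - (F \<union> (\<Union>i\<in>{1..<n}. C i))"
  \<comment> \<open>The function \<open>v 0\<close> is undefined on the first arc, but it equals the
    global logarithm minus the other arc logarithms, and these are continuous there. As
    \<open>exp d = 1\<close>, this is a logarithm of \<open>w 0\<close>.\<close>
  define R where "R z = \<Lambda> z - d - (\<Sum>i\<in>{1..<n}. v i z)" for z
  have Yop: "openin (top_of_set M) Y"
    unfolding Y_def
    by (intro openin_diff_compact compact_Un compact_UN) (auto simp: F_def Ccomp finite_imp_compact)
  have split: "{..<n} = insert 0 {1..<n}" using n0 by auto
  have Rc: "continuous_on Y R"
    unfolding R_def
  proof (intro continuous_on_diff continuous_on_const continuous_on_sum)
    show "continuous_on Y \<Lambda>" by (rule continuous_on_subset[OF \<Lambda>(1)]) (auto simp: Y_def)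
    show "continuous_on Y (v i)" if "i \<in> {1..<n}" for i
      by (rule continuous_on_subset[OF v]) (use that in \<open>auto simp: Y_def\<close>)
  qed
  have Rexp: "w 0 z = exp (R z)" if z: "z \<in> Y" for z
  proof -
    have "u z = w 0 z * (\<Prod>i\<in>{1..<n}. w i z)" unfolding u_def split by simp
    also have "(\<Prod>i\<in>{1..<n}. w i z) = exp (\<Sum>i\<in>{1..<n}. v i z)"
      unfolding exp_sum[OF finite_atLeastLessThan] using z by (intro prod.cong wv) (auto simp: Y_def)
    finally show ?thesis
      using \<Lambda>(2)[of z] z ed by (simp add: R_def exp_diff Y_def eq_divide_eq)
  qed
  have agree: "v 0 z = R z" if "z \<in> M - c0" for z
    using Gd[OF that] by (simp add: G_def R_def split algebra_simps)
  define L where "L z = (if z \<in> C 0 then R z else v 0 z)" for z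
  have overlap: "(M - C 0) \<inter> Y \<subseteq> M - c0"
    using n(4) p(3) unfolding Y_def C_def[symmetric] split by blast
  \<comment> \<open>An inner point of the first arc lies on no other arc, the curve being simple, so
    only the two end vertices remain uncovered.\<close>
  have cover: "M - {a 0, a 1} \<subseteq> (M - C 0) \<union> Y"
  proof
    fix z assume z: "z \<in> M - {a 0, a 1}"
    show "z \<in> (M - C 0) \<union> Y"
    proof (cases "z \<in> C 0")
      case True
      then obtain t where t: "0 \<le> t" "t \<le> 1 / n" "z = p t" by (auto simp: C_def)
      have "t \<noteq> 0" "t \<noteq> 1 / n" using z t(3) by (auto simp: a_def)
      then have t': "0 < t" "t < 1 / n" using t by auto
      have "1 / real n \<le> 1" using n0 by simp
      then have t1: "t < 1" using t'(2) by linarith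
      have notC: "z \<notin> C i" if i: "i \<in> {1..<n}" for i
      proof
        assume "z \<in> C i"
        then obtain s where s: "real i / n \<le> s" "s \<le> real (Suc i) / n" "z = p s" by (auto simp: C_def)
        have "1 / n \<le> real i / n" using i by (intro divide_right_mono) auto
        then have s': "1 / n \<le> s" using s(1) by linarith
        have "real (Suc i) / n \<le> 1" using bounds(2)[of i] i unfolding atLeastAtMost_iff by simp
        then have s1: "s \<le> 1" using s(2) by linarith
        have "0 < 1 / real n" using n0 by simp
        then have s0: "0 \<le> s" using s' by linarith
        show False
        proof (cases "s = 1")
          case True
          then have "z = a 0" using s(3) p(2) by (simp add: a_def pathstart_def pathfinish_def)
          then show False using z by simp
        next
          case False
          then have "s = t" using simple_path_inj[OF p(1), of s t] s(3) t(3) s0 s1 t'(1) t1 by auto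
          then show False using s' t'(2) by simp
        qed
      qed
      have "z \<notin> F"
      proof
        assume "z \<in> F"
        then obtain i where i: "i < n" "z = a i" by (auto simp: F_def)
        then have "i \<noteq> 0" using z by (cases "i = 0") auto
        then show False using notC[of i] i aC(1)[OF i(1)] by auto
      qed
      then show ?thesis using z notC by (auto simp: Y_def)
    qed (use z in auto)
  qed
  have Lc: "continuous_on (M - {a 0, a 1}) L"
  proof (rule continuous_on_open_cover2)
    show "openin (top_of_set (M - {a 0, a 1})) (M - C 0)"
      by (rule openin_subset_trans[OF openin_diff_compact[OF Ccomp[OF n0]]]) (use aC[OF n0] in auto)
    have a1: "a 1 \<in> F" using aSF[OF n0] by simp
    have "a 0 \<in> F" using n0 by (auto simp: F_def)
    with a1 show "openin (top_of_set (M - {a 0, a 1})) Y"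
      by (intro openin_subset_trans[OF Yop]) (auto simp: Y_def)
    show "M - {a 0, a 1} \<subseteq> (M - C 0) \<union> Y" by (rule cover)
    show "continuous_on (M - C 0) L"
      by (rule continuous_on_eq[OF v[OF n0]]) (simp add: L_def)
    show "continuous_on Y L"
    proof (rule continuous_on_eq[OF Rc])
      fix z assume "z \<in> Y"
      then show "R z = L z" using agree[of z] overlap by (auto simp: L_def Y_def)
    qed
  qed
  have Lexp: "w 0 z = exp (L z)" if "z \<in> M - {a 0, a 1}" for z
  proof (cases "z \<in> C 0")
    case True
    then show ?thesis using cover that Rexp by (auto simp: L_def)
  next
    case False
    then show ?thesis using wv[OF n0, of z] that by (simp add: L_def)
  qed

  \<comment> \<open>Contradiction on a small circle around the first vertex\<close>
  let ?\<kappa> = "\<kappa> 0"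
  have a01: "a 0 \<in> D 0" "a 1 \<in> D 0" "a 0 \<noteq> a 1"
    using aD[OF n0] a_inj[of 0 1] n(1) by auto
  have \<kappa>01: "?\<kappa> (a 0) \<noteq> ?\<kappa> (a 1)" using \<kappa>ne[OF n0 a01] .
  obtain \<psi> where \<psi>: "openin (top_of_set M) (U 0)" "open (?\<kappa> ` U 0)" "homeomorphism (U 0) (?\<kappa> ` U 0) ?\<kappa> \<psi>"
    by (rule complex_chartE[OF chart[OF n0]])
  have UM: "U 0 \<subseteq> M" using \<psi>(1) openin_imp_subset by blast
  have "open (?\<kappa> ` U 0 \<inter> ball (c 0) (r 0))" using \<psi>(2) by auto
  moreover have "?\<kappa> (a 0) \<in> ?\<kappa> ` U 0 \<inter> ball (c 0) (r 0)" using a01(1) by (auto simp: D_def)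
  ultimately obtain \<rho> where \<rho>: "0 < \<rho>" "cball (?\<kappa> (a 0)) \<rho> \<subseteq> ?\<kappa> ` U 0 \<inter> ball (c 0) (r 0)"
    using open_contains_cball by metis
  \<comment> \<open>The circle has to stay in the disc where \<open>w 0\<close> is the plain
    quotient and must not enclose the other end of the arc.\<close>
  define \<rho>' where "\<rho>' = min \<rho> (dist (?\<kappa> (a 0)) (?\<kappa> (a 1)) / 2)"
  have \<rho>': "0 < \<rho>'" "\<rho>' \<le> \<rho>" "\<rho>' < dist (?\<kappa> (a 0)) (?\<kappa> (a 1))"
    using \<rho>(1) \<kappa>01 by (auto simp: \<rho>'_def min_def field_simps)
  let ?S = "sphere (?\<kappa> (a 0)) \<rho>'"
  have S: "?S \<subseteq> ?\<kappa> ` U 0" "?S \<subseteq> ball (c 0) (r 0)" using \<rho>(2) \<rho>'(2) by (auto simp: subset_eq)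
  have \<psi>S: "\<psi> y \<in> D 0" "?\<kappa> (\<psi> y) = y" "\<psi> y \<in> M - {a 0, a 1}" if y: "y \<in> ?S" for y
  proof -
    have yU: "y \<in> ?\<kappa> ` U 0" "y \<in> ball (c 0) (r 0)" using S y by blast+
    show k: "?\<kappa> (\<psi> y) = y" using \<psi>(3) yU(1) by (rule homeomorphism_apply2)
    have u: "\<psi> y \<in> U 0" using homeomorphism_image2[OF \<psi>(3)] yU(1) by blast
    then show "\<psi> y \<in> D 0" using k yU(2) by (simp add: D_def)
    have "y \<noteq> ?\<kappa> (a 0)" "y \<noteq> ?\<kappa> (a 1)" using y \<rho>' by auto
    then show "\<psi> y \<in> M - {a 0, a 1}" using u UM k by auto
  qed
  have \<psi>c: "continuous_on ?S \<psi>" using \<psi>(3) S(1) by (meson continuous_on_subset homeomorphism_cont2)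
  have "continuous_on ?S (\<lambda>y. L (\<psi> y))"
    by (rule continuous_on_compose2[OF Lc \<psi>c]) (rule image_subsetI, rule \<psi>S(3))
  then have "continuous_on ?S (\<lambda>y. - L (\<psi> y))" by (rule continuous_on_minus)
  moreover have "(y - ?\<kappa> (a 0)) / (y - ?\<kappa> (a 1)) = exp (- L (\<psi> y))" if y: "y \<in> ?S" for y
  proof -
    have "exp (L (\<psi> y)) = (y - ?\<kappa> (a 1)) / (y - ?\<kappa> (a 0))"
      using Lexp[OF \<psi>S(3)[OF y]] wD[OF n0, of "\<psi> y"] \<psi>S(1,2)[OF y] unfolding D_def by simp
    then show ?thesis by (simp add: exp_minus)
  qed
  ultimately have 1: "has_log ?S (\<lambda>y. (y - ?\<kappa> (a 0)) / (y - ?\<kappa> (a 1)))"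
    unfolding has_log_def by (intro exI[of _ "\<lambda>y. - L (\<psi> y)"]) blast
  \<comment> \<open>The numerator has a logarithm because the circle leaves out
    \<open>?\<kappa> (a 1)\<close>; so \<open>L\<close> would provide one for the distance vector
    from the centre.\<close>
  have 2: "has_log ?S (\<lambda>y. y - ?\<kappa> (a 1))"
  proof -
    let ?m = "?\<kappa> (a 0) - ?\<kappa> (a 1)"
    have m: "?m \<noteq> 0" using \<kappa>01 by simp
    have cc: "continuous_on ?S (\<lambda>y. (y - ?\<kappa> (a 1)) / ?m)" using m by (intro continuous_intros) auto
    have dd: "dist ((y - ?\<kappa> (a 1)) / ?m) 1 < 1" if "y \<in> ?S" for y
    proof -
      have "(y - ?\<kappa> (a 1)) / ?m - 1 = (y - ?\<kappa> (a 0)) / ?m" using m by (simp add: field_simps)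
      then have "dist ((y - ?\<kappa> (a 1)) / ?m) 1 = \<rho>' / dist (?\<kappa> (a 0)) (?\<kappa> (a 1))"
        using that by (simp add: dist_norm norm_divide norm_minus_commute)
      also have "\<dots> < 1" using \<rho>'(3) \<kappa>01 by simp
      finally show ?thesis .
    qed
    show ?thesis unfolding has_log_def
    proof (intro exI conjI ballI)
      show "continuous_on ?S (\<lambda>y. Ln ((y - ?\<kappa> (a 1)) / ?m) + Ln ?m)"
        by (intro continuous_intros has_log_near_1(1)[OF cc dd])
      show "y - ?\<kappa> (a 1) = exp (Ln ((y - ?\<kappa> (a 1)) / ?m) + Ln ?m)" if y: "y \<in> ?S" for y
        using has_log_near_1(2)[OF cc dd y] m by (simp add: exp_add)
    qed
  qed
  have "has_log ?S (\<lambda>y. y - ?\<kappa> (a 0))"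
    by (rule has_log_mult[OF 1 2]) (use \<rho>' in auto)
  then show False using no_log_on_circle[OF \<rho>'(1)] by blast
qed

end

text \<open>A positive supremum is exceeded by no bound 0, so some nonseparating family is nonempty,
  and any of its curves supplies the essential map.\<close>

lemma (in compact_manifold) infinite_dim_of_genus:
  assumes "CARD('n) = 2" and bd: "boundary = {}" and g: "0 < genus M"
  shows "\<not> vectorspace.fin_dim real_ring (bounded_cohomology (Homeo0 k M \<A>) 1 2)"
proof -
  obtain i j :: 'n where ij: "UNIV = {i, j}" "i \<noteq> j" using assms(1) unfolding card_2_iff by blast
  define l where "l = (if k = i then j else i)"
  have "k = i \<or> k = j" using ij(1) by blast
  then have l: "k \<noteq> l" "UNIV = {k, l}" unfolding ij(1) using ij(2) by (auto simp: l_def)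
  interpret closed_surface k M \<A> l
  proof
    show "boundary = {}" "k \<noteq> l" "UNIV = {k, l}" by (fact bd, fact l(1), fact l(2))
  qed
  obtain e where e: "0 < e" "e \<in> {enat (card \<C>) | \<C>. finite \<C> \<and> pairwise disjnt \<C> \<and>
     (\<forall>c\<in>\<C>. \<exists>p. simple_path p \<and> pathfinish p = pathstart p \<and> path_image p = c \<and> c \<subseteq> M) \<and>
     connected (M - \<Union>\<C>)}"
    using g unfolding genus_def less_Sup_iff by blast
  from e(2) obtain \<C> where C: "e = enat (card \<C>)" "finite \<C>" "connected (M - \<Union>\<C>)"
    and curves: "\<forall>c\<in>\<C>. simple_closed_curve c"
    unfolding simple_closed_curve_def[symmetric] by (elim CollectE exE conjE) (rule that)
  have "\<C> \<noteq> {}" using C(1) e(1) by (auto simp: zero_enat_def)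
  then obtain c where "c \<in> \<C>" by blast
  then obtain u where u: "continuous_on M u" "\<And>z. z \<in> M \<Longrightarrow> u z \<noteq> 0" "\<not> has_log M u"
    using essential_map_exists[OF C(2) bspec[OF curves] C(3)] by blast
  interpret essential_map k M \<A> u
  proof
    show "boundary = {}" "2 \<le> CARD('n)" using bd assms(1) by simp_all
  qed (fact u)+
  show ?thesis by (rule infinite_dim_cohomology)
qed

subsection \<open>The two cases\<close>

theorem corollary1p10:
  fixes k :: "'n::finite"
    and M :: "'m::t2_space set"
    and \<A> :: "('m set \<times> ('m \<Rightarrow> real ^ 'n)) set"
    and x :: 'm
  assumes "compact_connected_oriented_manifold k M \<A>"
    and "x \<in> M"
    and "(CARD('n) = 2 \<and> manifold_boundary k \<A> = {} \<and> 0 < genus M) \<or>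
         (3 \<le> CARD('n) \<and>
          infinitely_many_independent_homogeneous_quasimorphisms
            (fundamental_group M x Mod group_centre (fundamental_group M x)))"
  shows "\<not> vectorspace.fin_dim real_ring (bounded_cohomology (Homeo0 k M \<A>) 1 2)"
proof -
  interpret compact_manifold k M \<A> by unfold_locales (rule assms(1))
  show ?thesis
    using assms(3)
  proof
    assume "CARD('n) = 2 \<and> boundary = {} \<and> 0 < genus M"
    then show ?thesis by (intro infinite_dim_of_genus) auto
  next
    assume "3 \<le> CARD('n) \<and> infinitely_many_independent_homogeneous_quasimorphisms
      (fundamental_group M x Mod group_centre (fundamental_group M x))"
    then show ?thesis by (intro infinite_dim_of_quasimorphisms[OF assms(2)]) blast
  qed
qed

end
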